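(* Let $\{\mathcal F,\mathcal G\}$ be a minimal Hilbert C*-system with $\mathcal G$ nonabelian and such that the fixed point algebra $\mathcal A$, with center $\mathcal Z$, satisfies Property B. Let $\lambda$ be a canonical endomorphism of $\mathcal A$. Then its action on $\mathcal Z$ is described by $$\lambda(Z)=\sum_{[D]}\alpha_{[D]}(Z)\cdot\Big(\sum_{D'\in[D]}E_{D'}\Big),\qquad Z\in\mathcal Z,$$ where $E_{D'}$ is the isotypical projection (of $\lambda$) with respect to $D'\in\widehat{\mathcal G}$.
   Context: C*-algebras are unital. An algebraic Hilbert space in $\mathcal F$ is a finite-dimensional subspace $\mathcal H\subset\mathcal F$ with $A^*B\in\mathbb C\mathbf 1$ for $A,B\in\mathcal H$, with scalar product $\langle A,B\rangle\mathbf 1=A^*B$; all algebraic Hilbert spaces are assumed to have support $\sum_j\Phi_j\Phi_j^*=\mathbf 1$ ($\{\Phi_j\}$ an orthonormal basis). Let $\mathcal G$ be a compact group acting on $\mathcal F$ by a pointwise norm-continuous homomorphism $\alpha:\mathcal G\to\mathrm{Aut}\,\mathcal F$. For $D\in\widehat{\mathcal G}$ (equivalence classes of irreducible unitary representations) put $\Pi_D(F)=\int_{\mathcal G}\overline{\chi_D(g)}\,\alpha_g(F)\,dg$, $\chi_D(g)=\dim D\cdot\mathrm{Tr}\,\pi(g)$, $\pi\in D$. The system is a Hilbert C*-system if for each $D\in\widehat{\mathcal G}$ there is an $\alpha_{\mathcal G}$-invariant algebraic Hilbert space $\mathcal H_D\subset\Pi_D\mathcal F$ carrying a unitary representation of class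 $D$. One identifies $\mathcal G$ with $\alpha_{\mathcal G}$ and writes $\{\mathcal F,\mathcal G\}$; $\mathcal A$ is the fixed point algebra and $\mathcal Z=\mathcal A'\cap\mathcal A$. Minimal: $\mathcal A'\cap\mathcal F=\mathcal Z$. Property B: $\mathcal A$ contains isometries $V,W$ with $VV^*+WW^*=\mathbf 1$. For a $\mathcal G$-invariant algebraic Hilbert space $\mathcal H$, $\rho_{\mathcal H}(A)=\sum_j\Phi_jA\Phi_j^*$ is the canonical endomorphism of $\mathcal A$; $\rho_D:=\rho_{\mathcal H_D}$. $(\sigma,\tau)=\{X\in\mathcal A:X\sigma(A)=\tau(A)X\ \forall A\in\mathcal A\}$. The restriction $\alpha_D:=\rho_D|_{\mathcal Z}$ is an automorphism of $\mathcal Z$. Chain classes: for $D_1,D_2\in\widehat{\mathcal G}$, $D_1\times D_2$ is the set of classes appearing in the decomposition of $U_{D_1}\otimes U_{D_2}$, $U_{D_i}\in D_i$ (extended to subsets by unions). $D\approx D'$ if there are $D_1,\dots,D_n$ with $D,D'\in D_1\times\dots\times D_n$; $[D]$ is the equivalence class. $\alpha_D$ depends only on $[D]$ and is denoted $\alpha_{[D]}$. Isotypical projections: if $\lambda=\rho_{\mathcal H}$, and $\{W_{D,j}\}_j$ is an orthonormal basis of $(\rho_D,\lambda)$ (i.e. $W_{D,j}^*W_{D,k}=\delta_{jk}\mathbf 1$ and the $W_{D,j}$ generate $(\rho_D,\lambda)$ as a right $\rho_D(\mathcal Z)$-module; it is empty if $D$ does not occur in the representation of $\mathcal G$ on $\mathcal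 H$), then $E_D:=\sum_jW_{D,j}W_{D,j}^*$, with $E_D=0$ if $D$ does not occur. One has $\lambda(A)=\sum_{D,j}W_{D,j}\rho_D(A)W_{D,j}^*$. The outer sum in the claim is over the chain classes of the finitely many $D$ that occur. *)

theory Defs
  imports "HOL-Analysis.Bochner_Integration" "Jordan_Normal_Form.Schur_Decomposition"
begin

section \<open>Unital C*-algebras\<close>

class cstar_algebra = real_normed_algebra_1 + banach +
  fixes scaleC :: "complex \<Rightarrow> 'a \<Rightarrow> 'a" (infixr "*\<^sub>C" 75)
    and adj :: "'a \<Rightarrow> 'a"
  assumes scaleC_add_right: "c *\<^sub>C (x + y) = c *\<^sub>C x + c *\<^sub>C y"
    and scaleC_add_left: "(c + d) *\<^sub>C x = c *\<^sub>C x + d *\<^sub>C x"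
    and scaleC_scaleC: "c *\<^sub>C d *\<^sub>C x = (c * d) *\<^sub>C x"
    and scaleC_of_real: "complex_of_real r *\<^sub>C x = r *\<^sub>R x"
    and mult_scaleC_left: "(c *\<^sub>C x) * y = c *\<^sub>C (x * y)"
    and mult_scaleC_right: "x * (c *\<^sub>C y) = c *\<^sub>C (x * y)"
    and norm_scaleC: "norm (c *\<^sub>C x) = cmod c * norm x"
    and adj_add: "adj (x + y) = adj x + adj y"
    and adj_scaleC: "adj (c *\<^sub>C x) = cnj c *\<^sub>C adj x"
    and adj_mult: "adj (x * y) = adj y * adj x"
    and adj_adj: "adj (adj x) = x"
    and cstar_identity: "norm (adj x * x) = (norm x)\<^sup>2"

global_interpretation complex_vs:
  Vector_Spaces.vector_space "scaleC :: complex \<Rightarrow> 'a \<Rightarrow> 'a::cstar_algebra"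
proof
  show "1 *\<^sub>C x = x" for x :: 'a
    using scaleC_of_real[of 1 x] by simp
qed (simp_all add: scaleC_add_right scaleC_add_left scaleC_scaleC)

definition star_automorphism :: "('a::cstar_algebra \<Rightarrow> 'a) \<Rightarrow> bool" where
  "star_automorphism f \<longleftrightarrow> bij f \<and>
     (\<forall>x y. f (x + y) = f x + f y) \<and> (\<forall>c x. f (c *\<^sub>C x) = c *\<^sub>C f x) \<and>
     (\<forall>x y. f (x * y) = f x * f y) \<and> (\<forall>x. f (adj x) = adj (f x))"

definition is_isometry :: "'a::cstar_algebra \<Rightarrow> bool" where
  "is_isometry v \<longleftrightarrow> adj v * v = 1"

definition property_B :: "'a::cstar_algebra set \<Rightarrow> bool" where
  "property_B A \<longleftrightarrow>
     (\<exists>V\<in>A. \<exists>W\<in>A. is_isometry V \<and> is_isometry W \<and> V * adj V + W * adj W = 1)"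

definition commutant :: "'a::cstar_algebra set \<Rightarrow> 'a set" where
  "commutant A = {x. \<forall>a\<in>A. x * a = a * x}"


section \<open>Algebraic Hilbert spaces and canonical endomorphisms\<close>

definition alg_inner :: "'a::cstar_algebra \<Rightarrow> 'a \<Rightarrow> complex" where
  "alg_inner A B = (THE c. adj A * B = c *\<^sub>C 1)"

definition orthonormal_basis :: "'a::cstar_algebra set \<Rightarrow> 'a list \<Rightarrow> bool" where
  "orthonormal_basis H \<Phi> \<longleftrightarrow> complex_vs.span (set \<Phi>) = H \<and>
     (\<forall>i<length \<Phi>. \<forall>j<length \<Phi>. alg_inner (\<Phi> ! i) (\<Phi> ! j) = (if i = j then 1 else 0))"

text \<open>As throughout the theory, the support is required to be the unit.\<close>

definition algebraic_hilbert_space :: "'a::cstar_algebra set \<Rightarrow> bool" where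
  "algebraic_hilbert_space H \<longleftrightarrow>
     complex_vs.subspace H \<and> (\<exists>B. finite B \<and> complex_vs.span B = H) \<and>
     (\<forall>A\<in>H. \<forall>B\<in>H. \<exists>c. adj A * B = c *\<^sub>C 1) \<and>
     (\<exists>\<Phi>. orthonormal_basis H \<Phi> \<and> (\<Sum>\<phi>\<leftarrow>\<Phi>. \<phi> * adj \<phi>) = 1)"

text \<open>The value is the same for every orthonormal basis.\<close>

definition canonical_endo :: "'a::cstar_algebra set \<Rightarrow> 'a \<Rightarrow> 'a" where
  "canonical_endo H A =
     (THE Y. \<exists>\<Phi>. orthonormal_basis H \<Phi> \<and> Y = (\<Sum>\<phi>\<leftarrow>\<Phi>. \<phi> * A * adj \<phi>))"


section \<open>Unitary representations of a group and its dual\<close>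

text \<open>
  Groups are written additively, because the topological groups of the library are
  (\<^class>\<open>topological_group_add\<close> does not assume commutativity). The irreducible unitary
  representations of a compact group are finite-dimensional, so they are taken to be matrix
  representations on the spaces of complex column vectors.
\<close>

type_synonym 'g rep = "'g \<Rightarrow> complex mat"

definition unitary_mat :: "nat \<Rightarrow> complex mat \<Rightarrow> bool" where
  "unitary_mat n U \<longleftrightarrow> U \<in> carrier_mat n n \<and>
     mat_adjoint U * U = 1\<^sub>m n \<and> U * mat_adjoint U = 1\<^sub>m n"

definition unitary_rep :: "nat \<Rightarrow> 'g::topological_group_add rep \<Rightarrow> bool" where
  "unitary_rep n \<pi> \<longleftrightarrow> (\<forall>g. unitary_mat n (\<pi> g)) \<and> (\<forall>g h. \<pi> (g + h) = \<pi> g * \<pi> h) \<and>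
     (\<forall>i<n. \<forall>j<n. continuous_on UNIV (\<lambda>g. \<pi> g $$ (i, j)))"

definition irreducible_rep :: "nat \<Rightarrow> 'g::topological_group_add rep \<Rightarrow> bool" where
  "irreducible_rep n \<pi> \<longleftrightarrow> unitary_rep n \<pi> \<and> n > 0 \<and>
     (\<forall>W. VectorSpace.subspace class_ring W (module_vec TYPE(complex) n) \<and>
          (\<forall>g. \<forall>w\<in>W. \<pi> g *\<^sub>v w \<in> W) \<longrightarrow> W = {0\<^sub>v n} \<or> W = carrier_vec n)"

definition irreps :: "'g::topological_group_add rep set" where
  "irreps = {\<pi>. \<exists>n. irreducible_rep n \<pi>}"

definition rep_equiv :: "'g rep \<Rightarrow> 'g rep \<Rightarrow> bool" where
  "rep_equiv \<pi> \<pi>' \<longleftrightarrow> (\<exists>n U. (\<forall>g. \<pi> g \<in> carrier_mat n n \<and> \<pi>' g \<in> carrier_mat n n) \<and>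
     unitary_mat n U \<and> (\<forall>g. U * \<pi> g = \<pi>' g * U))"

definition group_dual :: "'g::topological_group_add rep set set" where
  "group_dual = irreps // {(\<pi>, \<pi>'). \<pi> \<in> irreps \<and> \<pi>' \<in> irreps \<and> rep_equiv \<pi> \<pi>'}"

text \<open>\<open>D\<close> appears in the decomposition of \<open>U\<close> into irreducible representations.\<close>

definition occurs_in_rep :: "'g::topological_group_add rep set \<Rightarrow> 'g rep \<Rightarrow> bool" where
  "occurs_in_rep D U \<longleftrightarrow> (\<exists>\<pi>s. set \<pi>s \<subseteq> irreps \<and>
     rep_equiv U (\<lambda>g. diag_block_mat (map (\<lambda>\<pi>. \<pi> g) \<pi>s)) \<and> (\<exists>\<pi>\<in>set \<pi>s. \<pi> \<in> D))"

definition kronecker :: "complex mat \<Rightarrow> complex mat \<Rightarrow> complex mat" where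
  "kronecker A B = mat (dim_row A * dim_row B) (dim_col A * dim_col B)
     (\<lambda>(i, j). A $$ (i div dim_row B, j div dim_col B) * B $$ (i mod dim_row B, j mod dim_col B))"

definition class_product ::
  "'g::topological_group_add rep set \<Rightarrow> 'g rep set \<Rightarrow> 'g rep set set" where
  "class_product D\<^sub>1 D\<^sub>2 = {D \<in> group_dual.
     \<exists>U\<^sub>1\<in>D\<^sub>1. \<exists>U\<^sub>2\<in>D\<^sub>2. occurs_in_rep D (\<lambda>g. kronecker (U\<^sub>1 g) (U\<^sub>2 g))}"

definition class_set_product ::
  "'g::topological_group_add rep set set \<Rightarrow> 'g rep set set \<Rightarrow> 'g rep set set" where
  "class_set_product S T = (\<Union>D\<^sub>1\<in>S. \<Union>D\<^sub>2\<in>T. class_product D\<^sub>1 D\<^sub>2)"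

text \<open>Only products of at least one factor are used; the first equation is a dummy.\<close>

fun chain_product :: "'g::topological_group_add rep set list \<Rightarrow> 'g rep set set" where
  "chain_product [] = {}"
| "chain_product [D] = {D}"
| "chain_product (D # E # Ds) = class_set_product {D} (chain_product (E # Ds))"

definition chain_equiv :: "'g::topological_group_add rep set \<Rightarrow> 'g rep set \<Rightarrow> bool" where
  "chain_equiv D D' \<longleftrightarrow> (\<exists>Ds. Ds \<noteq> [] \<and> set Ds \<subseteq> group_dual \<and>
     D \<in> chain_product Ds \<and> D' \<in> chain_product Ds)"

definition chain_class :: "'g::topological_group_add rep set \<Rightarrow> 'g rep set set" where
  "chain_class D = {D' \<in> group_dual. chain_equiv D D'}"


section \<open>Haar measure and spectral projections\<close>

definition normalized_haar_measure :: "'g::{topological_group_add, t2_space} measure \<Rightarrow> bool" where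
  "normalized_haar_measure \<mu> \<longleftrightarrow> sets \<mu> = sets borel \<and> emeasure \<mu> UNIV = 1 \<and>
     (\<forall>g. distr \<mu> borel (\<lambda>h. g + h) = \<mu>) \<and>
     (\<forall>A\<in>sets borel. emeasure \<mu> A = (SUP K\<in>{K. compact K \<and> K \<subseteq> A}. emeasure \<mu> K))"

text \<open>
  The Bochner integral exactly as in \<^const>\<open>has_bochner_integral\<close>, which cannot be used itself
  because of its sort constraint: the C*-algebra need not be separable.
\<close>

definition has_vector_integral ::
  "'a measure \<Rightarrow> ('a \<Rightarrow> 'b::real_normed_vector) \<Rightarrow> 'b \<Rightarrow> bool" where
  "has_vector_integral M f x \<longleftrightarrow> f \<in> borel_measurable M \<and>
     (\<exists>s. (\<forall>i. Bochner_Integration.simple_bochner_integrable M (s i)) \<and>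
          (\<lambda>i::nat. \<integral>\<^sup>+ y. ennreal (norm (f y - s i y)) \<partial>M) \<longlonglongrightarrow> 0 \<and>
          (\<lambda>i. Bochner_Integration.simple_bochner_integral M (s i)) \<longlonglongrightarrow> x)"

definition mat_trace :: "complex mat \<Rightarrow> complex" where
  "mat_trace M = (\<Sum>i<dim_row M. M $$ (i, i))"

text \<open>The character carries the extra factor \<open>dim D\<close>.\<close>

definition class_character :: "'g::topological_group_add rep set \<Rightarrow> 'g \<Rightarrow> complex" where
  "class_character D g = (THE c. \<forall>\<pi>\<in>D. c = of_nat (dim_row (\<pi> g)) * mat_trace (\<pi> g))"

definition spectral_projection ::
  "'g::topological_group_add measure \<Rightarrow> ('g \<Rightarrow> 'f \<Rightarrow> 'f) \<Rightarrow> 'g rep set \<Rightarrow>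
   'f::cstar_algebra \<Rightarrow> 'f" where
  "spectral_projection \<mu> \<alpha> D F =
     (THE P. has_vector_integral \<mu> (\<lambda>g. cnj (class_character D g) *\<^sub>C \<alpha> g F) P)"


section \<open>Hilbert C*-systems\<close>

definition continuous_action ::
  "('g::topological_group_add \<Rightarrow> 'f \<Rightarrow> 'f::cstar_algebra) \<Rightarrow> bool" where
  "continuous_action \<alpha> \<longleftrightarrow> (\<forall>g. star_automorphism (\<alpha> g)) \<and> (\<forall>g h. \<alpha> (g + h) = \<alpha> g \<circ> \<alpha> h) \<and>
     (\<forall>F. continuous_on UNIV (\<lambda>g. \<alpha> g F))"

definition invariant_subset :: "('g \<Rightarrow> 'f \<Rightarrow> 'f) \<Rightarrow> 'f set \<Rightarrow> bool" where
  "invariant_subset \<alpha> H \<longleftrightarrow> (\<forall>g. \<alpha> g ` H \<subseteq> H)"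

text \<open>Matrix of the action restricted to the Hilbert space with orthonormal basis \<open>\<Phi>\<close>.\<close>

definition carried_rep :: "('g \<Rightarrow> 'f \<Rightarrow> 'f::cstar_algebra) \<Rightarrow> 'f list \<Rightarrow> 'g rep" where
  "carried_rep \<alpha> \<Phi> =
     (\<lambda>g. mat (length \<Phi>) (length \<Phi>) (\<lambda>(i, j). alg_inner (\<Phi> ! i) (\<alpha> g (\<Phi> ! j))))"

text \<open>
  The spaces \<open>HD D\<close> are part of the data, since the endomorphisms \<open>\<rho>\<^sub>D\<close>
  refer to them.
\<close>

definition hilbert_cstar_system ::
  "'g::{topological_group_add, t2_space} measure \<Rightarrow> ('g \<Rightarrow> 'f \<Rightarrow> 'f::cstar_algebra) \<Rightarrow>
   ('g rep set \<Rightarrow> 'f set) \<Rightarrow> bool" where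
  "hilbert_cstar_system \<mu> \<alpha> HD \<longleftrightarrow>
     compact (UNIV :: 'g set) \<and> normalized_haar_measure \<mu> \<and> continuous_action \<alpha> \<and>
     (\<forall>D\<in>group_dual. algebraic_hilbert_space (HD D) \<and> invariant_subset \<alpha> (HD D) \<and>
        HD D \<subseteq> range (spectral_projection \<mu> \<alpha> D) \<and>
        (\<exists>\<Phi>. orthonormal_basis (HD D) \<Phi> \<and> carried_rep \<alpha> \<Phi> \<in> D))"

definition fixed_algebra :: "('g \<Rightarrow> 'f \<Rightarrow> 'f::cstar_algebra) \<Rightarrow> 'f set" where
  "fixed_algebra \<alpha> = {F. \<forall>g. \<alpha> g F = F}"

definition fixed_center :: "('g \<Rightarrow> 'f \<Rightarrow> 'f::cstar_algebra) \<Rightarrow> 'f set" where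
  "fixed_center \<alpha> = commutant (fixed_algebra \<alpha>) \<inter> fixed_algebra \<alpha>"

definition minimal_system :: "('g \<Rightarrow> 'f \<Rightarrow> 'f::cstar_algebra) \<Rightarrow> bool" where
  "minimal_system \<alpha> \<longleftrightarrow> commutant (fixed_algebra \<alpha>) = fixed_center \<alpha>"

definition intertwiners ::
  "('g \<Rightarrow> 'f \<Rightarrow> 'f::cstar_algebra) \<Rightarrow> ('f \<Rightarrow> 'f) \<Rightarrow> ('f \<Rightarrow> 'f) \<Rightarrow> 'f set" where
  "intertwiners \<alpha> \<sigma> \<tau> =
     {X \<in> fixed_algebra \<alpha>. \<forall>A\<in>fixed_algebra \<alpha>. X * \<sigma> A = \<tau> A * X}"

text \<open>\<open>\<alpha>\<^sub>[\<^sub>D\<^sub>]\<close>: the common restriction to the centre of the \<open>\<rho>\<^sub>D\<close> with \<open>D\<close> in the chain class \<open>c\<close>.\<close>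

definition class_automorphism ::
  "('g rep set \<Rightarrow> 'f set) \<Rightarrow> 'g rep set set \<Rightarrow> 'f \<Rightarrow> 'f::cstar_algebra" where
  "class_automorphism HD c Z = (THE Y. \<forall>D\<in>c. Y = canonical_endo (HD D) Z)"

definition occurring ::
  "('g::topological_group_add \<Rightarrow> 'f \<Rightarrow> 'f::cstar_algebra) \<Rightarrow> 'f set \<Rightarrow> 'g rep set set" where
  "occurring \<alpha> H = {D \<in> group_dual.
     \<exists>\<Phi>. orthonormal_basis H \<Phi> \<and> occurs_in_rep D (carried_rep \<alpha> \<Phi>)}"

definition intertwiner_basis ::
  "('g \<Rightarrow> 'f \<Rightarrow> 'f::cstar_algebra) \<Rightarrow> ('f \<Rightarrow> 'f) \<Rightarrow> ('f \<Rightarrow> 'f) \<Rightarrow> 'f list \<Rightarrow> bool" where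
  "intertwiner_basis \<alpha> \<rho> \<tau> Ws \<longleftrightarrow>
     (\<forall>j<length Ws. \<forall>k<length Ws. adj (Ws ! j) * Ws ! k = (if j = k then 1 else 0)) \<and>
     intertwiners \<alpha> \<rho> \<tau> =
       {\<Sum>j<length Ws. Ws ! j * \<rho> (z j) | z. \<forall>j<length Ws. z j \<in> fixed_center \<alpha>}"

definition isotypical_projection ::
  "('g::topological_group_add \<Rightarrow> 'f \<Rightarrow> 'f::cstar_algebra) \<Rightarrow> ('g rep set \<Rightarrow> 'f set) \<Rightarrow>
   'f set \<Rightarrow> 'g rep set \<Rightarrow> 'f" where
  "isotypical_projection \<alpha> HD H D =
     (if D \<in> occurring \<alpha> H
      then THE E. \<exists>Ws. intertwiner_basis \<alpha> (canonical_endo (HD D)) (canonical_endo H) Ws \<and>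
                       E = (\<Sum>W\<leftarrow>Ws. W * adj W)
      else 0)"

end

(*
Write rho_H(A) = sum_i Phi_i A Phi_i^* for an orthonormal family Phi spanning H. Splitting the unitary
representation carried by H into irreducible blocks pi_k of class D_k and pairing the block of Phi
belonging to pi_k with an orthonormal basis of HD D_k on which the group acts by the same matrices gives
isometries W_k in the fixed point algebra with orthogonal ranges and
rho_H(A) = sum_k W_k rho_{D_k}(A) W_k^*.
By minimality the matrix entries Psi_j^* Y Phi_i of an intertwiner Y between rho_D and rho_E are central,
so, testing them with linear functionals, Schur's lemma gives Y = 0 for D distinct from E and
Y in rho_D(Z) for D = E. Hence the W_k with D_k = D form a basis of (rho_D, rho_H). Moreover rho_D maps
the centre into itself, so rho_{D_k}(z) commutes with W_k and
rho_H(z) = sum_D rho_D(z) E_D.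

It remains to group the classes D. If D is in D1 x D2, an isometry in (rho_D, rho_{D1} rho_{D2}) shows
that rho_D = rho_{D1} rho_{D2} on the centre, so rho_D(z) depends only on the chain class. That chain
classes partition the dual is seen on intertwiners as well: D is in D1 x D2 iff
(rho_D, rho_{D1} rho_{D2}) is nonzero, which makes the product of classes associative, and
D, D1 in P and D1, D2 in Q imply that D and D2 lie in P x conj(D1) x Q.
*)
theory Submission
  imports Defs "Jordan_Normal_Form.Spectral_Radius"
begin

section \<open>Unitary matrix representations\<close>

text \<open>The centre need not consist of scalars, so the matrix of an intertwiner has entries in
  \<open>\<Z>\<close>, and Schur's lemma for complex matrices can be used only after a complex
  linear functional has been applied to each entry; the relations in question are finite linear
  combinations of entries with complex coefficients, so algebraic functionals suffice. The delicate
  point is that \<open>\<rho> D\<close> maps the centre into itself. Schur's lemma alone gives the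
  opposite inclusion: a central element is an intertwiner from \<open>\<rho> D\<close> to itself,
  hence of the form \<open>\<rho> D b\<close>. The wanted inclusion is obtained from the opposite
  one for the conjugate class, since the adjoints of a basis of \<open>HD D\<close> transform like a
  basis for that class. Conjugates occur a second time in the transitivity of chain equivalence,
  where a class must be cancelled between two products. Products of classes are handled through
  intertwiners because these compose and do not depend on the choice of matrices, whereas
  reassociating Kronecker products and block decompositions would require explicit changes of
  basis.\<close>

lemma mat_adjoint_carrier [simp, intro]:
  "A \<in> carrier_mat n m \<Longrightarrow> mat_adjoint A \<in> carrier_mat m n"
  by (auto simp: mat_adjoint_def)

lemma mat_adjoint_dim [simp]:
  "dim_row (mat_adjoint A) = dim_col A" "dim_col (mat_adjoint A) = dim_row A"
  by (auto simp: mat_adjoint_def)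

lemma mat_adjoint_index [simp]:
  "i < dim_col A \<Longrightarrow> j < dim_row A \<Longrightarrow> mat_adjoint A $$ (i, j) = conjugate (A $$ (j, i))"
  by (simp add: mat_adjoint_def mat_of_rows_index)

lemma mult_mat_index:
  assumes "A \<in> carrier_mat n m" "B \<in> carrier_mat m k" "i < n" "j < k"
  shows "(A * B) $$ (i, j) = (\<Sum>l<m. A $$ (i, l) * B $$ (l, j))"
  using assms by (auto simp: scalar_prod_def lessThan_atLeast0)

lemma mult_vec_index:
  assumes "A \<in> carrier_mat n m" "v \<in> carrier_vec m" "i < n"
  shows "(A *\<^sub>v v) $ i = (\<Sum>l<m. A $$ (i, l) * v $ l)"
  using assms by (auto simp: scalar_prod_def lessThan_atLeast0)

lemma mat_adjoint_adjoint [simp]: "mat_adjoint (mat_adjoint A) = A"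
  by (rule eq_matI) auto

lemma mat_adjoint_one [simp]: "mat_adjoint (1\<^sub>m n :: complex mat) = 1\<^sub>m n"
  by (rule eq_matI) auto

lemma mat_adjoint_mult:
  assumes A: "(A :: complex mat) \<in> carrier_mat n m" and B: "B \<in> carrier_mat m k"
  shows "mat_adjoint (A * B) = mat_adjoint B * mat_adjoint A"
proof (rule eq_matI)
  have C: "mat_adjoint B \<in> carrier_mat k m" "mat_adjoint A \<in> carrier_mat m n"
    using A B by auto
  fix i j assume "i < dim_row (mat_adjoint B * mat_adjoint A)"
    "j < dim_col (mat_adjoint B * mat_adjoint A)"
  then have ij: "i < k" "j < n" using A B by auto
  then have "mat_adjoint (A * B) $$ (i, j) = cnj ((A * B) $$ (j, i))"
    using A B by (subst mat_adjoint_index) auto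
  then show "mat_adjoint (A * B) $$ (i, j) = (mat_adjoint B * mat_adjoint A) $$ (i, j)"
    using A B ij by (auto simp: mult_mat_index[OF A B] mult_mat_index[OF C] mult.commute
        simp del: index_mult_mat(1) intro!: sum.cong)
qed (use A B in auto)

lemma unitary_matI:
  assumes U: "U \<in> carrier_mat n n" and "mat_adjoint U * U = 1\<^sub>m n"
  shows "unitary_mat n U"
  unfolding unitary_mat_def
  using assms mat_mult_left_right_inverse[of "mat_adjoint U" n U] by auto

lemma unitary_mat_one: "unitary_mat n (1\<^sub>m n)"
  by (rule unitary_matI) auto

lemma unitary_mat_adjoint: "unitary_mat n U \<Longrightarrow> unitary_mat n (mat_adjoint U)"
  by (auto simp: unitary_mat_def)

lemma unitary_mat_mult:
  assumes "unitary_mat n U" "unitary_mat n V"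
  shows "unitary_mat n (U * V)"
proof (rule unitary_matI)
  have U: "U \<in> carrier_mat n n" "mat_adjoint U * U = 1\<^sub>m n"
    and V: "V \<in> carrier_mat n n" "mat_adjoint V * V = 1\<^sub>m n"
    using assms by (auto simp: unitary_mat_def)
  show "U * V \<in> carrier_mat n n" using U V by auto
  have A: "mat_adjoint U \<in> carrier_mat n n" "mat_adjoint V \<in> carrier_mat n n" using U V by auto
  have "mat_adjoint (U * V) * (U * V) = mat_adjoint V * (mat_adjoint U * (U * V))"
    unfolding mat_adjoint_mult[OF U(1) V(1)]
    using A U(1) V(1) by (intro assoc_mult_mat) auto
  also have "mat_adjoint U * (U * V) = mat_adjoint U * U * V"
    by (rule assoc_mult_mat[symmetric]) (use A U(1) V(1) in auto)
  finally show "mat_adjoint (U * V) * (U * V) = 1\<^sub>m n" using U V by simp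
qed

lemma rep_equivI:
  assumes "\<And>g. \<pi> g \<in> carrier_mat n n" "\<And>g. \<pi>' g \<in> carrier_mat n n"
    "unitary_mat n U" "\<And>g. U * \<pi> g = \<pi>' g * U"
  shows "rep_equiv \<pi> \<pi>'"
  using assms unfolding rep_equiv_def by blast

lemma rep_equivE:
  assumes "rep_equiv \<pi> \<pi>'"
  obtains n U where "\<And>g. \<pi> g \<in> carrier_mat n n" "\<And>g. \<pi>' g \<in> carrier_mat n n"
    "unitary_mat n U" "\<And>g. U * \<pi> g = \<pi>' g * U"
  using assms unfolding rep_equiv_def by blast

lemma rep_equiv_refl: "(\<And>g. \<pi> g \<in> carrier_mat n n) \<Longrightarrow> rep_equiv \<pi> \<pi>"
  using unitary_mat_one
  by (intro rep_equivI[of _ n _ "1\<^sub>m n"])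
    (simp_all add: left_mult_one_mat[of _ n n] right_mult_one_mat[of _ n n])

lemma rep_equiv_sym:
  assumes "rep_equiv \<pi> \<pi>'"
  shows "rep_equiv \<pi>' \<pi>"
proof -
  obtain n U where *: "\<And>g. \<pi> g \<in> carrier_mat n n" "\<And>g. \<pi>' g \<in> carrier_mat n n"
    "unitary_mat n U" "\<And>g. U * \<pi> g = \<pi>' g * U"
    using rep_equivE[OF assms] by metis
  have U: "U \<in> carrier_mat n n" "mat_adjoint U * U = 1\<^sub>m n" "U * mat_adjoint U = 1\<^sub>m n"
    "mat_adjoint U \<in> carrier_mat n n"
    using *(3) by (auto simp: unitary_mat_def)
  have "mat_adjoint U * \<pi>' g = \<pi> g * mat_adjoint U" for g
  proof -
    have "mat_adjoint U * \<pi>' g = mat_adjoint U * (\<pi>' g * (U * mat_adjoint U))"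
      using U(3) *(2)[of g] by simp
    also have "\<pi>' g * (U * mat_adjoint U) = \<pi>' g * U * mat_adjoint U"
      by (rule assoc_mult_mat[symmetric]) (use U *(2)[of g] in auto)
    also have "\<dots> = U * (\<pi> g * mat_adjoint U)"
      unfolding *(4)[symmetric] by (rule assoc_mult_mat) (use U *(1)[of g] in auto)
    also have "mat_adjoint U * \<dots> = mat_adjoint U * U * (\<pi> g * mat_adjoint U)"
      by (rule assoc_mult_mat[symmetric]) (use U *(1)[of g] in auto)
    finally show ?thesis using U *(1)[of g] by simp
  qed
  then show ?thesis
    using * unitary_mat_adjoint by (intro rep_equivI[of _ n _ "mat_adjoint U"]) auto
qed

lemma rep_equiv_trans:
  assumes "rep_equiv \<pi> \<pi>'" "rep_equiv \<pi>' \<pi>''"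
  shows "rep_equiv \<pi> \<pi>''"
proof -
  obtain n U where *: "\<And>g. \<pi> g \<in> carrier_mat n n" "\<And>g. \<pi>' g \<in> carrier_mat n n"
    "unitary_mat n U" "\<And>g. U * \<pi> g = \<pi>' g * U"
    using rep_equivE[OF assms(1)] by metis
  obtain m V where m: "\<And>g. \<pi>' g \<in> carrier_mat m m" "\<And>g. \<pi>'' g \<in> carrier_mat m m"
    "unitary_mat m V" "\<And>g. V * \<pi>' g = \<pi>'' g * V"
    using rep_equivE[OF assms(2)] by metis
  have "m = n" using m(1) *(2) by (metis carrier_matD(1))
  note m = m[unfolded this]
  have U: "U \<in> carrier_mat n n" "V \<in> carrier_mat n n"
    using *(3) m(3) by (auto simp: unitary_mat_def)
  have "(V * U) * \<pi> g = \<pi>'' g * (V * U)" for g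
  proof -
    have "(V * U) * \<pi> g = V * (\<pi>' g * U)"
      using U *(1)[of g] by (simp add: assoc_mult_mat[of _ n n _ n _ n] *(4))
    also have "\<dots> = (V * \<pi>' g) * U"
      using U *(2)[of g] by (simp add: assoc_mult_mat[of _ n n _ n _ n])
    also have "\<dots> = \<pi>'' g * (V * U)"
      using U m(2)[of g] by (simp add: assoc_mult_mat[of _ n n _ n _ n] m(4))
    finally show ?thesis .
  qed
  then show ?thesis
    using * m unitary_mat_mult by (intro rep_equivI[of _ n _ "V * U"]) auto
qed

text \<open>Irreducibility is defined with the subspaces of an abstract module; the closure
  conditions are the form in which eigenspaces and conjugated subspaces can be recognised as
  subspaces.\<close>

lemma complex_subspace_iff:
  "VectorSpace.subspace class_ring W (module_vec TYPE(complex) n) \<longleftrightarrow>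
     W \<subseteq> carrier_vec n \<and> 0\<^sub>v n \<in> W \<and> (\<forall>v\<in>W. \<forall>w\<in>W. v + w \<in> W) \<and> (\<forall>c. \<forall>v\<in>W. c \<cdot>\<^sub>v v \<in> W)"
  (is "?L = ?R")
proof
  assume ?L
  then interpret submodule class_ring W "module_vec TYPE(complex) n"
    by (simp add: VectorSpace.subspace_def)
  show ?R
    using subset m_closed zero_closed smult_closed
    by (auto simp: module_vec_simps class_ring_simps)
next
  assume R: ?R
  have "vectorspace class_ring (module_vec TYPE(complex) n)" by (rule vec_vs)
  moreover have "submodule class_ring W (module_vec TYPE(complex) n)"
    using R by (intro submodule.intro vec_module) (auto simp: module_vec_simps)
  ultimately show ?L by (simp add: VectorSpace.subspace_def)
qed

lemma irreducible_repD:
  assumes "irreducible_rep n \<pi>"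
    and "W \<subseteq> carrier_vec n" "0\<^sub>v n \<in> W" "\<And>v w. v \<in> W \<Longrightarrow> w \<in> W \<Longrightarrow> v + w \<in> W"
      "\<And>c v. v \<in> W \<Longrightarrow> c \<cdot>\<^sub>v v \<in> W" "\<And>g w. w \<in> W \<Longrightarrow> \<pi> g *\<^sub>v w \<in> W"
  shows "W = {0\<^sub>v n} \<or> W = carrier_vec n"
proof -
  have "VectorSpace.subspace class_ring W (module_vec TYPE(complex) n)"
    using assms(2-5) by (simp add: complex_subspace_iff)
  then show ?thesis using assms(1,6) by (simp add: irreducible_rep_def)
qed

lemma unitary_repD:
  assumes "unitary_rep n \<pi>"
  shows "\<pi> g \<in> carrier_mat n n" "mat_adjoint (\<pi> g) * \<pi> g = 1\<^sub>m n"
    "\<pi> g * mat_adjoint (\<pi> g) = 1\<^sub>m n" "\<pi> (g + h) = \<pi> g * \<pi> h"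
  using assms by (auto simp: unitary_rep_def unitary_mat_def)

lemma unitary_rep_zero:
  assumes "unitary_rep n \<pi>"
  shows "\<pi> 0 = 1\<^sub>m n"
proof -
  note D = unitary_repD[OF assms]
  have "\<pi> 0 = mat_adjoint (\<pi> 0) * \<pi> 0 * \<pi> 0"
    using D(1)[of 0] D(2)[of 0] by simp
  also have "\<dots> = mat_adjoint (\<pi> 0) * \<pi> (0 + 0)"
    unfolding D(4) using D(1)[of 0] by (intro assoc_mult_mat) auto
  finally show ?thesis using D(2) by simp
qed

lemma unitary_rep_uminus:
  assumes "unitary_rep n \<pi>"
  shows "\<pi> (- g) = mat_adjoint (\<pi> g)"
proof -
  note D = unitary_repD[OF assms]
  have "\<pi> (- g) = mat_adjoint (\<pi> g) * \<pi> g * \<pi> (- g)"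
    using D(1)[of "- g"] D(2)[of g] by simp
  also have "\<dots> = mat_adjoint (\<pi> g) * \<pi> (g + - g)"
    unfolding D(4) using D(1)[of g] D(1)[of "- g"] by (intro assoc_mult_mat) auto
  finally show ?thesis using D(1)[of g] unitary_rep_zero[OF assms] by simp
qed

section \<open>Schur's lemma for unitary matrix representations\<close>

lemma mat_eqI_mult_vec:
  assumes A: "(A :: complex mat) \<in> carrier_mat n m" and B: "B \<in> carrier_mat n m"
    and eq: "\<And>v. v \<in> carrier_vec m \<Longrightarrow> A *\<^sub>v v = B *\<^sub>v v"
  shows "A = B"
proof (rule eq_matI)
  fix i j assume "i < dim_row B" "j < dim_col B"
  then have ij: "i < n" "j < m" using B by auto
  have "(A *\<^sub>v unit_vec m j) $ i = (B *\<^sub>v unit_vec m j) $ i"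
    using eq[of "unit_vec m j"] by simp
  then show "A $$ (i, j) = B $$ (i, j)"
    using A B ij by simp
qed (use A B in auto)

text \<open>An eigenvalue of \<open>T\<close> exists because the dimension is positive and the
  scalars are complex. Its eigenspace is nonzero and invariant under the representation, so it is
  the whole space.\<close>

lemma schur_commuting:
  assumes irr: "irreducible_rep n \<pi>" and T: "T \<in> carrier_mat n n"
    and comm: "\<And>g. T * \<pi> g = \<pi> g * T"
  obtains c where "T = c \<cdot>\<^sub>m 1\<^sub>m n"
proof -
  have U: "unitary_rep n \<pi>" and n: "n > 0" using irr by (auto simp: irreducible_rep_def)
  note D = unitary_repD(1)[OF U]
  from spectrum_non_empty[OF T] n obtain c where "eigenvalue T c"
    by (auto simp: spectrum_def)
  then obtain v where v: "v \<in> carrier_vec n" "v \<noteq> 0\<^sub>v n" "T *\<^sub>v v = c \<cdot>\<^sub>v v"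
    using T by (auto simp: eigenvalue_def eigenvector_def)
  define W where "W = {w \<in> carrier_vec n. T *\<^sub>v w = c \<cdot>\<^sub>v w}"
  have "W = {0\<^sub>v n} \<or> W = carrier_vec n"
  proof (rule irreducible_repD[OF irr])
    show "W \<subseteq> carrier_vec n" "0\<^sub>v n \<in> W" using T by (auto simp: W_def)
    show "v + w \<in> W" if "v \<in> W" "w \<in> W" for v w
      using that T by (auto simp: W_def mult_add_distrib_mat_vec[of _ n n] smult_add_distrib_vec)
    show "d \<cdot>\<^sub>v v \<in> W" if "v \<in> W" for d v
      using that T by (auto simp: W_def mult_mat_vec[of _ n n] smult_smult_assoc mult.commute)
    show "\<pi> g *\<^sub>v w \<in> W" if "w \<in> W" for g w
    proof -
      have w: "w \<in> carrier_vec n" "T *\<^sub>v w = c \<cdot>\<^sub>v w" using that by (auto simp: W_def)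
      have "T *\<^sub>v (\<pi> g *\<^sub>v w) = (T * \<pi> g) *\<^sub>v w"
        using T D[of g] w by simp
      also have "\<dots> = \<pi> g *\<^sub>v (T *\<^sub>v w)"
        using T D[of g] w by (simp add: comm)
      also have "\<dots> = c \<cdot>\<^sub>v (\<pi> g *\<^sub>v w)"
        using D[of g] w by (simp add: mult_mat_vec[of _ n n])
      finally show ?thesis using D[of g] w by (simp add: W_def)
    qed
  qed
  with v have W: "W = carrier_vec n" by (auto simp: W_def)
  have "T = c \<cdot>\<^sub>m 1\<^sub>m n"
  proof (rule mat_eqI_mult_vec[OF T])
    fix v :: "complex vec" assume v: "v \<in> carrier_vec n"
    then have "T *\<^sub>v v = c \<cdot>\<^sub>v v" using W by (auto simp: W_def)
    also have "\<dots> = (c \<cdot>\<^sub>m 1\<^sub>m n) *\<^sub>v v"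
      using v by (intro eq_vecI) (auto simp: mult_vec_index[where m=n and n=n] sum.delta if_distrib cong: if_cong)
    finally show "T *\<^sub>v v = (c \<cdot>\<^sub>m 1\<^sub>m n) *\<^sub>v v" .
  qed auto
  then show ?thesis by (rule that)
qed

text \<open>Taking adjoints in the relation for \<open>- g\<close> reverses the order of the
  factors, and \<open>\<pi> (- g)\<close> is the adjoint of \<open>\<pi> g\<close>.\<close>

lemma intertwiner_adjoint:
  assumes \<pi>: "unitary_rep n \<pi>" and \<pi>': "unitary_rep m \<pi>'" and T: "T \<in> carrier_mat m n"
    and TI: "\<And>g. T * \<pi> g = \<pi>' g * T"
  shows "mat_adjoint T * \<pi>' g = \<pi> g * mat_adjoint T"
proof -
  have "mat_adjoint (T * \<pi> (- g)) = mat_adjoint (\<pi>' (- g) * T)" by (simp add: TI)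
  then show ?thesis
    using T unitary_repD(1)[OF \<pi>] unitary_repD(1)[OF \<pi>']
    by (simp add: mat_adjoint_mult[of _ m n _ n] mat_adjoint_mult[of _ m m _ n]
        unitary_rep_uminus[OF \<pi>] unitary_rep_uminus[OF \<pi>'])
qed

text \<open>Both \<open>mat_adjoint T * T\<close> and \<open>T * mat_adjoint T\<close> commute with
  an irreducible representation and are therefore scalar. The two scalars agree and are positive, so
  \<open>T\<close> is a positive multiple of a unitary; this gives the unitary equivalence required
  by \<open>rep_equiv\<close>, not merely invertibility.\<close>

lemma schur_intertwiner:
  assumes irr: "irreducible_rep n \<pi>" and irr': "irreducible_rep m \<pi>'" and T: "T \<in> carrier_mat m n"
    and TI: "\<And>g. T * \<pi> g = \<pi>' g * T" and T0: "T \<noteq> 0\<^sub>m m n"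
  shows "rep_equiv \<pi> \<pi>'"
proof -
  have U: "unitary_rep n \<pi>" "unitary_rep m \<pi>'" using irr irr' by (auto simp: irreducible_rep_def)
  note D = unitary_repD(1)[OF U(1)] and D' = unitary_repD(1)[OF U(2)]
  note TI' = intertwiner_adjoint[OF U T TI]
  have T': "mat_adjoint T \<in> carrier_mat n m" using T by auto
  obtain c where c: "mat_adjoint T * T = c \<cdot>\<^sub>m 1\<^sub>m n"
  proof (rule schur_commuting[OF irr])
    show "mat_adjoint T * T \<in> carrier_mat n n" using T by auto
    show "mat_adjoint T * T * \<pi> g = \<pi> g * (mat_adjoint T * T)" for g
    proof -
      have "mat_adjoint T * T * \<pi> g = mat_adjoint T * (T * \<pi> g)"
        by (rule assoc_mult_mat) (use T T' D[of g] in auto)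
      also have "\<dots> = (mat_adjoint T * \<pi>' g) * T"
        unfolding TI by (rule assoc_mult_mat[symmetric]) (use T T' D'[of g] in auto)
      also have "\<dots> = \<pi> g * (mat_adjoint T * T)"
        unfolding TI' by (rule assoc_mult_mat) (use T T' D[of g] in auto)
      finally show ?thesis .
    qed
  qed
  obtain d where d: "T * mat_adjoint T = d \<cdot>\<^sub>m 1\<^sub>m m"
  proof (rule schur_commuting[OF irr'])
    show "T * mat_adjoint T \<in> carrier_mat m m" using T by auto
    show "T * mat_adjoint T * \<pi>' g = \<pi>' g * (T * mat_adjoint T)" for g
    proof -
      have "T * mat_adjoint T * \<pi>' g = T * (mat_adjoint T * \<pi>' g)"
        by (rule assoc_mult_mat) (use T T' D'[of g] in auto)
      also have "\<dots> = (T * \<pi> g) * mat_adjoint T"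
        unfolding TI' by (rule assoc_mult_mat[symmetric]) (use T T' D[of g] in auto)
      also have "\<dots> = \<pi>' g * (T * mat_adjoint T)"
        unfolding TI by (rule assoc_mult_mat) (use T T' D'[of g] in auto)
      finally show ?thesis .
    qed
  qed
  obtain i0 j0 where ij: "i0 < m" "j0 < n" "T $$ (i0, j0) \<noteq> 0"
    using T T0 by (metis (no_types, lifting) carrier_matD eq_matI index_zero_mat)
  \<comment> \<open>The scalar is the squared length of each column of \<open>T\<close>, so a single
    nonzero entry makes it positive.\<close>
  have cj: "c = of_real (\<Sum>i<m. (cmod (T $$ (i, j)))\<^sup>2)" if "j < n" for j
  proof -
    have "c = (mat_adjoint T * T) $$ (j, j)" using that by (simp add: c)
    also have "\<dots> = (\<Sum>i<m. cnj (T $$ (i, j)) * T $$ (i, j))"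
      using that T by (subst mult_mat_index[OF T' T]) auto
    also have "\<dots> = (\<Sum>i<m. of_real ((cmod (T $$ (i, j)))\<^sup>2))"
      by (intro sum.cong refl) (metis complex_norm_square mult.commute of_real_power)
    finally show ?thesis by simp
  qed
  define r where "r = (\<Sum>i<m. (cmod (T $$ (i, j0)))\<^sup>2)"
  have cr: "c = of_real r" using cj[OF ij(2)] by (simp add: r_def)
  have r: "r > 0"
    unfolding r_def by (rule sum_pos2[of _ i0]) (use ij in auto)
  have "c \<cdot>\<^sub>m T = d \<cdot>\<^sub>m T"
  proof -
    have "c \<cdot>\<^sub>m T = T * (mat_adjoint T * T)"
      unfolding c using T by (simp add: mult_smult_distrib[OF T one_carrier_mat])
    also have "\<dots> = (T * mat_adjoint T) * T"
      by (rule assoc_mult_mat[symmetric]) (use T T' in auto)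
    also have "\<dots> = d \<cdot>\<^sub>m T"
      unfolding d using T by (simp add: mult_smult_assoc_mat[OF one_carrier_mat T])
    finally show ?thesis .
  qed
  then have "(c \<cdot>\<^sub>m T) $$ (i0, j0) = (d \<cdot>\<^sub>m T) $$ (i0, j0)" by simp
  then have cd: "c = d" using ij T by auto
  \<comment> \<open>The two products have the same trace; since the scalars are equal and nonzero,
    the dimensions agree.\<close>
  have "of_nat n * c = (\<Sum>j<n. (mat_adjoint T * T) $$ (j, j))" by (simp add: c)
  also have "\<dots> = (\<Sum>j<n. \<Sum>i<m. cnj (T $$ (i, j)) * T $$ (i, j))"
    using T by (simp add: mult_mat_index[OF T' T] del: index_mult_mat)
  also have "\<dots> = (\<Sum>i<m. \<Sum>j<n. T $$ (i, j) * cnj (T $$ (i, j)))"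
    by (subst sum.swap) (simp add: mult.commute)
  also have "\<dots> = (\<Sum>i<m. (T * mat_adjoint T) $$ (i, i))"
    using T by (simp add: mult_mat_index[OF T T'] del: index_mult_mat)
  also have "\<dots> = of_nat m * d" by (simp add: d)
  finally have mn: "m = n" using cd cr r by auto
  define V where "V = (of_real (1 / sqrt r)) \<cdot>\<^sub>m T"
  have V: "V \<in> carrier_mat n n" using T mn by (simp add: V_def)
  have adjV: "mat_adjoint V = (of_real (1 / sqrt r)) \<cdot>\<^sub>m mat_adjoint T"
    unfolding V_def by (rule eq_matI) auto
  have "complex_of_real (1 / sqrt r) * (of_real (1 / sqrt r) * c) = of_real (1 / sqrt r * (1 / sqrt r) * r)"
    by (simp only: cr of_real_mult mult.assoc)
  also have "\<dots> = 1" using r by (simp add: field_simps)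
  finally have 1: "complex_of_real (1 / sqrt r) * (of_real (1 / sqrt r) * c) = 1" .
  have "mat_adjoint V * V = of_real (1 / sqrt r) \<cdot>\<^sub>m (of_real (1 / sqrt r) \<cdot>\<^sub>m (mat_adjoint T * T))"
    unfolding adjV unfolding V_def using T T'
    by (subst mult_smult_distrib[of _ n m]) (auto simp: mult_smult_assoc_mat[of _ n m])
  also have "\<dots> = 1\<^sub>m n"
    unfolding c using 1 by (intro eq_matI) (auto simp: mult.assoc)
  finally have "unitary_mat n V" using V by (intro unitary_matI)
  moreover have "V * \<pi> g = \<pi>' g * V" for g
    unfolding V_def using T D[of g] D'[of g] TI[of g]
    by (simp add: mult_smult_distrib[of _ m m] mult_smult_assoc_mat[of _ m n])
  ultimately show ?thesis
    using D D' mn by (intro rep_equivI[of _ n _ V]) auto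
qed

text \<open>A subspace invariant under the conjugated matrices becomes, after entrywise conjugation
  of its vectors, a subspace invariant under \<open>\<pi>\<close>. This supplies the conjugate of a
  class.\<close>

lemma irreducible_rep_conjugate:
  assumes irr: "irreducible_rep n \<pi>"
  shows "irreducible_rep n (\<lambda>g. map_mat cnj (\<pi> g))"
proof -
  have U: "unitary_rep n \<pi>" and n: "n > 0" using irr by (auto simp: irreducible_rep_def)
  note D = unitary_repD[OF U]
  have mm: "map_mat cnj (A * B) = map_mat cnj A * map_mat cnj B"
    if "A \<in> carrier_mat n n" "B \<in> carrier_mat n n" for A B :: "complex mat"
    using that by (intro eq_matI) (simp_all add: mult_mat_index[of _ n n _ n] del: index_mult_mat(1))
  have aa: "mat_adjoint (map_mat cnj A) = map_mat cnj (mat_adjoint A)" for A :: "complex mat"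
    by (intro eq_matI) auto
  have one: "map_mat cnj (1\<^sub>m n) = 1\<^sub>m n" by (intro eq_matI) auto
  have "unitary_rep n (\<lambda>g. map_mat cnj (\<pi> g))"
    unfolding unitary_rep_def
  proof (intro conjI allI impI)
    show "unitary_mat n (map_mat cnj (\<pi> g))" for g
      using D(1,2)[of g] by (intro unitary_matI) (auto simp: aa mm[symmetric] one)
    show "map_mat cnj (\<pi> (g + h)) = map_mat cnj (\<pi> g) * map_mat cnj (\<pi> h)" for g h
      using D(1) by (simp add: D(4) mm)
    show "continuous_on UNIV (\<lambda>g. map_mat cnj (\<pi> g) $$ (i, j))" if "i < n" "j < n" for i j
    proof -
      have "continuous_on UNIV (\<lambda>g. cnj (\<pi> g $$ (i, j)))"
        using U that by (intro continuous_on_cnj) (auto simp: unitary_rep_def)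
      moreover have "map_mat cnj (\<pi> g) $$ (i, j) = cnj (\<pi> g $$ (i, j))" for g
        using D(1)[of g] that by auto
      ultimately show ?thesis by simp
    qed
  qed
  moreover have "W = {0\<^sub>v n} \<or> W = carrier_vec n"
    if W: "VectorSpace.subspace class_ring W (module_vec TYPE(complex) n)"
      and inv: "\<forall>g. \<forall>w\<in>W. map_mat cnj (\<pi> g) *\<^sub>v w \<in> W" for W
  proof -
    note W = W[unfolded complex_subspace_iff]
    define W' where "W' = {w. conjugate w \<in> W}"
    have "W' = {0\<^sub>v n} \<or> W' = carrier_vec n"
    proof (rule irreducible_repD[OF irr])
      show sub: "W' \<subseteq> carrier_vec n"
      proof
        fix w assume "w \<in> W'"
        then have "conjugate w \<in> carrier_vec n" using W by (auto simp: W'_def)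
        then show "w \<in> carrier_vec n" by (metis carrier_vecD carrier_vecI dim_vec_conjugate)
      qed
      show "0\<^sub>v n \<in> W'" using W by (simp add: W'_def)
      show "v + w \<in> W'" if "v \<in> W'" "w \<in> W'" for v w
        using that W subsetD[OF sub that(1)] subsetD[OF sub that(2)]
        by (simp add: W'_def conjugate_add_vec[of _ n])
      show "c \<cdot>\<^sub>v v \<in> W'" if "v \<in> W'" for c v
        using that W by (simp add: W'_def conjugate_smult_vec)
      show "\<pi> g *\<^sub>v w \<in> W'" if "w \<in> W'" for g w
      proof -
        have w: "w \<in> carrier_vec n" using that sub by auto
        have "conjugate (\<pi> g *\<^sub>v w) = map_mat cnj (\<pi> g) *\<^sub>v conjugate w"
          using w D(1)[of g]
          by (intro eq_vecI) (auto simp: mult_vec_index[of _ n n] simp del: index_mult_mat_vec)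
        then show ?thesis using that inv by (simp add: W'_def)
      qed
    qed
    then show ?thesis
    proof
      assume W': "W' = {0\<^sub>v n}"
      have "w = 0\<^sub>v n" if "w \<in> W" for w
      proof -
        have "conjugate w \<in> W'" using that by (simp add: W'_def)
        then show ?thesis using W' by simp
      qed
      then show ?thesis using W by auto
    next
      assume W': "W' = carrier_vec n"
      have "w \<in> W" if "w \<in> carrier_vec n" for w
      proof -
        have "conjugate w \<in> W'" using that W' by simp
        then show ?thesis by (simp add: W'_def)
      qed
      then show ?thesis using W by auto
    qed
  qed
  ultimately show ?thesis using n by (auto simp: irreducible_rep_def)
qed

section \<open>Complete reducibility\<close>

text \<open>If \<open>m\<close> exceeded \<open>n\<close>, padding \<open>V\<close> with zero rows
  would give a square matrix with a left inverse, hence a unitary one, although its row with index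
  \<open>n\<close> is zero. The bound stops the successive enlargement of orthonormal
  families.\<close>

lemma isometry_dim_le:
  assumes V: "(V :: complex mat) \<in> carrier_mat n m" and iso: "mat_adjoint V * V = 1\<^sub>m m"
  shows "m \<le> n"
proof (rule ccontr)
  assume "\<not> m \<le> n"
  then have nm: "n < m" by simp
  define X where "X = mat m m (\<lambda>(i, j). if i < n then V $$ (i, j) else 0)"
  have X: "X \<in> carrier_mat m m" by (simp add: X_def)
  have X': "mat_adjoint X \<in> carrier_mat m m" and V': "mat_adjoint V \<in> carrier_mat m n"
    using X V by auto
  have "mat_adjoint X * X = mat_adjoint V * V"
  proof (rule eq_matI)
    fix i j assume "i < dim_row (mat_adjoint V * V)" "j < dim_col (mat_adjoint V * V)"
    then have ij: "i < m" "j < m" using V by auto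
    have "(mat_adjoint X * X) $$ (i, j) = (\<Sum>l<m. cnj (X $$ (l, i)) * X $$ (l, j))"
      using ij X by (subst mult_mat_index[OF X' X]) auto
    also have "\<dots> = (\<Sum>l<n. cnj (V $$ (l, i)) * V $$ (l, j))"
      using ij nm by (intro sum.mono_neutral_cong_right) (auto simp: X_def)
    also have "\<dots> = (mat_adjoint V * V) $$ (i, j)"
      using ij V by (subst mult_mat_index[OF V' V]) auto
    finally show "(mat_adjoint X * X) $$ (i, j) = (mat_adjoint V * V) $$ (i, j)" .
  qed (use X V in auto)
  then have "unitary_mat m X" using iso X by (intro unitary_matI) auto
  then have "(X * mat_adjoint X) $$ (n, n) = 1" using nm by (simp add: unitary_mat_def)
  moreover have "(X * mat_adjoint X) $$ (n, n) = 0"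
    using nm X by (subst mult_mat_index[OF X X']) (auto simp: X_def intro!: sum.neutral)
  ultimately show False by simp
qed

text \<open>An orthonormal family in \<open>W\<close> is encoded as the columns of a matrix
  \<open>V\<close> with \<open>mat_adjoint V * V = 1\<^sub>m m\<close>; then
  \<open>V *\<^sub>v (mat_adjoint V *\<^sub>v w)\<close> is the orthogonal projection of
  \<open>w\<close> to the span of the family.\<close>

locale complex_vec_subspace =
  fixes n :: nat and W :: "complex vec set"
  assumes subset: "W \<subseteq> carrier_vec n" and zero: "0\<^sub>v n \<in> W"
    and add: "\<And>v w. v \<in> W \<Longrightarrow> w \<in> W \<Longrightarrow> v + w \<in> W"
    and smult: "\<And>c v. v \<in> W \<Longrightarrow> c \<cdot>\<^sub>v v \<in> W"
begin

lemma mult_vec_mem: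
  assumes V: "V \<in> carrier_mat n m" and cols: "\<And>j. j < m \<Longrightarrow> col V j \<in> W" and x: "x \<in> carrier_vec m"
  shows "V *\<^sub>v x \<in> W"
proof -
  have "vec n (\<lambda>i. \<Sum>j<k. V $$ (i, j) * x $ j) \<in> W" if "k \<le> m" for k
    using that
  proof (induction k)
    case 0
    have "vec n (\<lambda>i. 0) = (0\<^sub>v n :: complex vec)" by auto
    then show ?case using zero by simp
  next
    case (Suc k)
    have "vec n (\<lambda>i. \<Sum>j<Suc k. V $$ (i, j) * x $ j) =
        vec n (\<lambda>i. \<Sum>j<k. V $$ (i, j) * x $ j) + x $ k \<cdot>\<^sub>v col V k"
      using V Suc.prems by (intro eq_vecI) auto
    then show ?case using Suc cols[of k] by (auto intro!: add smult)
  qed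
  from this[of m] have "vec n (\<lambda>i. \<Sum>j<m. V $$ (i, j) * x $ j) \<in> W" by simp
  moreover have "vec n (\<lambda>i. \<Sum>j<m. V $$ (i, j) * x $ j) = V *\<^sub>v x"
    using V x by (intro eq_vecI) (auto simp: mult_vec_index simp del: index_mult_mat_vec)
  ultimately show ?thesis by simp
qed

text \<open>One Gram-Schmidt step: \<open>w\<close> minus its projection to the columns of
  \<open>V\<close> is nonzero, orthogonal to them and still in \<open>W\<close>; normalised, it
  becomes the new last column.\<close>

lemma isometry_extend:
  assumes V: "V \<in> carrier_mat n m" and iso: "mat_adjoint V * V = 1\<^sub>m m"
    and cols: "\<And>j. j < m \<Longrightarrow> col V j \<in> W"
    and w: "w \<in> W" and neq: "V *\<^sub>v (mat_adjoint V *\<^sub>v w) \<noteq> w"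
  obtains V' where "V' \<in> carrier_mat n (Suc m)" "mat_adjoint V' * V' = 1\<^sub>m (Suc m)"
    "\<And>j. j < Suc m \<Longrightarrow> col V' j \<in> W" "\<And>j. j < m \<Longrightarrow> col V' j = col V j"
proof -
  have V': "mat_adjoint V \<in> carrier_mat m n" using V by auto
  have wc: "w \<in> carrier_vec n" using w subset by auto
  define p where "p = V *\<^sub>v (mat_adjoint V *\<^sub>v w)"
  define u where "u = w + (-1) \<cdot>\<^sub>v p"
  have pW: "p \<in> W" unfolding p_def by (intro mult_vec_mem[OF V cols] mult_mat_vec_carrier[OF V' wc])
  then have pc: "p \<in> carrier_vec n" using subset by auto
  have uW: "u \<in> W" unfolding u_def using w pW by (intro add smult)
  then have uc: "u \<in> carrier_vec n" using subset by auto
  have u0: "u \<noteq> 0\<^sub>v n"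
  proof
    assume 0: "u = 0\<^sub>v n"
    have "p $ i = w $ i" if "i < n" for i
    proof -
      have "u $ i = 0" using 0 that by simp
      then show ?thesis using that pc wc by (simp add: u_def)
    qed
    then have "p = w" using pc wc by (intro eq_vecI) auto
    then show False using neq by (simp add: p_def)
  qed
  have orth: "mat_adjoint V *\<^sub>v u = 0\<^sub>v m"
  proof -
    have "mat_adjoint V *\<^sub>v p = mat_adjoint V * V *\<^sub>v (mat_adjoint V *\<^sub>v w)"
      unfolding p_def by (rule assoc_mult_mat_vec[symmetric, OF V' V mult_mat_vec_carrier[OF V' wc]])
    also have "\<dots> = mat_adjoint V *\<^sub>v w" unfolding iso
      by (rule one_mult_mat_vec) (rule mult_mat_vec_carrier[OF V' wc])
    finally have 1: "mat_adjoint V *\<^sub>v p = mat_adjoint V *\<^sub>v w" .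
    have "mat_adjoint V *\<^sub>v u = mat_adjoint V *\<^sub>v w + (-1) \<cdot>\<^sub>v (mat_adjoint V *\<^sub>v p)"
      unfolding u_def using V' wc pc
      by (simp add: mult_add_distrib_mat_vec[of _ m n] mult_mat_vec[of _ m n])
    also have "\<dots> = 0\<^sub>v m" unfolding 1 using V' wc by (intro eq_vecI) auto
    finally show ?thesis .
  qed
  define r where "r = (\<Sum>i<n. (cmod (u $ i))\<^sup>2)"
  obtain i0 where i0: "i0 < n" "u $ i0 \<noteq> 0"
    using u0 uc by (metis carrier_vecD eq_vecI index_zero_vec)
  have r: "r > 0" unfolding r_def by (rule sum_pos2[of _ i0]) (use i0 in auto)
  have uu: "(\<Sum>i<n. cnj (u $ i) * u $ i) = of_real r"
    unfolding r_def of_real_sum by (intro sum.cong refl) (metis complex_norm_square mult.commute of_real_power)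
  define s where "s = complex_of_real (1 / sqrt r)"
  have sr: "cnj s * (s * of_real r) = 1"
  proof -
    have "cnj s * (s * of_real r) = of_real (1 / sqrt r * (1 / sqrt r * r))"
      unfolding s_def complex_cnj_complex_of_real by (simp only: of_real_mult)
    also have "1 / sqrt r * (1 / sqrt r * r) = 1" using r by (simp add: field_simps)
    finally show ?thesis by simp
  qed
  define X where "X = mat n (Suc m) (\<lambda>(i, j). if j < m then V $$ (i, j) else s * u $ i)"
  have X: "X \<in> carrier_mat n (Suc m)" by (simp add: X_def)
  have X': "mat_adjoint X \<in> carrier_mat (Suc m) n" using X by auto
  have VV: "(\<Sum>l<n. cnj (V $$ (l, i)) * V $$ (l, j)) = (if i = j then 1 else 0)"
    if "i < m" "j < m" for i j
  proof -
    have "(mat_adjoint V * V) $$ (i, j) = (if i = j then 1 else 0)" using that iso by simp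
    then show ?thesis using that V by (subst (asm) mult_mat_index[OF V' V]) auto
  qed
  have Vu: "(\<Sum>l<n. cnj (V $$ (l, i)) * u $ l) = 0" if "i < m" for i
  proof -
    have "(mat_adjoint V *\<^sub>v u) $ i = 0" using that orth by simp
    then show ?thesis using that V by (subst (asm) mult_vec_index[OF V' uc]) auto
  qed
  have uV: "(\<Sum>l<n. cnj (u $ l) * V $$ (l, i)) = 0" if "i < m" for i
  proof -
    have "cnj (\<Sum>l<n. cnj (V $$ (l, i)) * u $ l) = 0" using Vu[OF that] by simp
    then show ?thesis by (simp add: mult.commute)
  qed
  have "mat_adjoint X * X = 1\<^sub>m (Suc m)"
  proof (rule eq_matI)
    fix i j assume "i < dim_row (1\<^sub>m (Suc m) :: complex mat)" "j < dim_col (1\<^sub>m (Suc m) :: complex mat)"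
    then have ij: "i < Suc m" "j < Suc m" by auto
    have "(mat_adjoint X * X) $$ (i, j) = (\<Sum>l<n. cnj (X $$ (l, i)) * X $$ (l, j))"
      using ij X by (subst mult_mat_index[OF X' X]) auto
    also have "\<dots> = (if i = j then 1 else 0)"
    proof -
      consider "i < m" "j < m" | "i < m" "j = m" | "i = m" "j < m" | "i = m" "j = m"
        using ij by (auto simp: less_Suc_eq)
      then show ?thesis
      proof cases
        case 1
        then show ?thesis using ij by (simp add: X_def VV)
      next
        case 2
        then have "(\<Sum>l<n. cnj (X $$ (l, i)) * X $$ (l, j)) = s * (\<Sum>l<n. cnj (V $$ (l, i)) * u $ l)"
          by (simp add: X_def sum_distrib_left mult_ac)
        then show ?thesis using 2 Vu by simp
      next
        case 3
        then have "(\<Sum>l<n. cnj (X $$ (l, i)) * X $$ (l, j)) = cnj s * (\<Sum>l<n. cnj (u $ l) * V $$ (l, j))"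
          by (simp add: X_def sum_distrib_left mult_ac)
        then show ?thesis using 3 uV by simp
      next
        case 4
        then have "(\<Sum>l<n. cnj (X $$ (l, i)) * X $$ (l, j)) = cnj s * (s * (\<Sum>l<n. cnj (u $ l) * u $ l))"
          by (simp add: X_def sum_distrib_left mult_ac)
        then show ?thesis using 4 uu sr by simp
      qed
    qed
    also have "\<dots> = 1\<^sub>m (Suc m) $$ (i, j)" using ij by simp
    finally show "(mat_adjoint X * X) $$ (i, j) = 1\<^sub>m (Suc m) $$ (i, j)" .
  qed (use X in auto)
  moreover have colX: "col X j = col V j" if "j < m" for j
    using that V by (intro eq_vecI) (auto simp: X_def)
  moreover have "col X j \<in> W" if "j < Suc m" for j
  proof (cases "j < m")
    case True
    then show ?thesis using colX cols by simp
  next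
    case False
    then have "col X j = s \<cdot>\<^sub>v u" using that uc by (intro eq_vecI) (auto simp: X_def)
    then show ?thesis using uW smult by simp
  qed
  ultimately show thesis using X that by blast
qed

text \<open>Orthonormal families are enlarged until they span \<open>W\<close>. The old columns stay
  in front, so a basis of a subspace can also be completed to one of a larger space. The induction
  ends because an isometry into dimension \<open>n\<close> has at most \<open>n\<close>
  columns.\<close>

lemma isometry_complete:
  assumes V: "V \<in> carrier_mat n m" and iso: "mat_adjoint V * V = 1\<^sub>m m"
    and cols: "\<And>j. j < m \<Longrightarrow> col V j \<in> W"
  obtains k V' where "m \<le> k" "V' \<in> carrier_mat n k" "mat_adjoint V' * V' = 1\<^sub>m k"
    "\<And>j. j < k \<Longrightarrow> col V' j \<in> W" "\<And>j. j < m \<Longrightarrow> col V' j = col V j"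
    "\<And>w. w \<in> W \<Longrightarrow> V' *\<^sub>v (mat_adjoint V' *\<^sub>v w) = w"
proof -
  have "\<exists>k V'. m \<le> k \<and> V' \<in> carrier_mat n k \<and> mat_adjoint V' * V' = 1\<^sub>m k \<and>
    (\<forall>j<k. col V' j \<in> W) \<and> (\<forall>j<m. col V' j = col V j) \<and>
    (\<forall>w\<in>W. V' *\<^sub>v (mat_adjoint V' *\<^sub>v w) = w)"
    using V iso cols
  proof (induction "n - m" arbitrary: m V rule: less_induct)
    case less
    show ?case
    proof (cases "\<forall>w\<in>W. V *\<^sub>v (mat_adjoint V *\<^sub>v w) = w")
      case True
      with less.prems show ?thesis by blast
    next
      case False
      then obtain w where "w \<in> W" "V *\<^sub>v (mat_adjoint V *\<^sub>v w) \<noteq> w" by blast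
      then obtain V' where V': "V' \<in> carrier_mat n (Suc m)" "mat_adjoint V' * V' = 1\<^sub>m (Suc m)"
        "\<And>j. j < Suc m \<Longrightarrow> col V' j \<in> W" "\<And>j. j < m \<Longrightarrow> col V' j = col V j"
        using isometry_extend[OF less.prems] by blast
      have "Suc m \<le> n" using isometry_dim_le[OF V'(1,2)] .
      then have "n - Suc m < n - m" by simp
      from less.hyps[OF this V'(1,2)] V'(3) obtain k V'' where
        *: "Suc m \<le> k" "V'' \<in> carrier_mat n k" "mat_adjoint V'' * V'' = 1\<^sub>m k"
          "\<forall>j<k. col V'' j \<in> W" "\<forall>j<Suc m. col V'' j = col V' j"
          "\<forall>w\<in>W. V'' *\<^sub>v (mat_adjoint V'' *\<^sub>v w) = w" by blast
      then have "m \<le> k" "\<forall>j<m. col V'' j = col V j" using V'(4) by auto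
      with * show ?thesis by blast
    qed
  qed
  with that show ?thesis by blast
qed

end

lemma complex_vec_subspace_carrier: "complex_vec_subspace n (carrier_vec n)"
  by unfold_locales auto

lemma complex_vec_subspaceI:
  "VectorSpace.subspace class_ring W (module_vec TYPE(complex) n) \<Longrightarrow> complex_vec_subspace n W"
  unfolding complex_subspace_iff by unfold_locales auto

text \<open>An orthonormal basis of \<open>W\<close> is completed to one of the whole space. The
  columns added by the second completion are orthogonal to \<open>W\<close>, which is the vanishing
  of the later coordinates.\<close>

lemma adapted_unitary:
  assumes sub: "complex_vec_subspace n W" and W: "W \<noteq> {0\<^sub>v n}" "W \<noteq> carrier_vec n"
  obtains m V where "0 < m" "m < n" "unitary_mat n V" "\<And>j. j < m \<Longrightarrow> col V j \<in> W"
    "\<And>w j. w \<in> W \<Longrightarrow> m \<le> j \<Longrightarrow> j < n \<Longrightarrow> (mat_adjoint V *\<^sub>v w) $ j = 0"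
proof -
  interpret complex_vec_subspace n W by (rule sub)
  interpret C: complex_vec_subspace n "carrier_vec n" by (rule complex_vec_subspace_carrier)
  \<comment> \<open>The completion starts from the empty family, a matrix without columns, and ends
    with an orthonormal basis of \<open>W\<close>.\<close>
  obtain m V where V: "V \<in> carrier_mat n m" "mat_adjoint V * V = 1\<^sub>m m"
    "\<And>j. j < m \<Longrightarrow> col V j \<in> W" "\<And>w. w \<in> W \<Longrightarrow> V *\<^sub>v (mat_adjoint V *\<^sub>v w) = w"
    by (rule isometry_complete[of "0\<^sub>m n 0" 0]) (auto intro!: eq_matI)
  have Va: "mat_adjoint V \<in> carrier_mat m n" using V(1) by auto
  have "m \<noteq> 0"
  proof
    assume 0: "m = 0"
    have "w = 0\<^sub>v n" if "w \<in> W" for w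
    proof -
      have wc: "w \<in> carrier_vec n" using that subset by auto
      have "V *\<^sub>v (mat_adjoint V *\<^sub>v w) = 0\<^sub>v n"
      proof (rule eq_vecI)
        fix i assume "i < dim_vec (0\<^sub>v n :: complex vec)"
        then have "i < n" by simp
        from mult_vec_index[OF V(1) mult_mat_vec_carrier[OF Va wc] this]
        show "(V *\<^sub>v (mat_adjoint V *\<^sub>v w)) $ i = 0\<^sub>v n $ i"
          using \<open>i < n\<close> 0 by (simp del: index_mult_mat_vec)
      qed (use V(1) in simp)
      then show ?thesis using V(4)[OF that] by simp
    qed
    then show False using W(1) zero by blast
  qed
  have "m \<noteq> n"
  proof
    assume [simp]: "m = n"
    have un: "unitary_mat n V" using V by (intro unitary_matI) auto
    have "w \<in> W" if "w \<in> carrier_vec n" for w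
    proof -
      have "V *\<^sub>v (mat_adjoint V *\<^sub>v w) \<in> W"
        using that Va by (intro mult_vec_mem[OF V(1,3)] mult_mat_vec_carrier) simp_all
      also have "V *\<^sub>v (mat_adjoint V *\<^sub>v w) = V * mat_adjoint V *\<^sub>v w"
        using V(1) Va that by (intro assoc_mult_mat_vec[symmetric]) auto
      also have "\<dots> = w" using un that by (simp add: unitary_mat_def)
      finally show ?thesis .
    qed
    then show False using W(2) subset by blast
  qed
  moreover have "m \<le> n" using isometry_dim_le[OF V(1,2)] .
  ultimately have mn: "0 < m" "m < n" using \<open>m \<noteq> 0\<close> by auto
  obtain k X where X: "m \<le> k" "X \<in> carrier_mat n k" "mat_adjoint X * X = 1\<^sub>m k"
    "\<And>j. j < m \<Longrightarrow> col X j = col V j" "\<And>w. w \<in> carrier_vec n \<Longrightarrow> X *\<^sub>v (mat_adjoint X *\<^sub>v w) = w"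
  proof (rule C.isometry_complete[OF V(1,2)])
    show "col V j \<in> carrier_vec n" if "j < m" for j using V(1) by auto
  qed blast
  have Xa: "mat_adjoint X \<in> carrier_mat k n" using X(2) by auto
  have "X * mat_adjoint X = 1\<^sub>m n"
  proof (rule mat_eqI_mult_vec)
    show "X * mat_adjoint X *\<^sub>v v = 1\<^sub>m n *\<^sub>v v" if "v \<in> carrier_vec n" for v
      using X(5)[OF that] X(2) Xa that by (simp add: assoc_mult_mat_vec[of _ n k _ n])
  qed (use X(2) in auto)
  then have "n \<le> k" using isometry_dim_le[OF Xa] by simp
  moreover have "k \<le> n" using isometry_dim_le[OF X(2,3)] .
  ultimately have [simp]: "k = n" by simp
  have "unitary_mat n X" using X by (intro unitary_matI) auto
  moreover have "(mat_adjoint X *\<^sub>v w) $ j = 0" if w: "w \<in> W" and j: "m \<le> j" "j < n" for w j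
  proof -
    have wc: "w \<in> carrier_vec n" using w subset by auto
    define x where "x = mat_adjoint V *\<^sub>v w"
    have x: "x \<in> carrier_vec m" using Va wc by (simp add: x_def)
    have XX: "(\<Sum>l<n. cnj (X $$ (l, j)) * V $$ (l, i)) = 0" if "i < m" for i
    proof -
      have "(\<Sum>l<n. cnj (X $$ (l, j)) * V $$ (l, i)) = (\<Sum>l<n. cnj (X $$ (l, j)) * X $$ (l, i))"
      proof (intro sum.cong refl)
        fix l assume "l \<in> {..<n}"
        then have "col X i $ l = X $$ (l, i)" "col V i $ l = V $$ (l, i)"
          using that mn X(2) V(1) by auto
        then show "cnj (X $$ (l, j)) * V $$ (l, i) = cnj (X $$ (l, j)) * X $$ (l, i)"
          using X(4)[OF that] by simp
      qed
      also have "\<dots> = (mat_adjoint X * X) $$ (j, i)"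
        using that j mn X(2) by (subst mult_mat_index[OF Xa X(2)]) auto
      also have "\<dots> = 0" using that j mn X(3) by simp
      finally show ?thesis .
    qed
    have "(mat_adjoint X *\<^sub>v w) $ j = (\<Sum>l<n. cnj (X $$ (l, j)) * w $ l)"
      using j X(2) by (subst mult_vec_index[OF Xa wc]) auto
    also have "\<dots> = (\<Sum>l<n. cnj (X $$ (l, j)) * (V *\<^sub>v x) $ l)"
      using V(4)[OF w] by (simp add: x_def)
    also have "\<dots> = (\<Sum>l<n. \<Sum>i<m. cnj (X $$ (l, j)) * V $$ (l, i) * x $ i)"
      by (simp add: mult_vec_index[OF V(1) x] sum_distrib_left mult.assoc del: index_mult_mat_vec)
    also have "\<dots> = (\<Sum>i<m. (\<Sum>l<n. cnj (X $$ (l, j)) * V $$ (l, i)) * x $ i)"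
      by (subst sum.swap) (simp add: sum_distrib_right)
    also have "\<dots> = 0" by (simp add: XX)
    finally show ?thesis .
  qed
  moreover have "col X j \<in> W" if "j < m" for j using that X(4) V(3) by simp
  ultimately show thesis using mn that by blast
qed


section \<open>Decomposition of a unitary representation into irreducible blocks\<close>

lemma unitary_rep_change_basis:
  assumes U: "unitary_rep n U" and V: "unitary_mat n V"
  shows "unitary_rep n (\<lambda>g. mat_adjoint V * U g * V)"
proof -
  note D = unitary_repD[OF U]
  have Vc: "V \<in> carrier_mat n n" "mat_adjoint V \<in> carrier_mat n n" and VV: "V * mat_adjoint V = 1\<^sub>m n"
    using V by (auto simp: unitary_mat_def)
  have "mat_adjoint V * U (g + h) * V = mat_adjoint V * U g * V * (mat_adjoint V * U h * V)" for g h
  proof -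
    have "mat_adjoint V * U g * V * (mat_adjoint V * U h * V)
        = mat_adjoint V * U g * (V * (mat_adjoint V * U h * V))"
      by (rule assoc_mult_mat) (use Vc D(1)[of g] D(1)[of h] in auto)
    also have "V * (mat_adjoint V * U h * V) = V * (mat_adjoint V * U h) * V"
      by (rule assoc_mult_mat[symmetric]) (use Vc D(1)[of g] D(1)[of h] in auto)
    also have "V * (mat_adjoint V * U h) = V * mat_adjoint V * U h"
      by (rule assoc_mult_mat[symmetric]) (use Vc D(1)[of g] D(1)[of h] in auto)
    also have "\<dots> = U h" using D(1)[of h] by (simp add: VV)
    also have "mat_adjoint V * U g * (U h * V) = mat_adjoint V * U g * U h * V"
      by (rule assoc_mult_mat[symmetric]) (use Vc D(1)[of g] D(1)[of h] in auto)
    also have "mat_adjoint V * U g * U h = mat_adjoint V * (U g * U h)"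
      by (rule assoc_mult_mat) (use Vc D(1)[of g] D(1)[of h] in auto)
    finally show ?thesis by (simp add: D(4))
  qed
  moreover have "unitary_mat n (mat_adjoint V * U g * V)" for g
    using U V by (intro unitary_mat_mult unitary_mat_adjoint) (auto simp: unitary_rep_def)
  moreover have "continuous_on UNIV (\<lambda>g. (mat_adjoint V * U g * V) $$ (i, j))"
    if "i < n" "j < n" for i j
  proof -
    have "(mat_adjoint V * U g * V) $$ (i, j) =
        (\<Sum>l<n. (\<Sum>k<n. cnj (V $$ (k, i)) * U g $$ (k, l)) * V $$ (l, j))" for g
    proof -
      have "mat_adjoint V * U g \<in> carrier_mat n n" using Vc D(1)[of g] by auto
      then show ?thesis
        using that Vc(1) D(1)[of g]
        by (simp add: mult_mat_index[OF _ Vc(1)] mult_mat_index[OF Vc(2) D(1)] del: index_mult_mat(1))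
    qed
    then show ?thesis
      using U that unfolding unitary_rep_def by (auto intro!: continuous_intros)
  qed
  ultimately show ?thesis by (simp add: unitary_rep_def)
qed

text \<open>Invariance of one subspace gives only block triangular matrices. The other corner
  vanishes because \<open>B g\<close> is the adjoint of \<open>B (- g)\<close>, whose lower left
  corner is zero as well.\<close>

lemma block_unitary_rep:
  assumes B: "unitary_rep n B" and m: "m < n"
    and off: "\<And>g i j. m \<le> i \<Longrightarrow> i < n \<Longrightarrow> j < m \<Longrightarrow> B g $$ (i, j) = 0"
  obtains B1 B2 where "unitary_rep m B1" "unitary_rep (n - m) B2"
    "\<And>g. B g = four_block_mat (B1 g) (0\<^sub>m m (n - m)) (0\<^sub>m (n - m) m) (B2 g)"
proof -
  define B1 where "B1 = (\<lambda>g. mat m m (\<lambda>(i, j). B g $$ (i, j)))"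
  define B2 where "B2 = (\<lambda>g. mat (n - m) (n - m) (\<lambda>(i, j). B g $$ (i + m, j + m)))"
  note D = unitary_repD[OF B]
  have c: "B1 g \<in> carrier_mat m m" "B2 g \<in> carrier_mat (n - m) (n - m)" for g
    by (auto simp: B1_def B2_def)
  have off': "B g $$ (i, j) = 0" if "i < m" "m \<le> j" "j < n" for g i j
  proof -
    have "B g = mat_adjoint (B (- g))" using unitary_rep_uminus[OF B, of "- g"] by simp
    then have "B g $$ (i, j) = cnj (B (- g) $$ (j, i))"
      using that m D(1)[of "- g"] by (metis carrier_matD conjugate_complex_def less_trans mat_adjoint_index)
    then show ?thesis using off[of j i "- g"] that by simp
  qed
  have B_eq: "B g = four_block_mat (B1 g) (0\<^sub>m m (n - m)) (0\<^sub>m (n - m) m) (B2 g)" for g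
    using D(1)[of g] m off off'
    by (intro eq_matI) (auto simp: B1_def B2_def)
  have adj: "mat_adjoint (B g) = four_block_mat (mat_adjoint (B1 g)) (0\<^sub>m m (n - m)) (0\<^sub>m (n - m) m)
      (mat_adjoint (B2 g))" for g
    unfolding B_eq using c[of g] m by (intro eq_matI) auto
  have blocks: "X1 = Y1 \<and> X2 = Y2"
    if "four_block_mat X1 (0\<^sub>m m (n - m)) (0\<^sub>m (n - m) m) X2 =
        four_block_mat Y1 (0\<^sub>m m (n - m)) (0\<^sub>m (n - m) m) Y2"
      "X1 \<in> carrier_mat m m" "X2 \<in> carrier_mat (n - m) (n - m)"
      "Y1 \<in> carrier_mat m m" "Y2 \<in> carrier_mat (n - m) (n - m)" for X1 X2 Y1 Y2 :: "complex mat"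
  proof
    show "X1 = Y1"
    proof (rule eq_matI)
      fix i j assume "i < dim_row Y1" "j < dim_col Y1"
      then show "X1 $$ (i, j) = Y1 $$ (i, j)"
        using that(2-5) arg_cong[OF that(1), of "\<lambda>X. X $$ (i, j)"] by auto
    qed (use that in auto)
    show "X2 = Y2"
    proof (rule eq_matI)
      fix i j assume "i < dim_row Y2" "j < dim_col Y2"
      then show "X2 $$ (i, j) = Y2 $$ (i, j)"
        using that(2-5) arg_cong[OF that(1), of "\<lambda>X. X $$ (i + m, j + m)"] by auto
    qed (use that in auto)
  qed
  have mult4: "four_block_mat X1 (0\<^sub>m m (n - m)) (0\<^sub>m (n - m) m) X2 *
        four_block_mat Y1 (0\<^sub>m m (n - m)) (0\<^sub>m (n - m) m) Y2 =
      four_block_mat (X1 * Y1) (0\<^sub>m m (n - m)) (0\<^sub>m (n - m) m) (X2 * Y2)"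
    if "X1 \<in> carrier_mat m m" "X2 \<in> carrier_mat (n - m) (n - m)"
      "Y1 \<in> carrier_mat m m" "Y2 \<in> carrier_mat (n - m) (n - m)" for X1 X2 Y1 Y2 :: "complex mat"
    using that
    by (subst mult_four_block_mat[where ?nr1.0=m and ?n1.0=m and ?n2.0="n-m" and ?nr2.0="n-m"
        and ?nc1.0=m and ?nc2.0="n-m"])
      (auto simp: left_add_zero_mat right_add_zero_mat)
  have one4: "1\<^sub>m n = four_block_mat (1\<^sub>m m) (0\<^sub>m m (n - m)) (0\<^sub>m (n - m) m) (1\<^sub>m (n - m) :: complex mat)"
    using m by (intro eq_matI) auto
  have mc: "mat_adjoint (B1 g) \<in> carrier_mat m m" "mat_adjoint (B2 g) \<in> carrier_mat (n - m) (n - m)" for g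
    using c[of g] by auto
  have un: "mat_adjoint (B1 g) * B1 g = 1\<^sub>m m \<and> mat_adjoint (B2 g) * B2 g = 1\<^sub>m (n - m)" for g
  proof (rule blocks)
    show "four_block_mat (mat_adjoint (B1 g) * B1 g) (0\<^sub>m m (n - m)) (0\<^sub>m (n - m) m) (mat_adjoint (B2 g) * B2 g)
      = four_block_mat (1\<^sub>m m) (0\<^sub>m m (n - m)) (0\<^sub>m (n - m) m) (1\<^sub>m (n - m))"
      using D(2)[of g] unfolding adj unfolding B_eq[of g] one4 mult4[OF mc c] .
  qed (use mc[of g] c[of g] in auto)
  have mu: "B1 (g + h) = B1 g * B1 h \<and> B2 (g + h) = B2 g * B2 h" for g h
  proof (rule blocks)
    show "four_block_mat (B1 (g + h)) (0\<^sub>m m (n - m)) (0\<^sub>m (n - m) m) (B2 (g + h))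
      = four_block_mat (B1 g * B1 h) (0\<^sub>m m (n - m)) (0\<^sub>m (n - m) m) (B2 g * B2 h)"
      using D(4)[of g h] unfolding B_eq mult4[OF c c] .
  qed (use c[of g] c[of h] c[of "g + h"] in auto)
  have "unitary_rep m B1" "unitary_rep (n - m) B2"
    unfolding unitary_rep_def
    using c un mu B m by (auto intro!: unitary_matI simp: B1_def B2_def unitary_rep_def)
  then show thesis using B_eq that by blast
qed

lemma rep_equiv_four_block:
  assumes "rep_equiv A A'" "rep_equiv B B'"
    and dims: "\<And>g. A g \<in> carrier_mat n n" "\<And>g. B g \<in> carrier_mat m m"
  shows "rep_equiv (\<lambda>g. four_block_mat (A g) (0\<^sub>m n m) (0\<^sub>m m n) (B g))
    (\<lambda>g. four_block_mat (A' g) (0\<^sub>m n m) (0\<^sub>m m n) (B' g))"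
proof -
  obtain n' U where *: "\<And>g. A g \<in> carrier_mat n' n'" "\<And>g. A' g \<in> carrier_mat n' n'"
    "unitary_mat n' U" "\<And>g. U * A g = A' g * U"
    using rep_equivE[OF assms(1)] by metis
  obtain m' V where m: "\<And>g. B g \<in> carrier_mat m' m'" "\<And>g. B' g \<in> carrier_mat m' m'"
    "unitary_mat m' V" "\<And>g. V * B g = B' g * V"
    using rep_equivE[OF assms(2)] by metis
  have [simp]: "n' = n" "m' = m" using dims *(1) m(1) by (metis carrier_matD(1))+
  let ?blk = "\<lambda>X Y. four_block_mat X (0\<^sub>m n m) (0\<^sub>m m n) Y :: complex mat"
  have mult4: "?blk X1 X2 * ?blk Y1 Y2 = ?blk (X1 * Y1) (X2 * Y2)"
    if "X1 \<in> carrier_mat n n" "X2 \<in> carrier_mat m m"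
      "Y1 \<in> carrier_mat n n" "Y2 \<in> carrier_mat m m" for X1 X2 Y1 Y2
    using that
    by (subst mult_four_block_mat[where ?nr1.0=n and ?n1.0=n and ?n2.0=m and ?nr2.0=m
        and ?nc1.0=n and ?nc2.0=m])
      (auto simp: left_add_zero_mat right_add_zero_mat)
  have UV: "U \<in> carrier_mat n n" "V \<in> carrier_mat m m" "mat_adjoint U * U = 1\<^sub>m n" "mat_adjoint V * V = 1\<^sub>m m"
    using *(3) m(3) by (auto simp: unitary_mat_def)
  have "mat_adjoint (?blk U V) = ?blk (mat_adjoint U) (mat_adjoint V)"
    using UV(1,2) by (intro eq_matI) auto
  then have "mat_adjoint (?blk U V) * ?blk U V = ?blk (1\<^sub>m n) (1\<^sub>m m)"
    using UV by (simp add: mult4)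
  then have "unitary_mat (n + m) (?blk U V)"
    using UV by (intro unitary_matI) auto
  then show ?thesis
    using * m UV dims by (intro rep_equivI[where n="n + m" and U="?blk U V"]) (auto simp: mult4)
qed

text \<open>Strong induction on the dimension: in an orthonormal basis adapted to a proper nonzero
  invariant subspace the representation splits into two unitary blocks of smaller dimension.\<close>

lemma complete_reducibility:
  "unitary_rep n U \<Longrightarrow> \<exists>\<pi>s. set \<pi>s \<subseteq> irreps \<and> rep_equiv U (\<lambda>g. diag_block_mat (map (\<lambda>\<pi>. \<pi> g) \<pi>s))"
proof (induction n arbitrary: U rule: less_induct)
  case (less n)
  note D = unitary_repD[OF less.prems]
  consider "n = 0" | "irreducible_rep n U" | "n > 0" "\<not> irreducible_rep n U" by blast
  then show ?case
  proof cases
    case 1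
    \<comment> \<open>Dimension zero corresponds to the empty list, whose block matrix has no rows
      and no columns.\<close>
    have "(\<lambda>g. diag_block_mat (map (\<lambda>\<pi>. \<pi> g) [])) = U"
    proof (intro ext eq_matI)
      fix g i j assume "i < dim_row (U g)" "j < dim_col (U g)"
      then show "diag_block_mat (map (\<lambda>\<pi>. \<pi> g) []) $$ (i, j) = U g $$ (i, j)"
        using carrier_matD(1)[OF D(1)[of g]] 1 by simp
    qed (use carrier_matD[OF D(1)] 1 in auto)
    then have "rep_equiv U (\<lambda>g. diag_block_mat (map (\<lambda>\<pi>. \<pi> g) []))"
      using rep_equiv_refl[of U n] D(1) by simp
    then show ?thesis by (intro exI[of _ "[]"]) auto
  next
    case 2
    then have "rep_equiv U (\<lambda>g. diag_block_mat (map (\<lambda>\<pi>. \<pi> g) [U]))"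
      using rep_equiv_refl[of U n] D(1) by (simp only: list.map diag_block_mat_singleton)
    then show ?thesis using 2 by (intro exI[of _ "[U]"]) (auto simp: irreps_def)
  next
    case 3
    then obtain W where W: "VectorSpace.subspace class_ring W (module_vec TYPE(complex) n)"
      "\<And>g w. w \<in> W \<Longrightarrow> U g *\<^sub>v w \<in> W" "W \<noteq> {0\<^sub>v n}" "W \<noteq> carrier_vec n"
      using less.prems by (auto simp: irreducible_rep_def)
    have Wc: "W \<subseteq> carrier_vec n" using W(1) by (simp add: complex_subspace_iff)
    obtain m V where V: "0 < m" "m < n" "unitary_mat n V" "\<And>j. j < m \<Longrightarrow> col V j \<in> W"
      "\<And>w j. w \<in> W \<Longrightarrow> m \<le> j \<Longrightarrow> j < n \<Longrightarrow> (mat_adjoint V *\<^sub>v w) $ j = 0"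
      using adapted_unitary[OF complex_vec_subspaceI[OF W(1)] W(3,4)] by metis
    have Vc: "V \<in> carrier_mat n n" "mat_adjoint V \<in> carrier_mat n n"
      using V(3) by (auto simp: unitary_mat_def)
    define B where "B = (\<lambda>g. mat_adjoint V * U g * V)"
    have B: "unitary_rep n B" unfolding B_def by (rule unitary_rep_change_basis[OF less.prems V(3)])
    \<comment> \<open>The first \<open>m\<close> columns of \<open>V\<close> lie in
      \<open>W\<close>, \<open>U g\<close> keeps them there, and the remaining rows of
      \<open>mat_adjoint V\<close> annihilate \<open>W\<close>.\<close>
    have "B g $$ (i, j) = 0" if "m \<le> i" "i < n" "j < m" for g i j
    proof -
      have "B g = mat_adjoint V * (U g * V)"
        unfolding B_def by (rule assoc_mult_mat) (use Vc D(1)[of g] in auto)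
      moreover have "col (U g * V) j = U g *\<^sub>v col V j"
        using that V(2) by (intro col_mult2[OF D(1) Vc(1)]) simp
      ultimately have "B g $$ (i, j) = (mat_adjoint V *\<^sub>v (U g *\<^sub>v col V j)) $ i"
        using that V(2) carrier_matD[OF Vc(1)] carrier_matD[OF D(1)[of g]]
        by (simp del: col_mult)
      also have "\<dots> = 0" using that V W(2) by auto
      finally show ?thesis .
    qed
    then obtain B1 B2 where B12: "unitary_rep m B1" "unitary_rep (n - m) B2"
      "\<And>g. B g = four_block_mat (B1 g) (0\<^sub>m m (n - m)) (0\<^sub>m (n - m) m) (B2 g)"
      using block_unitary_rep[OF B V(2)] by blast
    obtain p1 where p1: "set p1 \<subseteq> irreps" "rep_equiv B1 (\<lambda>g. diag_block_mat (map (\<lambda>\<pi>. \<pi> g) p1))"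
      using less.IH[OF V(2) B12(1)] by blast
    obtain p2 where p2: "set p2 \<subseteq> irreps" "rep_equiv B2 (\<lambda>g. diag_block_mat (map (\<lambda>\<pi>. \<pi> g) p2))"
      using less.IH[OF _ B12(2)] V(1,2) by auto
    note c = unitary_repD(1)[OF B12(1)] unitary_repD(1)[OF B12(2)]
    have d: "diag_block_mat (map (\<lambda>\<pi>. \<pi> g) p1) \<in> carrier_mat m m"
      "diag_block_mat (map (\<lambda>\<pi>. \<pi> g) p2) \<in> carrier_mat (n - m) (n - m)" for g
      using rep_equivE[OF p1(2)] rep_equivE[OF p2(2)] c by (metis carrier_matD(1))+
    have "rep_equiv B (\<lambda>g. four_block_mat (diag_block_mat (map (\<lambda>\<pi>. \<pi> g) p1)) (0\<^sub>m m (n - m))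
        (0\<^sub>m (n - m) m) (diag_block_mat (map (\<lambda>\<pi>. \<pi> g) p2)))"
      unfolding B12(3) by (rule rep_equiv_four_block[OF p1(2) p2(2) c])
    moreover have "four_block_mat (diag_block_mat (map (\<lambda>\<pi>. \<pi> g) p1)) (0\<^sub>m m (n - m))
        (0\<^sub>m (n - m) m) (diag_block_mat (map (\<lambda>\<pi>. \<pi> g) p2)) =
        diag_block_mat (map (\<lambda>\<pi>. \<pi> g) (p1 @ p2))" for g
      using carrier_matD[OF d(1)[of g]] carrier_matD[OF d(2)[of g]]
      by (simp add: diag_block_mat_append Let_def)
    ultimately have "rep_equiv B (\<lambda>g. diag_block_mat (map (\<lambda>\<pi>. \<pi> g) (p1 @ p2)))" by simp
    moreover have "rep_equiv U B"
    proof (rule rep_equivI[OF D(1) unitary_repD(1)[OF B] unitary_mat_adjoint[OF V(3)]])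
      show "mat_adjoint V * U g = B g * mat_adjoint V" for g
      proof -
        have "B g * mat_adjoint V = mat_adjoint V * U g * (V * mat_adjoint V)"
          unfolding B_def by (rule assoc_mult_mat) (use Vc D(1)[of g] in auto)
        also have "\<dots> = mat_adjoint V * U g"
          using V(3) right_mult_one_mat[OF mult_carrier_mat[OF Vc(2) D(1)]] by (simp add: unitary_mat_def)
        finally show ?thesis ..
      qed
    qed
    ultimately have "rep_equiv U (\<lambda>g. diag_block_mat (map (\<lambda>\<pi>. \<pi> g) (p1 @ p2)))"
      by (rule rep_equiv_trans[rotated])
    then show ?thesis using p1(1) p2(1) by (intro exI[of _ "p1 @ p2"]) auto
  qed
qed

section \<open>Orthonormal families under a star action\<close>

lemma adj_zero [simp]: "adj (0 :: 'a::cstar_algebra) = 0"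
  using adj_scaleC[of 0 "0 :: 'a"] by simp

lemma adj_one [simp]: "adj (1 :: 'a::cstar_algebra) = 1"
  using adj_mult[of "adj 1" "1 :: 'a"] by (simp add: adj_adj)

lemma adj_sum: "adj (\<Sum>i\<in>I. f i) = (\<Sum>i\<in>I. adj (f i :: 'a::cstar_algebra))"
  by (induction I rule: infinite_finite_induct) (simp_all add: adj_add)

lemma alg_inner_eq: "adj A * B = c *\<^sub>C 1 \<Longrightarrow> alg_inner A B = c"
  unfolding alg_inner_def by (rule the_equality) (simp_all add: complex_vs.scale_cancel_right)

lemma scaleC_sum_sum:
  "(\<Sum>i\<in>I. a i *\<^sub>C x i) * y * (\<Sum>k\<in>K. b k *\<^sub>C z k) =
    (\<Sum>i\<in>I. \<Sum>k\<in>K. (a i * b k) *\<^sub>C (x i * y * z k :: 'a::cstar_algebra))"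
  by (simp add: sum_distrib_right[of _ _ y] sum_product mult_scaleC_left mult_scaleC_right scaleC_scaleC
      mult.commute)

text \<open>With \<open>M\<close> a change of basis this makes endomorphisms independent of the basis; with \<open>M\<close> the
  matrix of a group element it makes intertwiners invariant.\<close>

lemma sum_unitary_mix:
  fixes X Y :: "nat \<Rightarrow> 'a::cstar_algebra"
  assumes M: "unitary_mat n M"
  shows "(\<Sum>j<n. (\<Sum>i<n. M $$ (i, j) *\<^sub>C X i) * A * (\<Sum>k<n. cnj (M $$ (k, j)) *\<^sub>C Y k)) =
    (\<Sum>j<n. X j * A * Y j)"
proof -
  have c: "M \<in> carrier_mat n n" "mat_adjoint M \<in> carrier_mat n n" and MM: "M * mat_adjoint M = 1\<^sub>m n"
    using M by (auto simp: unitary_mat_def)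
  have 1: "(\<Sum>j<n. M $$ (i, j) * cnj (M $$ (k, j))) = (if i = k then 1 else 0)" if "i < n" "k < n" for i k
  proof -
    have "(M * mat_adjoint M) $$ (i, k) = (if i = k then 1 else 0)" using that MM by simp
    then show ?thesis using that c(1) by (subst (asm) mult_mat_index[OF c]) auto
  qed
  have "(\<Sum>j<n. (\<Sum>i<n. M $$ (i, j) *\<^sub>C X i) * A * (\<Sum>k<n. cnj (M $$ (k, j)) *\<^sub>C Y k)) =
      (\<Sum>j<n. \<Sum>i<n. \<Sum>k<n. (M $$ (i, j) * cnj (M $$ (k, j))) *\<^sub>C (X i * A * Y k))"
    by (simp add: scaleC_sum_sum)
  also have "\<dots> = (\<Sum>i<n. \<Sum>k<n. \<Sum>j<n. (M $$ (i, j) * cnj (M $$ (k, j))) *\<^sub>C (X i * A * Y k))"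
    by (rule trans[OF sum.swap sum.cong[OF refl sum.swap]])
  also have "\<dots> = (\<Sum>i<n. \<Sum>k<n. (if i = k then 1 else 0) *\<^sub>C (X i * A * Y k))"
    by (intro sum.cong refl) (simp add: complex_vs.scale_sum_left[symmetric] 1)
  also have "\<dots> = (\<Sum>j<n. X j * A * Y j)"
    by (simp add: if_distrib if_distribR sum.delta' cong: if_cong)
  finally show ?thesis .
qed

text \<open>Indexed families with identities in the algebra replace lists and
  \<open>alg_inner\<close>, so that no definite description has to be evaluated and a family can be
  cut into blocks.\<close>

definition orthonormal :: "nat \<Rightarrow> (nat \<Rightarrow> 'a::cstar_algebra) \<Rightarrow> bool" where
  "orthonormal n \<Phi> \<longleftrightarrow> (\<forall>i<n. \<forall>j<n. adj (\<Phi> i) * \<Phi> j = (if i = j then 1 else 0))"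

text \<open>This is the sum behind \<open>canonical_endo\<close>, taken for a given family whose
  support need not be the unit; a block of a basis is such a family.\<close>

definition endo :: "nat \<Rightarrow> (nat \<Rightarrow> 'a::cstar_algebra) \<Rightarrow> 'a \<Rightarrow> 'a" where
  "endo n \<Phi> A = (\<Sum>i<n. \<Phi> i * A * adj (\<Phi> i))"

lemma orthonormalD: "orthonormal n \<Phi> \<Longrightarrow> i < n \<Longrightarrow> j < n \<Longrightarrow> adj (\<Phi> i) * \<Phi> j = (if i = j then 1 else 0)"
  by (simp add: orthonormal_def)

lemma orthonormal_cancel:
  assumes "orthonormal n \<Phi>" "j < n"
  shows "adj (\<Phi> j) * (\<Sum>i<n. \<Phi> i * b i) = b j"
proof -
  have "adj (\<Phi> j) * (\<Sum>i<n. \<Phi> i * b i) = (\<Sum>i<n. adj (\<Phi> j) * \<Phi> i * b i)"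
    by (simp add: sum_distrib_left mult.assoc)
  also have "\<dots> = (\<Sum>i<n. if i = j then b i else 0)"
    using assms by (intro sum.cong refl) (auto simp: orthonormal_def)
  finally show ?thesis using assms(2) by simp
qed

lemma orthonormal_cancel_right:
  assumes "orthonormal n \<Phi>" "j < n"
  shows "(\<Sum>i<n. b i * adj (\<Phi> i)) * \<Phi> j = b j"
proof -
  have "(\<Sum>i<n. b i * adj (\<Phi> i)) * \<Phi> j = (\<Sum>i<n. b i * (adj (\<Phi> i) * \<Phi> j))"
    by (simp add: sum_distrib_right mult.assoc)
  also have "\<dots> = (\<Sum>i<n. if i = j then b i else 0)"
    using assms by (intro sum.cong refl) (auto simp: orthonormal_def)
  finally show ?thesis using assms(2) by simp
qed

lemma endo_mult_basis: "orthonormal n \<Phi> \<Longrightarrow> j < n \<Longrightarrow> endo n \<Phi> A * \<Phi> j = \<Phi> j * A"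
  unfolding endo_def by (rule orthonormal_cancel_right)

lemma adj_basis_mult_endo: "orthonormal n \<Phi> \<Longrightarrow> j < n \<Longrightarrow> adj (\<Phi> j) * endo n \<Phi> A = A * adj (\<Phi> j)"
  using orthonormal_cancel[of n \<Phi> j "\<lambda>i. A * adj (\<Phi> i)"] by (simp add: endo_def mult.assoc)

lemma endo_mult:
  assumes "orthonormal n \<Phi>"
  shows "endo n \<Phi> (A * B) = endo n \<Phi> A * endo n \<Phi> B"
proof -
  have "endo n \<Phi> A * endo n \<Phi> B = (\<Sum>j<n. endo n \<Phi> A * \<Phi> j * B * adj (\<Phi> j))"
    unfolding endo_def[of n \<Phi> B] by (simp add: sum_distrib_left mult.assoc)
  also have "\<dots> = endo n \<Phi> (A * B)"
    unfolding endo_def[of n \<Phi> "A * B"]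
    by (intro sum.cong refl) (simp add: endo_mult_basis[OF assms] mult.assoc)
  finally show ?thesis ..
qed

lemma endo_adj: "adj (endo n \<Phi> A) = endo n \<Phi> (adj A)"
  by (simp add: endo_def adj_sum adj_mult adj_adj mult.assoc)

lemma endo_sum: "endo n \<Phi> (\<Sum>i\<in>I. f i) = (\<Sum>i\<in>I. endo n \<Phi> (f i))"
  unfolding endo_def by (subst sum.swap) (simp add: sum_distrib_left sum_distrib_right)

lemma orthonormal_mix:
  assumes M: "unitary_mat n M" and on: "orthonormal n \<Phi>"
  shows "orthonormal n (\<lambda>j. \<Sum>i<n. M $$ (i, j) *\<^sub>C \<Phi> i)"
  unfolding orthonormal_def
proof (intro allI impI)
  fix a b assume ab: "a < n" "b < n"
  have c: "M \<in> carrier_mat n n" "mat_adjoint M \<in> carrier_mat n n" and MM: "mat_adjoint M * M = 1\<^sub>m n"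
    using M by (auto simp: unitary_mat_def)
  have "adj (\<Sum>i<n. M $$ (i, a) *\<^sub>C \<Phi> i) * (\<Sum>i<n. M $$ (i, b) *\<^sub>C \<Phi> i) =
      (\<Sum>i<n. \<Sum>k<n. (cnj (M $$ (i, a)) * M $$ (k, b)) *\<^sub>C (adj (\<Phi> i) * \<Phi> k))"
    using scaleC_sum_sum[where y=1] by (simp add: adj_sum adj_scaleC)
  also have "\<dots> = (\<Sum>i<n. \<Sum>k<n. if i = k then (cnj (M $$ (i, a)) * M $$ (k, b)) *\<^sub>C 1 else 0)"
    by (intro sum.cong refl) (simp add: orthonormalD[OF on])
  also have "\<dots> = (\<Sum>i<n. cnj (M $$ (i, a)) * M $$ (i, b)) *\<^sub>C 1"
    by (simp add: complex_vs.scale_sum_left)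
  also have "(\<Sum>i<n. cnj (M $$ (i, a)) * M $$ (i, b)) = (mat_adjoint M * M) $$ (a, b)"
    using ab c(1) by (subst mult_mat_index[OF c(2,1)]) auto
  also have "\<dots> *\<^sub>C 1 = (if a = b then 1 else (0 :: 'a))" using ab MM by simp
  finally show "adj (\<Sum>i<n. M $$ (i, a) *\<^sub>C \<Phi> i) * (\<Sum>i<n. M $$ (i, b) *\<^sub>C \<Phi> i) =
      (if a = b then 1 else 0)" .
qed

lemma sum_list_nth: "(\<Sum>x\<leftarrow>xs. f x) = (\<Sum>i<length xs. f (xs ! i))"
  by (simp add: sum_list_sum_nth lessThan_atLeast0)

lemma span_invariant:
  assumes "\<And>x. x \<in> S \<Longrightarrow> P * x = x * A"
    and "x \<in> complex_vs.span S"
  shows "P * x = x * A"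
  using assms(2)
proof (induction rule: complex_vs.span_induct_alt)
  case (step c x y)
  then show ?case using assms(1) by (simp add: distrib_left distrib_right mult_scaleC_left mult_scaleC_right)
qed simp

text \<open>Every vector of \<open>H\<close> intertwines the identity with the endomorphism of any
  orthonormal basis. Multiplying that endomorphism by the support of a second basis, known to be the
  unit, turns it into the endomorphism of the second basis. Hence the definite description is well
  defined, and the support is the unit for every basis.\<close>

lemma algebraic_hilbert_space_basis:
  assumes H: "algebraic_hilbert_space H" and \<Phi>: "orthonormal_basis H \<Phi>"
  shows "orthonormal (length \<Phi>) ((!) \<Phi>)" "endo (length \<Phi>) ((!) \<Phi>) 1 = 1"
    "canonical_endo H A = endo (length \<Phi>) ((!) \<Phi>) A"
proof -
  have on: "orthonormal (length \<Phi>) ((!) \<Phi>)" if "orthonormal_basis H \<Phi>" for \<Phi>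
    unfolding orthonormal_def
  proof (intro allI impI)
    fix i j assume ij: "i < length \<Phi>" "j < length \<Phi>"
    then have "\<Phi> ! i \<in> H" "\<Phi> ! j \<in> H"
      using that complex_vs.span_base unfolding orthonormal_basis_def by (metis nth_mem)+
    then obtain c where c: "adj (\<Phi> ! i) * \<Phi> ! j = c *\<^sub>C 1"
      using H by (auto simp: algebraic_hilbert_space_def)
    then have "c = (if i = j then 1 else 0)"
      using that ij alg_inner_eq[OF c] by (simp add: orthonormal_basis_def)
    with c show "adj (\<Phi> ! i) * \<Phi> ! j = (if i = j then 1 else 0)" by simp
  qed
  have inter: "endo (length \<Phi>) ((!) \<Phi>) B * x = x * B" if "orthonormal_basis H \<Phi>" "x \<in> H" for \<Phi> B x
  proof (rule span_invariant[of "set \<Phi>"])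
    show "x \<in> complex_vs.span (set \<Phi>)" using that by (simp add: orthonormal_basis_def)
    show "endo (length \<Phi>) ((!) \<Phi>) B * y = y * B" if "y \<in> set \<Phi>" for y
      using that endo_mult_basis[OF on[OF \<open>orthonormal_basis H \<Phi>\<close>]] by (metis in_set_conv_nth)
  qed
  have mem: "\<Phi> ! i \<in> H" if "orthonormal_basis H \<Phi>" "i < length \<Phi>" for i \<Phi>
    using that complex_vs.span_base unfolding orthonormal_basis_def by (metis nth_mem)
  obtain \<Psi> where \<Psi>: "orthonormal_basis H \<Psi>" "endo (length \<Psi>) ((!) \<Psi>) 1 = 1"
    using H by (auto simp: algebraic_hilbert_space_def endo_def sum_list_nth)
  have eq: "endo (length \<Phi>) ((!) \<Phi>) B = endo (length \<Psi>) ((!) \<Psi>) B" if "orthonormal_basis H \<Phi>" for \<Phi> B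
  proof -
    have "endo (length \<Phi>) ((!) \<Phi>) B = endo (length \<Phi>) ((!) \<Phi>) B * endo (length \<Psi>) ((!) \<Psi>) 1"
      by (simp add: \<Psi>)
    also have "\<dots> = endo (length \<Psi>) ((!) \<Psi>) B"
      unfolding endo_def[of "length \<Psi>"]
      using inter[OF that mem[OF \<Psi>(1)], of _ B]
      by (simp add: sum_distrib_left mult.assoc[symmetric])
    finally show ?thesis .
  qed
  show "orthonormal (length \<Phi>) ((!) \<Phi>)" "endo (length \<Phi>) ((!) \<Phi>) 1 = 1"
    using on[OF \<Phi>] eq[OF \<Phi>] \<Psi>(2) by auto
  have "canonical_endo H A = endo (length \<Psi>) ((!) \<Psi>) A"
    unfolding canonical_endo_def
  proof (rule the_equality)
    show "\<exists>\<Phi>. orthonormal_basis H \<Phi> \<and> endo (length \<Psi>) ((!) \<Psi>) A = (\<Sum>\<phi>\<leftarrow>\<Phi>. \<phi> * A * adj \<phi>)"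
      using \<Psi>(1) by (intro exI[of _ \<Psi>]) (simp add: sum_list_nth endo_def)
  qed (use eq in \<open>auto simp: sum_list_nth endo_def\<close>)
  then show "canonical_endo H A = endo (length \<Phi>) ((!) \<Phi>) A" using eq[OF \<Phi>] by simp
qed

section \<open>The action, its fixed point algebra and its multiplets\<close>

locale star_action =
  fixes \<alpha> :: "'g::{topological_group_add, t2_space} \<Rightarrow> 'f::cstar_algebra \<Rightarrow> 'f"
  assumes action: "continuous_action \<alpha>"
begin

lemma star_automorphism: "star_automorphism (\<alpha> g)"
  using action unfolding continuous_action_def by blast

lemma action_add: "\<alpha> g (x + y) = \<alpha> g x + \<alpha> g y"
  and action_scaleC: "\<alpha> g (c *\<^sub>C x) = c *\<^sub>C \<alpha> g x"
  and action_mult: "\<alpha> g (x * y) = \<alpha> g x * \<alpha> g y"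
  and action_adj: "\<alpha> g (adj x) = adj (\<alpha> g x)"
  and action_bij: "bij (\<alpha> g)"
  using star_automorphism[of g] by (simp_all add: star_automorphism_def)

lemma action_plus: "\<alpha> (g + h) x = \<alpha> g (\<alpha> h x)"
proof -
  have "\<alpha> (g + h) = \<alpha> g \<circ> \<alpha> h" using action unfolding continuous_action_def by (elim conjE allE)
  then show ?thesis by simp
qed

lemma action_continuous: "continuous_on UNIV (\<lambda>g. \<alpha> g x)"
  using action unfolding continuous_action_def by blast

lemma action_zero [simp]: "\<alpha> g 0 = 0"
  using action_scaleC[of g 0 0] by simp

lemma action_one [simp]: "\<alpha> g 1 = 1"
proof -
  \<comment> \<open>Preservation of the unit is not part of \<open>star_automorphism\<close>; it
    follows from multiplicativity once \<open>1\<close> has a preimage.\<close>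
  obtain x where "\<alpha> g x = 1" using action_bij[of g] by (metis bij_pointE)
  then show ?thesis using action_mult[of g 1 x] by simp
qed

lemma action_sum: "\<alpha> g (\<Sum>i\<in>I. f i) = (\<Sum>i\<in>I. \<alpha> g (f i))"
  by (induction I rule: infinite_finite_induct) (simp_all add: action_add)

abbreviation \<A> where "\<A> \<equiv> fixed_algebra \<alpha>"

abbreviation \<Z> where "\<Z> \<equiv> fixed_center \<alpha>"

lemma fixedI: "(\<And>g. \<alpha> g x = x) \<Longrightarrow> x \<in> \<A>"
  by (simp add: fixed_algebra_def)

lemma fixedD: "x \<in> \<A> \<Longrightarrow> \<alpha> g x = x"
  by (simp add: fixed_algebra_def)

lemma fixed_mult: "x \<in> \<A> \<Longrightarrow> y \<in> \<A> \<Longrightarrow> x * y \<in> \<A>"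
  by (simp add: fixed_algebra_def action_mult)

lemma fixed_adj: "x \<in> \<A> \<Longrightarrow> adj x \<in> \<A>"
  by (simp add: fixed_algebra_def action_adj)

lemma fixed_one: "1 \<in> \<A>"
  by (simp add: fixed_algebra_def)

lemma fixed_sum: "(\<And>i. i \<in> I \<Longrightarrow> f i \<in> \<A>) \<Longrightarrow> (\<Sum>i\<in>I. f i) \<in> \<A>"
  by (simp add: fixed_algebra_def action_sum)

lemma center_fixed: "z \<in> \<Z> \<Longrightarrow> z \<in> \<A>"
  by (simp add: fixed_center_def)

lemma center_commute: "z \<in> \<Z> \<Longrightarrow> x \<in> \<A> \<Longrightarrow> z * x = x * z"
  by (simp add: fixed_center_def commutant_def)

lemma centerI: "z \<in> \<A> \<Longrightarrow> (\<And>x. x \<in> \<A> \<Longrightarrow> z * x = x * z) \<Longrightarrow> z \<in> \<Z>"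
  by (simp add: fixed_center_def commutant_def)

lemma center_adj: "z \<in> \<Z> \<Longrightarrow> adj z \<in> \<Z>"
proof (rule centerI)
  assume z: "z \<in> \<Z>"
  then show "adj z \<in> \<A>" by (intro fixed_adj center_fixed)
  fix x assume "x \<in> \<A>"
  then have "adj (z * adj x) = adj (adj x * z)" by (simp add: center_commute[OF z] fixed_adj)
  then show "adj z * x = x * adj z" by (simp add: adj_mult adj_adj)
qed

definition transforms :: "nat \<Rightarrow> (nat \<Rightarrow> 'f) \<Rightarrow> 'g rep \<Rightarrow> bool" where
  "transforms n \<Phi> U \<longleftrightarrow> unitary_rep n U \<and> (\<forall>g. \<forall>j<n. \<alpha> g (\<Phi> j) = (\<Sum>i<n. U g $$ (i, j) *\<^sub>C \<Phi> i))"

lemma transformsD: "transforms n \<Phi> U \<Longrightarrow> j < n \<Longrightarrow> \<alpha> g (\<Phi> j) = (\<Sum>i<n. U g $$ (i, j) *\<^sub>C \<Phi> i)"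
  by (simp add: transforms_def)

text \<open>Orthonormality recovers the entries of \<open>U g\<close> as the scalars in
  \<open>adj (\<Phi> i) * \<alpha> g (\<Phi> j)\<close>. Unitarity, multiplicativity and continuity
  of \<open>U\<close> are then inherited from the action.\<close>

lemma transformsI:
  assumes on: "orthonormal n \<Phi>" and c: "\<And>g. U g \<in> carrier_mat n n"
    and t: "\<And>g j. j < n \<Longrightarrow> \<alpha> g (\<Phi> j) = (\<Sum>i<n. U g $$ (i, j) *\<^sub>C \<Phi> i)"
  shows "transforms n \<Phi> U"
proof -
  have entry: "adj (\<Phi> i) * \<alpha> g (\<Phi> j) = U g $$ (i, j) *\<^sub>C 1" if "i < n" "j < n" for g i j
    using orthonormal_cancel[OF on that(1), of "\<lambda>k. U g $$ (k, j) *\<^sub>C 1"] t[OF that(2)]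
    by (simp add: mult_scaleC_right)
  have entry': "x = y" if "x *\<^sub>C (1 :: 'f) = y *\<^sub>C 1" for x y
    using that by (simp add: complex_vs.scale_cancel_right)
  have "unitary_mat n (U g)" for g
  proof (rule unitary_matI[OF c])
    have c': "mat_adjoint (U g) \<in> carrier_mat n n" using c[of g] by auto
    show "mat_adjoint (U g) * U g = 1\<^sub>m n"
    proof (rule eq_matI)
      fix a b assume "a < dim_row (1\<^sub>m n :: complex mat)" "b < dim_col (1\<^sub>m n :: complex mat)"
      then have ab: "a < n" "b < n" by auto
      have "(mat_adjoint (U g) * U g) $$ (a, b) *\<^sub>C (1 :: 'f) =
          (\<Sum>i<n. cnj (U g $$ (i, a)) * U g $$ (i, b)) *\<^sub>C 1"
        using ab c[of g] by (subst mult_mat_index[OF c' c]) auto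
      also have "\<dots> = (\<Sum>i<n. cnj (U g $$ (i, a)) *\<^sub>C U g $$ (i, b) *\<^sub>C 1)"
        by (simp add: complex_vs.scale_sum_left scaleC_scaleC)
      also have "\<dots> = (\<Sum>i<n. cnj (U g $$ (i, a)) *\<^sub>C (adj (\<Phi> i) * \<alpha> g (\<Phi> b)))"
        using ab by (intro sum.cong refl) (simp add: entry)
      also have "\<dots> = adj (\<alpha> g (\<Phi> a)) * \<alpha> g (\<Phi> b)"
        unfolding t[OF ab(1)] by (simp add: adj_sum adj_scaleC sum_distrib_right mult_scaleC_left)
      also have "\<dots> = \<alpha> g (adj (\<Phi> a) * \<Phi> b)" by (simp add: action_mult action_adj)
      also have "\<dots> = (if a = b then 1 else 0) *\<^sub>C 1" using orthonormalD[OF on ab] by simp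
      finally show "(mat_adjoint (U g) * U g) $$ (a, b) = 1\<^sub>m n $$ (a, b)"
        using ab entry' by (metis index_one_mat(1))
    qed (use c[of g] in auto)
  qed
  moreover have "U (g + h) = U g * U h" for g h
  proof (rule eq_matI)
    fix a b assume "a < dim_row (U g * U h)" "b < dim_col (U g * U h)"
    then have ab: "a < n" "b < n" using c[of g] c[of h] by auto
    have "U (g + h) $$ (a, b) *\<^sub>C (1 :: 'f) = adj (\<Phi> a) * \<alpha> g (\<alpha> h (\<Phi> b))"
      using entry[OF ab, of "g + h"] by (simp add: action_plus)
    also have "\<dots> = (\<Sum>i<n. U h $$ (i, b) *\<^sub>C (adj (\<Phi> a) * \<alpha> g (\<Phi> i)))"
      using t[OF ab(2), of h] by (simp add: action_sum action_scaleC sum_distrib_left mult_scaleC_right)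
    also have "\<dots> = (\<Sum>i<n. (U g $$ (a, i) * U h $$ (i, b)) *\<^sub>C 1)"
      using ab by (intro sum.cong refl) (simp add: entry scaleC_scaleC mult.commute)
    also have "\<dots> = (U g * U h) $$ (a, b) *\<^sub>C 1"
      using ab by (simp add: mult_mat_index[OF c c] complex_vs.scale_sum_left del: index_mult_mat(1))
    finally show "U (g + h) $$ (a, b) = (U g * U h) $$ (a, b)" by (rule entry')
  qed (use c[of g] c[of h] c[of "g + h"] in auto)
  moreover have "continuous_on UNIV (\<lambda>g. U g $$ (i, j))" if "i < n" "j < n" for i j
  proof -
    have "continuous_on UNIV (\<lambda>g. adj (\<Phi> i) * \<alpha> g (\<Phi> j))"
      by (intro continuous_intros action_continuous)
    then have 1: "continuous_on UNIV (\<lambda>g. U g $$ (i, j) *\<^sub>C (1 :: 'f))" using that by (simp add: entry)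
    \<comment> \<open>Scalars embed isometrically as multiples of the unit, so continuity of the
      orbit maps passes to the matrix entries.\<close>
    have d: "dist (x *\<^sub>C (1 :: 'f)) (y *\<^sub>C 1) = dist x y" for x y
      by (simp add: dist_norm complex_vs.scale_left_diff_distrib[symmetric] norm_scaleC)
    show ?thesis
      using 1 unfolding continuous_on_def tendsto_iff d .
  qed
  ultimately show ?thesis using t by (simp add: transforms_def unitary_rep_def)
qed

text \<open>\<open>X\<close> transforms by unitary matrices and \<open>Y\<close> by their
  conjugates, so their pairing is invariant. With \<open>Y\<close> the adjoints of a family this
  yields intertwiners; with \<open>X\<close> and \<open>Y\<close> from a class and its conjugate it
  yields invariant vectors of a product.\<close>

lemma contragredient_sum_fixed:
  assumes X: "transforms n X U"
    and Y: "\<And>g j. j < n \<Longrightarrow> \<alpha> g (Y j) = (\<Sum>i<n. cnj (U g $$ (i, j)) *\<^sub>C Y i)"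
    and A: "A \<in> \<A>"
  shows "(\<Sum>j<n. X j * A * Y j) \<in> \<A>"
proof (rule fixedI)
  fix g
  have "\<alpha> g (\<Sum>j<n. X j * A * Y j) =
      (\<Sum>j<n. (\<Sum>i<n. U g $$ (i, j) *\<^sub>C X i) * A * (\<Sum>k<n. cnj (U g $$ (k, j)) *\<^sub>C Y k))"
    by (simp add: action_sum action_mult fixedD[OF A] transformsD[OF X] Y)
  also have "\<dots> = (\<Sum>j<n. X j * A * Y j)"
    using X by (intro sum_unitary_mix) (simp add: transforms_def unitary_rep_def)
  finally show "\<alpha> g (\<Sum>j<n. X j * A * Y j) = (\<Sum>j<n. X j * A * Y j)" .
qed

lemma transforms_adj:
  assumes "transforms n \<Phi> U" "j < n"
  shows "\<alpha> g (adj (\<Phi> j)) = (\<Sum>i<n. cnj (U g $$ (i, j)) *\<^sub>C adj (\<Phi> i))"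
  by (simp add: action_adj transformsD[OF assms] adj_sum adj_scaleC)

lemma intertwining_sum_fixed:
  "transforms n \<Phi> U \<Longrightarrow> transforms n \<Psi> U \<Longrightarrow> A \<in> \<A> \<Longrightarrow> (\<Sum>j<n. \<Phi> j * A * adj (\<Psi> j)) \<in> \<A>"
  by (rule contragredient_sum_fixed) (auto simp: transforms_adj)

lemma endo_fixed: "transforms n \<Phi> U \<Longrightarrow> A \<in> \<A> \<Longrightarrow> endo n \<Phi> A \<in> \<A>"
  unfolding endo_def by (rule intertwining_sum_fixed)

text \<open>An invariant algebraic Hilbert space is replaced by a basis together with the exact
  matrices \<open>U\<close> of the action. Two multiplets with the same \<open>U\<close> can then be
  paired index by index.\<close>

definition multiplet :: "nat \<Rightarrow> (nat \<Rightarrow> 'f) \<Rightarrow> 'g rep \<Rightarrow> bool" where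
  "multiplet n \<Phi> U \<longleftrightarrow> orthonormal n \<Phi> \<and> endo n \<Phi> 1 = 1 \<and> transforms n \<Phi> U"

text \<open>The adjoint of the unitary that implements the equivalence serves as the change of
  basis. Such a change leaves the endomorphism untouched, so the matrices may be prescribed freely
  within the equivalence class.\<close>

lemma multiplet_rep_equiv:
  assumes \<Phi>: "multiplet n \<Phi> U" and eq: "rep_equiv U U'"
  obtains \<Psi> where "multiplet n \<Psi> U'" "\<And>A. endo n \<Psi> A = endo n \<Phi> A"
proof -
  obtain m V where *: "\<And>g. U g \<in> carrier_mat m m" "\<And>g. U' g \<in> carrier_mat m m"
    "unitary_mat m V" "\<And>g. V * U g = U' g * V"
    using rep_equivE[OF eq] by metis
  have on: "orthonormal n \<Phi>" and e1: "endo n \<Phi> 1 = 1" and t: "transforms n \<Phi> U"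
    using \<Phi> by (auto simp: multiplet_def)
  have Uc: "U g \<in> carrier_mat n n" for g using t unitary_repD(1) by (auto simp: transforms_def)
  then have "m = n" using *(1) by (metis carrier_matD(1))
  note * = *[unfolded this]
  define M where "M = mat_adjoint V"
  have M: "unitary_mat n M" using *(3) unitary_mat_adjoint by (simp add: M_def)
  then have Mc: "M \<in> carrier_mat n n" by (simp add: unitary_mat_def)
  have UM: "U g * M = M * U' g" for g
  proof -
    have V: "V \<in> carrier_mat n n" "M * V = 1\<^sub>m n" "V * M = 1\<^sub>m n"
      using *(3) by (auto simp: M_def unitary_mat_def)
    have "U g * M = M * V * (U g * M)" using V(2) left_mult_one_mat[OF mult_carrier_mat[OF Uc Mc]] by simp
    also have "\<dots> = M * (V * (U g * M))"
      by (rule assoc_mult_mat) (use Mc V Uc[of g] in auto)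
    also have "V * (U g * M) = V * U g * M"
      by (rule assoc_mult_mat[symmetric]) (use Mc V Uc[of g] in auto)
    also have "\<dots> = U' g * (V * M)"
      unfolding *(4) by (rule assoc_mult_mat) (use Mc V *(2)[of g] in auto)
    also have "\<dots> = U' g" using V(3) right_mult_one_mat[OF *(2)] by simp
    finally show ?thesis .
  qed
  define \<Psi> where "\<Psi> = (\<lambda>j. \<Sum>i<n. M $$ (i, j) *\<^sub>C \<Phi> i)"
  have on': "orthonormal n \<Psi>" unfolding \<Psi>_def by (rule orthonormal_mix[OF M on])
  have adj: "adj (\<Psi> j) = (\<Sum>k<n. cnj (M $$ (k, j)) *\<^sub>C adj (\<Phi> k))" for j
    by (simp add: \<Psi>_def adj_sum adj_scaleC)
  have endo: "endo n \<Psi> A = endo n \<Phi> A" for A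
    unfolding endo_def adj unfolding \<Psi>_def by (rule sum_unitary_mix[OF M])
  have "transforms n \<Psi> U'"
  proof (rule transformsI[OF on' *(2)])
    fix g j assume j: "j < n"
    have "\<alpha> g (\<Psi> j) = (\<Sum>i<n. \<Sum>k<n. (U g $$ (k, i) * M $$ (i, j)) *\<^sub>C \<Phi> k)"
      unfolding \<Psi>_def
      by (simp add: action_sum action_scaleC transformsD[OF t] complex_vs.scale_sum_right scaleC_scaleC mult.commute)
    also have "\<dots> = (\<Sum>k<n. (U g * M) $$ (k, j) *\<^sub>C \<Phi> k)"
      using j by (subst sum.swap)
        (simp add: mult_mat_index[OF Uc Mc] complex_vs.scale_sum_left del: index_mult_mat(1))
    also have "\<dots> = (\<Sum>k<n. \<Sum>l<n. (M $$ (k, l) * U' g $$ (l, j)) *\<^sub>C \<Phi> k)"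
      unfolding UM using j
      by (simp add: mult_mat_index[OF Mc *(2)] complex_vs.scale_sum_left del: index_mult_mat(1))
    also have "\<dots> = (\<Sum>l<n. U' g $$ (l, j) *\<^sub>C \<Psi> l)"
      unfolding \<Psi>_def
      by (subst sum.swap) (simp add: complex_vs.scale_sum_right scaleC_scaleC mult.commute)
    finally show "\<alpha> g (\<Psi> j) = (\<Sum>l<n. U' g $$ (l, j) *\<^sub>C \<Psi> l)" .
  qed
  then show thesis using that[of \<Psi>] on' endo e1 by (simp add: multiplet_def)
qed

lemma hilbert_space_multiplet:
  assumes H: "algebraic_hilbert_space H" and inv: "invariant_subset \<alpha> H"
    and \<Phi>: "orthonormal_basis H \<Phi>"
  shows "multiplet (length \<Phi>) ((!) \<Phi>) (carried_rep \<alpha> \<Phi>)"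
    "canonical_endo H A = endo (length \<Phi>) ((!) \<Phi>) A"
proof -
  note B = algebraic_hilbert_space_basis[OF H \<Phi>]
  have "transforms (length \<Phi>) ((!) \<Phi>) (carried_rep \<alpha> \<Phi>)"
  proof (rule transformsI[OF B(1)])
    show "carried_rep \<alpha> \<Phi> g \<in> carrier_mat (length \<Phi>) (length \<Phi>)" for g by (simp add: carried_rep_def)
    fix g j assume j: "j < length \<Phi>"
    have mem: "\<Phi> ! i \<in> H" if "i < length \<Phi>" for i
      using that \<Phi> complex_vs.span_base unfolding orthonormal_basis_def by (metis nth_mem)
    have "\<alpha> g (\<Phi> ! j) \<in> H" using mem[OF j] inv by (auto simp: invariant_subset_def)
    then have ip: "adj (\<Phi> ! i) * \<alpha> g (\<Phi> ! j) = alg_inner (\<Phi> ! i) (\<alpha> g (\<Phi> ! j)) *\<^sub>C 1"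
      if "i < length \<Phi>" for i
      using mem[OF that] H alg_inner_eq unfolding algebraic_hilbert_space_def by metis
    \<comment> \<open>Inserting the support, which is the unit, expands the translate in the basis;
      the coefficients are scalars because the translate stays in \<open>H\<close>.\<close>
    have "\<alpha> g (\<Phi> ! j) = endo (length \<Phi>) ((!) \<Phi>) 1 * \<alpha> g (\<Phi> ! j)" by (simp add: B)
    also have "\<dots> = (\<Sum>i<length \<Phi>. \<Phi> ! i * (adj (\<Phi> ! i) * \<alpha> g (\<Phi> ! j)))"
      by (simp add: endo_def sum_distrib_right mult.assoc)
    also have "\<dots> = (\<Sum>i<length \<Phi>. carried_rep \<alpha> \<Phi> g $$ (i, j) *\<^sub>C \<Phi> ! i)"
      using j by (intro sum.cong refl) (simp add: ip mult_scaleC_right carried_rep_def)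
    finally show "\<alpha> g (\<Phi> ! j) = (\<Sum>i<length \<Phi>. carried_rep \<alpha> \<Phi> g $$ (i, j) *\<^sub>C \<Phi> ! i)" .
  qed
  then show "multiplet (length \<Phi>) ((!) \<Phi>) (carried_rep \<alpha> \<Phi>)" using B by (simp add: multiplet_def)
  show "canonical_endo H A = endo (length \<Phi>) ((!) \<Phi>) A" by (rule B(3))
qed

end

section \<open>Intertwiners and Schur's lemma\<close>

text \<open>For irreducible \<open>\<pi>\<close> this is the element of the quotient
  \<open>group_dual\<close> that contains \<open>\<pi>\<close>.\<close>

definition rep_class :: "'g::topological_group_add rep \<Rightarrow> 'g rep set" where
  "rep_class \<pi> = {\<pi>' \<in> irreps. rep_equiv \<pi> \<pi>'}"

lemma irreps_refl:
  assumes "\<pi> \<in> irreps"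
  shows "rep_equiv \<pi> \<pi>"
proof -
  obtain n where "unitary_rep n \<pi>" using assms by (auto simp: irreps_def irreducible_rep_def)
  then show ?thesis by (intro rep_equiv_refl[of _ n] unitary_repD(1))
qed

lemma rep_class_dual:
  assumes "\<pi> \<in> irreps"
  shows "rep_class \<pi> \<in> group_dual"
proof -
  have "rep_class \<pi> = {(\<pi>, \<pi>'). \<pi> \<in> irreps \<and> \<pi>' \<in> irreps \<and> rep_equiv \<pi> \<pi>'} `` {\<pi>}"
    using assms by (auto simp: rep_class_def)
  then show ?thesis unfolding group_dual_def using assms by (simp only: quotientI)
qed

lemma rep_class_self: "\<pi> \<in> irreps \<Longrightarrow> \<pi> \<in> rep_class \<pi>"
  by (simp add: rep_class_def irreps_refl)

lemma group_dualE:
  assumes "D \<in> group_dual"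
  obtains \<pi> where "\<pi> \<in> irreps" "\<pi> \<in> D" "D = rep_class \<pi>"
proof -
  obtain \<pi> where "\<pi> \<in> irreps" "D = rep_class \<pi>"
    using assms unfolding group_dual_def quotient_def rep_class_def by auto
  then show thesis using that rep_class_self by blast
qed

lemma rep_class_eq: "rep_equiv \<pi> \<pi>' \<Longrightarrow> rep_class \<pi> = rep_class \<pi>'"
  unfolding rep_class_def using rep_equiv_sym rep_equiv_trans by blast

lemma group_dual_memD:
  assumes "D \<in> group_dual" "\<pi> \<in> D"
  shows "\<pi> \<in> irreps" "D = rep_class \<pi>"
proof -
  obtain \<pi>' where \<pi>': "\<pi>' \<in> irreps" "D = rep_class \<pi>'" using group_dualE[OF assms(1)] by metis
  then show "\<pi> \<in> irreps" using assms(2) by (simp add: rep_class_def)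
  have "rep_equiv \<pi>' \<pi>" using assms(2) \<pi>' by (simp add: rep_class_def)
  then show "D = rep_class \<pi>" using \<pi>'(2) rep_class_eq by simp
qed

lemma sum_split_add:
  fixes f :: "nat \<Rightarrow> 'a::comm_monoid_add"
  shows "(\<Sum>i<d + m. f i) = (\<Sum>i<d. f i) + (\<Sum>i<m. f (d + i))"
  by (induction m) (simp_all add: add.assoc)

text \<open>The functional is the coordinate of \<open>x\<close> in an algebraic basis containing
  \<open>x\<close>. Continuity is not claimed; the functional is meant for finite sums.\<close>

lemma complex_functional:
  fixes x :: "'a::cstar_algebra"
  assumes "x \<noteq> 0"
  obtains f :: "'a \<Rightarrow> complex" where "\<And>u v. f (u + v) = f u + f v" "\<And>c v. f (c *\<^sub>C v) = c * f v" "f x \<noteq> 0"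
proof -
  have ind: "complex_vs.independent {x}" using assms by simp
  define B where "B = complex_vs.extend_basis {x}"
  have B: "complex_vs.independent B" "complex_vs.span B = UNIV" "x \<in> B"
    using complex_vs.independent_extend_basis[OF ind] complex_vs.span_extend_basis[OF ind]
      complex_vs.extend_basis_superset[OF ind] by (auto simp: B_def)
  show thesis
  proof (rule that[of "\<lambda>v. complex_vs.representation B v x"])
    show "complex_vs.representation B (u + v) x = complex_vs.representation B u x + complex_vs.representation B v x" for u v
      using complex_vs.representation_add[OF B(1)] B(2) by simp
    show "complex_vs.representation B (c *\<^sub>C v) x = c * complex_vs.representation B v x" for c v
      using complex_vs.representation_scale[OF B(1)] B(2) by simp
    show "complex_vs.representation B x x \<noteq> 0"
      using complex_vs.representation_basis[OF B(1,3)] by simp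
  qed
qed

lemma sum_outer_orthonormal:
  fixes W :: "nat \<Rightarrow> 'a::cstar_algebra"
  assumes "\<And>j k. j < K \<Longrightarrow> k < K \<Longrightarrow> adj (W j) * W k = (if j = k then 1 else 0)"
    and "k < K"
  shows "(\<Sum>j<K. W j * B j * adj (W j)) * W k = W k * B k"
  using orthonormal_cancel_right[of K W k "\<lambda>j. W j * B j"] assms by (simp add: orthonormal_def)

locale minimal_hilbert_system = star_action \<alpha>
  for \<alpha> :: "'g::{topological_group_add, t2_space} \<Rightarrow> 'f::cstar_algebra \<Rightarrow> 'f" +
  fixes HD :: "'g rep set \<Rightarrow> 'f set"
  assumes dual_spaces: "\<And>D. D \<in> group_dual \<Longrightarrow> algebraic_hilbert_space (HD D) \<and>
      invariant_subset \<alpha> (HD D) \<and> (\<exists>\<Phi>. orthonormal_basis (HD D) \<Phi> \<and> carried_rep \<alpha> \<Phi> \<in> D)"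
    and minimal: "minimal_system \<alpha>"
begin

abbreviation \<rho> :: "'g rep set \<Rightarrow> 'f \<Rightarrow> 'f" where "\<rho> D \<equiv> canonical_endo (HD D)"

text \<open>\<open>HD D\<close> carries some matrix representation in the class; a unitary change of
  basis makes it equal to the prescribed \<open>\<pi>\<close> and does not change the
  endomorphism.\<close>

lemma class_multiplet:
  assumes D: "D \<in> group_dual" and \<pi>: "\<pi> \<in> D" and irr: "irreducible_rep n \<pi>"
  obtains \<Phi> where "multiplet n \<Phi> \<pi>" "\<And>A. \<rho> D A = endo n \<Phi> A"
proof -
  obtain \<Phi>0 where \<Phi>0: "orthonormal_basis (HD D) \<Phi>0" "carried_rep \<alpha> \<Phi>0 \<in> D"
    and H: "algebraic_hilbert_space (HD D)" "invariant_subset \<alpha> (HD D)"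
    using dual_spaces[OF D] by blast
  note M = hilbert_space_multiplet[OF H \<Phi>0(1)]
  have "D = rep_class (carried_rep \<alpha> \<Phi>0)" using group_dual_memD[OF D \<Phi>0(2)] by simp
  then have "rep_equiv (carried_rep \<alpha> \<Phi>0) \<pi>" using \<pi> by (simp add: rep_class_def)
  then obtain \<Psi> where \<Psi>: "multiplet (length \<Phi>0) \<Psi> \<pi>"
    "\<And>A. endo (length \<Phi>0) \<Psi> A = endo (length \<Phi>0) ((!) \<Phi>0) A"
    using multiplet_rep_equiv[OF M(1)] by metis
  have "unitary_rep (length \<Phi>0) \<pi>" "unitary_rep n \<pi>"
    using \<Psi>(1) irr by (simp_all add: multiplet_def transforms_def irreducible_rep_def)
  then have "length \<Phi>0 = n" using unitary_repD(1) by (metis carrier_matD(1))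
  with \<Psi> M(2) that show thesis by metis
qed

lemma dual_multiplet:
  assumes "D \<in> group_dual"
  obtains n \<pi> \<Phi> where "\<pi> \<in> D" "irreducible_rep n \<pi>" "multiplet n \<Phi> \<pi>" "\<And>A. \<rho> D A = endo n \<Phi> A"
proof -
  obtain \<pi> where \<pi>: "\<pi> \<in> irreps" "\<pi> \<in> D" using group_dualE[OF assms] by metis
  then obtain n where "irreducible_rep n \<pi>" by (auto simp: irreps_def)
  with class_multiplet[OF assms \<pi>(2) this] \<pi> that show thesis by metis
qed

lemma rho_one: "D \<in> group_dual \<Longrightarrow> \<rho> D 1 = 1"
  by (rule dual_multiplet) (auto simp: multiplet_def)

lemma rho_mult: "D \<in> group_dual \<Longrightarrow> \<rho> D (A * B) = \<rho> D A * \<rho> D B"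
  by (rule dual_multiplet) (auto simp: multiplet_def endo_mult)

lemma rho_sum: "D \<in> group_dual \<Longrightarrow> \<rho> D (\<Sum>i\<in>I. f i) = (\<Sum>i\<in>I. \<rho> D (f i))"
  by (rule dual_multiplet) (auto simp: endo_sum)

lemma rho_adj: "D \<in> group_dual \<Longrightarrow> \<rho> D (adj A) = adj (\<rho> D A)"
  by (rule dual_multiplet) (auto simp: endo_adj)

lemma rho_fixed: "D \<in> group_dual \<Longrightarrow> A \<in> \<A> \<Longrightarrow> \<rho> D A \<in> \<A>"
  by (rule dual_multiplet) (auto simp: multiplet_def endo_fixed)

lemma irreducible_dim: "irreducible_rep n \<pi> \<Longrightarrow> 0 < n"
  by (simp add: irreducible_rep_def)

text \<open>\<open>A\<close> is recovered from \<open>\<rho> D A\<close> by compression with a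
  single basis vector, which exists because irreducible representations have positive
  dimension.\<close>

lemma rho_eq_zero: "D \<in> group_dual \<Longrightarrow> \<rho> D A = 0 \<Longrightarrow> A = 0"
proof -
  assume D: "D \<in> group_dual" and 0: "\<rho> D A = 0"
  obtain n \<pi> \<Phi> where *: "irreducible_rep n \<pi>" "multiplet n \<Phi> \<pi>" "\<And>A. \<rho> D A = endo n \<Phi> A"
    using dual_multiplet[OF D] by metis
  then have on: "orthonormal n \<Phi>" and n: "0 < n" by (auto simp: multiplet_def irreducible_dim)
  have "A * adj (\<Phi> 0) = 0" using adj_basis_mult_endo[OF on n, of A] *(3) 0 by simp
  then have "A * (adj (\<Phi> 0) * \<Phi> 0) = 0" by (simp add: mult.assoc[symmetric])
  then show "A = 0" using orthonormalD[OF on n n] by simp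
qed

text \<open>The basis vectors exchange \<open>A\<close> with its images under the two endomorphisms,
  and \<open>Y\<close> intertwines these, so the entry commutes with the fixed point algebra.
  Minimality then places it in the centre; that the entry is itself fixed is part of this
  conclusion.\<close>

lemma intertwiner_entries:
  assumes \<Phi>: "multiplet n \<Phi> \<pi>" and \<Psi>: "multiplet m \<Psi> \<sigma>"
    and Y: "Y \<in> intertwiners \<alpha> (endo n \<Phi>) (endo m \<Psi>)"
    and i: "i < n" and j: "j < m"
  shows "adj (\<Psi> j) * Y * \<Phi> i \<in> \<Z>"
proof -
  have on: "orthonormal n \<Phi>" "orthonormal m \<Psi>" using \<Phi> \<Psi> by (auto simp: multiplet_def)
  have "adj (\<Psi> j) * Y * \<Phi> i * A = A * (adj (\<Psi> j) * Y * \<Phi> i)" if A: "A \<in> \<A>" for A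
  proof -
    have "adj (\<Psi> j) * Y * \<Phi> i * A = adj (\<Psi> j) * (Y * endo n \<Phi> A) * \<Phi> i"
      by (simp add: mult.assoc endo_mult_basis[OF on(1) i])
    also have "\<dots> = adj (\<Psi> j) * endo m \<Psi> A * Y * \<Phi> i"
      using Y A by (simp add: intertwiners_def mult.assoc)
    also have "\<dots> = A * (adj (\<Psi> j) * Y * \<Phi> i)"
      by (simp add: mult.assoc adj_basis_mult_endo[OF on(2) j])
    finally show ?thesis .
  qed
  then have "adj (\<Psi> j) * Y * \<Phi> i \<in> commutant \<A>" by (simp add: commutant_def)
  then show ?thesis using minimal by (simp add: minimal_system_def)
qed

text \<open>\<open>\<alpha> g (Y * \<Phi> i)\<close> is computed twice: once with \<open>Y\<close>
  fixed and \<open>\<Phi> i\<close> transformed, and once from the expansion of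
  \<open>Y * \<Phi> i\<close> along \<open>\<Psi>\<close>, whose coefficients are central and hence
  fixed.\<close>

lemma intertwiner_entries_relation:
  assumes \<Phi>: "multiplet n \<Phi> \<pi>" and \<Psi>: "multiplet m \<Psi> \<sigma>"
    and Y: "Y \<in> intertwiners \<alpha> (endo n \<Phi>) (endo m \<Psi>)"
    and i: "i < n" and a: "a < m"
  shows "(\<Sum>j<m. \<sigma> g $$ (a, j) *\<^sub>C (adj (\<Psi> j) * Y * \<Phi> i)) =
    (\<Sum>l<n. \<pi> g $$ (l, i) *\<^sub>C (adj (\<Psi> a) * Y * \<Phi> l))"
proof -
  have on: "orthonormal m \<Psi>" and t: "transforms n \<Phi> \<pi>" "transforms m \<Psi> \<sigma>" and e: "endo m \<Psi> 1 = 1"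
    using \<Phi> \<Psi> by (auto simp: multiplet_def)
  have YA: "Y \<in> \<A>" using Y by (simp add: intertwiners_def)
  note M = center_fixed[OF intertwiner_entries[OF \<Phi> \<Psi> Y i]]
  have "Y * \<Phi> i = endo m \<Psi> 1 * (Y * \<Phi> i)" by (simp add: e)
  also have "\<dots> = (\<Sum>j<m. \<Psi> j * (adj (\<Psi> j) * Y * \<Phi> i))"
    by (simp add: endo_def sum_distrib_right mult.assoc)
  finally have "\<alpha> g (Y * \<Phi> i) = (\<Sum>j<m. \<alpha> g (\<Psi> j) * (adj (\<Psi> j) * Y * \<Phi> i))"
    using fixedD[OF M] by (simp add: action_sum action_mult)
  also have "\<dots> = (\<Sum>j<m. \<Sum>k<m. \<Psi> k * \<sigma> g $$ (k, j) *\<^sub>C (adj (\<Psi> j) * Y * \<Phi> i))"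
    by (simp add: transformsD[OF t(2)] sum_distrib_right mult_scaleC_left mult_scaleC_right)
  also have "\<dots> = (\<Sum>k<m. \<Psi> k * (\<Sum>j<m. \<sigma> g $$ (k, j) *\<^sub>C (adj (\<Psi> j) * Y * \<Phi> i)))"
    by (subst sum.swap) (simp add: sum_distrib_left)
  finally have "adj (\<Psi> a) * \<alpha> g (Y * \<Phi> i) = (\<Sum>j<m. \<sigma> g $$ (a, j) *\<^sub>C (adj (\<Psi> j) * Y * \<Phi> i))"
    using orthonormal_cancel[OF on a] by simp
  moreover have "\<alpha> g (Y * \<Phi> i) = (\<Sum>l<n. \<pi> g $$ (l, i) *\<^sub>C (Y * \<Phi> l))"
    by (simp add: action_mult fixedD[OF YA] transformsD[OF t(1) i] sum_distrib_left mult_scaleC_right)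
  ultimately show ?thesis by (simp add: sum_distrib_left mult_scaleC_right mult.assoc)
qed

lemma intertwiner_functional:
  assumes \<Phi>: "multiplet n \<Phi> \<pi>" and \<Psi>: "multiplet m \<Psi> \<sigma>"
    and Y: "Y \<in> intertwiners \<alpha> (endo n \<Phi>) (endo m \<Psi>)"
    and f: "\<And>u v. f (u + v) = f u + f v" "\<And>c v. f (c *\<^sub>C v) = c * f v"
  defines "T \<equiv> mat m n (\<lambda>(j, i). f (adj (\<Psi> j) * Y * \<Phi> i))"
  shows "T * \<pi> g = \<sigma> g * T"
proof (rule eq_matI)
  have c: "\<pi> g \<in> carrier_mat n n" "\<sigma> g \<in> carrier_mat m m" "T \<in> carrier_mat m n"
    using \<Phi> \<Psi> unitary_repD(1) by (auto simp: multiplet_def transforms_def T_def)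
  have f0: "f 0 = 0" using f(2)[of 0 0] by simp
  have f_sum: "f (\<Sum>i\<in>I. h i) = (\<Sum>i\<in>I. f (h i))" for I :: "nat set" and h
    by (induction I rule: infinite_finite_induct) (simp_all add: f f0)
  show "dim_row (T * \<pi> g) = dim_row (\<sigma> g * T)" "dim_col (T * \<pi> g) = dim_col (\<sigma> g * T)"
    using c by auto
  fix a i assume "a < dim_row (\<sigma> g * T)" "i < dim_col (\<sigma> g * T)"
  then have ai: "a < m" "i < n" using c by auto
  have "f (\<Sum>j<m. \<sigma> g $$ (a, j) *\<^sub>C (adj (\<Psi> j) * Y * \<Phi> i)) =
      f (\<Sum>l<n. \<pi> g $$ (l, i) *\<^sub>C (adj (\<Psi> a) * Y * \<Phi> l))"
    using intertwiner_entries_relation[OF \<Phi> \<Psi> Y ai(2,1)] by simp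
  then have "(\<Sum>j<m. \<sigma> g $$ (a, j) * T $$ (j, i)) = (\<Sum>l<n. T $$ (a, l) * \<pi> g $$ (l, i))"
    using ai by (simp add: f_sum f T_def mult.commute)
  then show "(T * \<pi> g) $$ (a, i) = (\<sigma> g * T) $$ (a, i)"
    using ai by (simp add: mult_mat_index[OF c(3,1)] mult_mat_index[OF c(2,3)] del: index_mult_mat(1))
qed

lemma intertwiner_expand:
  assumes \<Phi>: "multiplet n \<Phi> \<pi>" and \<Psi>: "multiplet m \<Psi> \<sigma>"
  shows "Y = (\<Sum>j<m. \<Sum>i<n. \<Psi> j * (adj (\<Psi> j) * Y * \<Phi> i) * adj (\<Phi> i))"
proof -
  have "Y = endo m \<Psi> 1 * Y * endo n \<Phi> 1" using \<Phi> \<Psi> by (simp add: multiplet_def)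
  also have "\<dots> = (\<Sum>j<m. \<Sum>i<n. \<Psi> j * (adj (\<Psi> j) * Y * \<Phi> i) * adj (\<Phi> i))"
    by (subst sum.swap) (simp add: endo_def sum_distrib_right sum_distrib_left mult.assoc)
  finally show ?thesis .
qed

lemma intertwiner_distinct:
  assumes D: "D \<in> group_dual" and E: "E \<in> group_dual" and DE: "D \<noteq> E"
    and Y: "Y \<in> intertwiners \<alpha> (\<rho> D) (\<rho> E)"
  shows "Y = 0"
proof -
  obtain n \<pi> \<Phi> where \<Phi>: "\<pi> \<in> D" "irreducible_rep n \<pi>" "multiplet n \<Phi> \<pi>" "\<And>A. \<rho> D A = endo n \<Phi> A"
    using dual_multiplet[OF D] by metis
  obtain m \<sigma> \<Psi> where \<Psi>: "\<sigma> \<in> E" "irreducible_rep m \<sigma>" "multiplet m \<Psi> \<sigma>" "\<And>A. \<rho> E A = endo m \<Psi> A"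
    using dual_multiplet[OF E] by metis
  have Y': "Y \<in> intertwiners \<alpha> (endo n \<Phi>) (endo m \<Psi>)"
    using Y \<Phi>(4) \<Psi>(4) by (simp add: intertwiners_def)
  have neq: "\<not> rep_equiv \<pi> \<sigma>"
    using DE group_dual_memD(2)[OF D \<Phi>(1)] group_dual_memD(2)[OF E \<Psi>(1)] rep_class_eq by metis
  have "adj (\<Psi> j) * Y * \<Phi> i = 0" if ij: "i < n" "j < m" for i j
  proof (rule ccontr)
    assume "adj (\<Psi> j) * Y * \<Phi> i \<noteq> 0"
    \<comment> \<open>A functional that does not vanish on the entry produces a nonzero complex
      intertwiner, in contradiction to inequivalence.\<close>
    then obtain f :: "'f \<Rightarrow> complex" where f: "\<And>u v. f (u + v) = f u + f v" "\<And>c v. f (c *\<^sub>C v) = c * f v"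
      "f (adj (\<Psi> j) * Y * \<Phi> i) \<noteq> 0"
      using complex_functional by metis
    let ?T = "mat m n (\<lambda>(j, i). f (adj (\<Psi> j) * Y * \<Phi> i))"
    have "?T $$ (j, i) \<noteq> 0" using ij f(3) by simp
    then have "?T \<noteq> 0\<^sub>m m n" using ij by (metis index_zero_mat(1))
    then have "rep_equiv \<pi> \<sigma>"
      using intertwiner_functional[OF \<Phi>(3) \<Psi>(3) Y' f(1,2)]
      by (intro schur_intertwiner[OF \<Phi>(2) \<Psi>(2), of ?T]) auto
    with neq show False by simp
  qed
  then show "Y = 0" by (subst intertwiner_expand[OF \<Phi>(3) \<Psi>(3)]) simp
qed

text \<open>Every functional makes the matrix of \<open>Y\<close> a complex multiple of the
  identity. Hence the off-diagonal entries and the differences of diagonal entries vanish, and the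
  common diagonal entry is the central element sought.\<close>

lemma intertwiner_same:
  assumes D: "D \<in> group_dual" and Y: "Y \<in> intertwiners \<alpha> (\<rho> D) (\<rho> D)"
  obtains z where "z \<in> \<Z>" "Y = \<rho> D z"
proof -
  obtain n \<pi> \<Phi> where \<Phi>: "irreducible_rep n \<pi>" "multiplet n \<Phi> \<pi>" "\<And>A. \<rho> D A = endo n \<Phi> A"
    using dual_multiplet[OF D] by metis
  have n: "0 < n" using \<Phi>(1) by (rule irreducible_dim)
  have Y': "Y \<in> intertwiners \<alpha> (endo n \<Phi>) (endo n \<Phi>)"
    using Y \<Phi>(3) by (simp add: intertwiners_def)
  define z where "z = adj (\<Phi> 0) * Y * \<Phi> 0"
  have entry: "adj (\<Phi> j) * Y * \<Phi> i = (if i = j then z else 0)" if ij: "i < n" "j < n" for i j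
  proof (rule ccontr)
    assume "adj (\<Phi> j) * Y * \<Phi> i \<noteq> (if i = j then z else 0)"
    \<comment> \<open>The deviation from the expected matrix is put into one element, so that a
      single functional treats the diagonal and the off-diagonal case together.\<close>
    moreover define d where "d = adj (\<Phi> j) * Y * \<Phi> i - (if i = j then z else 0)"
    ultimately have "d \<noteq> 0" by (simp add: d_def)
    then obtain f :: "'f \<Rightarrow> complex" where f: "\<And>u v. f (u + v) = f u + f v" "\<And>c v. f (c *\<^sub>C v) = c * f v"
      "f d \<noteq> 0"
      using complex_functional by metis
    let ?T = "mat n n (\<lambda>(j, i). f (adj (\<Phi> j) * Y * \<Phi> i))"
    obtain c where c: "?T = c \<cdot>\<^sub>m 1\<^sub>m n"
      using intertwiner_functional[OF \<Phi>(2) \<Phi>(2) Y' f(1,2)]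
      by (elim schur_commuting[OF \<Phi>(1), of ?T, rotated 2]) auto
    have f0: "f 0 = 0" using f(2)[of 0 0] by simp
    have Tc: "f (adj (\<Phi> b) * Y * \<Phi> a) = (if a = b then c else 0)" if "a < n" "b < n" for a b
    proof -
      have "?T $$ (b, a) = (c \<cdot>\<^sub>m 1\<^sub>m n) $$ (b, a)" by (simp add: c)
      then show ?thesis using that by (auto split: if_splits)
    qed
    have "f (u - v) = f u - f v" for u v using f(1)[of "u - v" v] by simp
    then have "f d = 0" using Tc[OF ij] Tc[OF n n] by (simp add: d_def f0 z_def)
    with f(3) show False by simp
  qed
  have "Y = (\<Sum>j<n. \<Sum>i<n. \<Phi> j * (adj (\<Phi> j) * Y * \<Phi> i) * adj (\<Phi> i))"
    by (rule intertwiner_expand[OF \<Phi>(2,2)])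
  also have "\<dots> = (\<Sum>j<n. \<Sum>i<n. if i = j then \<Phi> j * z * adj (\<Phi> i) else 0)"
    by (intro sum.cong refl) (simp add: entry)
  also have "\<dots> = \<rho> D z" by (simp add: \<Phi>(3) endo_def)
  finally have "Y = \<rho> D z" .
  moreover have "z \<in> \<Z>" unfolding z_def by (rule intertwiner_entries[OF \<Phi>(2,2) Y' n n])
  ultimately show thesis using that by blast
qed

section \<open>Conjugate classes and the action on the centre\<close>

lemma conjugate_multiplets:
  assumes "D \<in> group_dual"
  obtains D' n \<pi> \<Phi> \<Xi> where "D' \<in> group_dual" "0 < n"
    "multiplet n \<Phi> \<pi>" "multiplet n \<Xi> (\<lambda>g. map_mat cnj (\<pi> g))"
    "\<And>A. \<rho> D A = endo n \<Phi> A" "\<And>A. \<rho> D' A = endo n \<Xi> A"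
proof -
  obtain n \<pi> \<Phi> where \<Phi>: "\<pi> \<in> D" "irreducible_rep n \<pi>" "multiplet n \<Phi> \<pi>" "\<And>A. \<rho> D A = endo n \<Phi> A"
    using dual_multiplet[OF assms] by metis
  let ?c = "\<lambda>g. map_mat cnj (\<pi> g)"
  have irr: "irreducible_rep n ?c" using irreducible_rep_conjugate[OF \<Phi>(2)] .
  then have "?c \<in> irreps" by (auto simp: irreps_def)
  then have D': "rep_class ?c \<in> group_dual" "?c \<in> rep_class ?c"
    by (rule rep_class_dual, rule rep_class_self)
  obtain \<Xi> where "multiplet n \<Xi> ?c" "\<And>A. \<rho> (rep_class ?c) A = endo n \<Xi> A"
    using class_multiplet[OF D' irr] by metis
  with that[OF D'(1) irreducible_dim[OF \<Phi>(2)] \<Phi>(3)] \<Phi>(4) show thesis by blast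
qed

text \<open>The sums are invariant vectors in the products of \<open>\<pi>\<close> with its
  conjugate, in either order. Multiplying by the adjoint of the first vector of the left-hand family
  isolates a nonzero vector, so neither sum is zero.\<close>

lemma conjugate_sum:
  assumes \<Phi>: "multiplet n \<Phi> \<pi>" and \<Xi>: "multiplet n \<Xi> (\<lambda>g. map_mat cnj (\<pi> g))" and n: "0 < n"
  shows "(\<Sum>j<n. \<Xi> j * \<Phi> j) \<in> \<A>" "(\<Sum>j<n. \<Phi> j * \<Xi> j) \<in> \<A>"
    "(\<Sum>j<n. \<Xi> j * \<Phi> j) \<noteq> 0" "(\<Sum>j<n. \<Phi> j * \<Xi> j) \<noteq> 0"
proof -
  have t: "transforms n \<Phi> \<pi>" "transforms n \<Xi> (\<lambda>g. map_mat cnj (\<pi> g))"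
    and on: "orthonormal n \<Phi>" "orthonormal n \<Xi>"
    using \<Phi> \<Xi> by (auto simp: multiplet_def)
  have c: "\<pi> g \<in> carrier_mat n n" for g using t(1) unitary_repD(1) by (auto simp: transforms_def)
  have entry: "map_mat cnj (\<pi> g) $$ (i, j) = cnj (\<pi> g $$ (i, j))" if "i < n" "j < n" for g i j
    using c[of g] that by auto
  have "(\<Sum>j<n. \<Xi> j * 1 * \<Phi> j) \<in> \<A>"
    by (rule contragredient_sum_fixed[OF t(2) _ fixed_one]) (simp add: transformsD[OF t(1)] entry)
  then show "(\<Sum>j<n. \<Xi> j * \<Phi> j) \<in> \<A>" by simp
  have "(\<Sum>j<n. \<Phi> j * 1 * \<Xi> j) \<in> \<A>"
    by (rule contragredient_sum_fixed[OF t(1) _ fixed_one]) (simp add: transformsD[OF t(2)] entry)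
  then show "(\<Sum>j<n. \<Phi> j * \<Xi> j) \<in> \<A>" by simp
  have nz: "\<Phi> 0 \<noteq> 0" "\<Xi> 0 \<noteq> 0" using orthonormalD[OF on(1) n n] orthonormalD[OF on(2) n n] by auto
  show "(\<Sum>j<n. \<Xi> j * \<Phi> j) \<noteq> 0" using orthonormal_cancel[OF on(2) n, of \<Phi>] nz by auto
  show "(\<Sum>j<n. \<Phi> j * \<Xi> j) \<noteq> 0" using orthonormal_cancel[OF on(1) n, of \<Xi>] nz by auto
qed

text \<open>On the fixed point algebra \<open>\<rho> D\<close> takes fixed values, so a central
  element commutes with these and is an intertwiner from \<open>\<rho> D\<close> to itself.\<close>

lemma center_shift:
  assumes D: "D \<in> group_dual" and z: "z \<in> \<Z>"
  obtains b where "b \<in> \<Z>" "z = \<rho> D b"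
proof -
  have "z \<in> intertwiners \<alpha> (\<rho> D) (\<rho> D)"
    using center_fixed[OF z] center_commute[OF z rho_fixed[OF D]] by (simp add: intertwiners_def)
  with intertwiner_same[OF D] that show thesis by metis
qed

text \<open>The elements \<open>\<Phi>\<^sub>j\<^sup>*\<close> span a copy of the conjugate space \<open>\<Xi>\<close>, up to left multiplication by
  an element of the fixed point algebra; hence moving a central element through them is governed by
  the preceding lemma for the conjugate class.\<close>

lemma rho_center:
  assumes D: "D \<in> group_dual" and z: "z \<in> \<Z>"
  shows "\<rho> D z \<in> \<Z>"
proof -
  obtain D' n \<pi> \<Phi> \<Xi> where D': "D' \<in> group_dual" and n: "0 < n"
    and \<Phi>: "multiplet n \<Phi> \<pi>" and \<Xi>: "multiplet n \<Xi> (\<lambda>g. map_mat cnj (\<pi> g))"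
    and \<rho>: "\<And>A. \<rho> D A = endo n \<Phi> A" "\<And>A. \<rho> D' A = endo n \<Xi> A"
    using conjugate_multiplets[OF D] by metis
  have on: "orthonormal n \<Xi>" and e: "endo n \<Phi> 1 = 1" using \<Phi> \<Xi> by (auto simp: multiplet_def)
  define R where "R = (\<Sum>j<n. \<Xi> j * \<Phi> j)"
  have R: "adj R \<in> \<A>" unfolding R_def by (intro fixed_adj conjugate_sum(1)[OF \<Phi> \<Xi> n])
  have R\<Xi>: "adj R * \<Xi> i = adj (\<Phi> i)" if "i < n" for i
    using orthonormal_cancel_right[OF on that, of "\<lambda>j. adj (\<Phi> j)"] by (simp add: R_def adj_sum adj_mult)
  note az = center_adj[OF z]
  \<comment> \<open>The conjugate class is applied to \<open>adj z\<close>, because taking adjoints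
    at the end returns \<open>z\<close> and turns the \<open>adj (\<Phi> i)\<close> into the basis
    of \<open>HD D\<close>.\<close>
  obtain b where b: "b \<in> \<Z>" "adj z = \<rho> D' b" using center_shift[OF D' az] .
  have shift: "adj z * adj (\<Phi> i) = adj (\<Phi> i) * b" if "i < n" for i
  proof -
    have "adj z * adj (\<Phi> i) = adj R * (adj z * \<Xi> i)"
      unfolding R\<Xi>[OF that, symmetric] mult.assoc[symmetric] center_commute[OF az R] ..
    also have "\<dots> = adj R * \<Xi> i * b"
      unfolding b(2) \<rho> endo_mult_basis[OF on that] by (simp add: mult.assoc)
    finally show ?thesis using R\<Xi>[OF that] by simp
  qed
  have "\<Phi> i * z = adj b * \<Phi> i" if "i < n" for i
    using arg_cong[OF shift[OF that], of adj] by (simp add: adj_mult adj_adj)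
  \<comment> \<open>The element \<open>adj b\<close> comes out of the sum on the left, and what
    remains is the support.\<close>
  then have "\<rho> D z = adj b * endo n \<Phi> 1"
    unfolding \<rho> endo_def sum_distrib_left by (simp add: mult.assoc)
  then show ?thesis using e center_adj[OF b(1)] by simp
qed

end

section \<open>Decompositions and chain classes\<close>

text \<open>Quotient and remainder code the pair of indices of a product family in the same way as
  \<open>kronecker\<close> does.\<close>

lemma sum_div_mod:
  fixes f :: "nat \<Rightarrow> nat \<Rightarrow> 'a::comm_monoid_add"
  assumes "0 < m"
  shows "(\<Sum>i<n * m. f (i div m) (i mod m)) = (\<Sum>a<n. \<Sum>b<m. f a b)"
proof (induction n)
  case (Suc n)
  have "(\<Sum>i<Suc n * m. f (i div m) (i mod m)) = (\<Sum>i<n * m + m. f (i div m) (i mod m))"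
    by (simp add: add.commute)
  also have "\<dots> = (\<Sum>a<n. \<Sum>b<m. f a b) + (\<Sum>b<m. f n b)"
    unfolding sum_split_add Suc.IH using assms by (intro arg_cong2[of _ _ _ _ "(+)"] sum.cong refl) simp_all
  finally show ?case by simp
qed simp

lemma (in star_action) intertwinersI:
  "X \<in> \<A> \<Longrightarrow> (\<And>A. A \<in> \<A> \<Longrightarrow> X * \<sigma> A = \<tau> A * X) \<Longrightarrow> X \<in> intertwiners \<alpha> \<sigma> \<tau>"
  by (simp add: intertwiners_def)

lemma (in star_action) intertwinersD:
  assumes "X \<in> intertwiners \<alpha> \<sigma> \<tau>"
  shows "X \<in> \<A>" "A \<in> \<A> \<Longrightarrow> X * \<sigma> A = \<tau> A * X"
  using assms by (simp_all add: intertwiners_def)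

text \<open>Multiplication in the algebra realises the tensor product of two multiplets. The
  numbering is that of \<open>kronecker\<close>, so no permutation of indices intervenes.\<close>

lemma (in star_action) product_multiplet:
  assumes \<Phi>: "multiplet n \<Phi> U" and \<Psi>: "multiplet m \<Psi> V" and m: "0 < m"
  defines "\<Theta> \<equiv> \<lambda>i. \<Phi> (i div m) * \<Psi> (i mod m)"
  shows "multiplet (n * m) \<Theta> (\<lambda>g. kronecker (U g) (V g))"
    "endo (n * m) \<Theta> A = endo n \<Phi> (endo m \<Psi> A)"
proof -
  have on: "orthonormal n \<Phi>" "orthonormal m \<Psi>" and t: "transforms n \<Phi> U" "transforms m \<Psi> V"
    and e: "endo n \<Phi> 1 = 1" "endo m \<Psi> 1 = 1"
    using \<Phi> \<Psi> by (auto simp: multiplet_def)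
  have c: "U g \<in> carrier_mat n n" "V g \<in> carrier_mat m m" for g
    using t unitary_repD(1) by (auto simp: transforms_def)
  have dm: "i div m < n" "i mod m < m" if "i < n * m" for i
    using that m by (simp_all add: less_mult_imp_div_less)
  have endo: "endo (n * m) \<Theta> A = endo n \<Phi> (endo m \<Psi> A)" for A
    unfolding endo_def[of "n * m"] \<Theta>_def
    by (subst sum_div_mod[OF m, where f="\<lambda>a b. \<Phi> a * \<Psi> b * A * adj (\<Phi> a * \<Psi> b)"])
      (simp add: endo_def adj_mult sum_distrib_left sum_distrib_right mult.assoc)
  have on': "orthonormal (n * m) \<Theta>"
    unfolding orthonormal_def
  proof (intro allI impI)
    fix i j assume ij: "i < n * m" "j < n * m"
    have "adj (\<Theta> i) * \<Theta> j = adj (\<Psi> (i mod m)) * (adj (\<Phi> (i div m)) * \<Phi> (j div m)) * \<Psi> (j mod m)"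
      by (simp add: \<Theta>_def adj_mult mult.assoc)
    also have "\<dots> = (if i div m = j div m \<and> i mod m = j mod m then 1 else 0)"
      unfolding orthonormalD[OF on(1) dm(1)[OF ij(1)] dm(1)[OF ij(2)]]
      by (simp add: orthonormalD[OF on(2)] dm(2)[OF ij(1)] dm(2)[OF ij(2)])
    also have "i div m = j div m \<and> i mod m = j mod m \<longleftrightarrow> i = j"
      by (metis div_mult_mod_eq)
    finally show "adj (\<Theta> i) * \<Theta> j = (if i = j then 1 else 0)" .
  qed
  have "transforms (n * m) \<Theta> (\<lambda>g. kronecker (U g) (V g))"
  proof (rule transformsI[OF on'])
    show "kronecker (U g) (V g) \<in> carrier_mat (n * m) (n * m)" for g
      using carrier_matD[OF c(1)[of g]] carrier_matD[OF c(2)[of g]] by (simp add: kronecker_def)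
    fix g j assume j: "j < n * m"
    have "\<alpha> g (\<Theta> j) = (\<Sum>a<n. \<Sum>b<m. (U g $$ (a, j div m) * V g $$ (b, j mod m)) *\<^sub>C (\<Phi> a * \<Psi> b))"
      unfolding \<Theta>_def action_mult transformsD[OF t(1) dm(1)[OF j]] transformsD[OF t(2) dm(2)[OF j]]
      using scaleC_sum_sum[where y=1] by simp
    also have "\<dots> = (\<Sum>i<n * m. (U g $$ (i div m, j div m) * V g $$ (i mod m, j mod m)) *\<^sub>C \<Theta> i)"
      unfolding \<Theta>_def
      by (rule sum_div_mod[OF m, where
            f="\<lambda>a b. (U g $$ (a, j div m) * V g $$ (b, j mod m)) *\<^sub>C (\<Phi> a * \<Psi> b)", symmetric])
    also have "\<dots> = (\<Sum>i<n * m. kronecker (U g) (V g) $$ (i, j) *\<^sub>C \<Theta> i)"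
      using carrier_matD[OF c(1)[of g]] carrier_matD[OF c(2)[of g]] j by (simp add: kronecker_def)
    finally show "\<alpha> g (\<Theta> j) = (\<Sum>i<n * m. kronecker (U g) (V g) $$ (i, j) *\<^sub>C \<Theta> i)" .
  qed
  then show "multiplet (n * m) \<Theta> (\<lambda>g. kronecker (U g) (V g))"
    using on' endo e by (simp add: multiplet_def)
  show "endo (n * m) \<Theta> A = endo n \<Phi> (endo m \<Psi> A)" by (rule endo)
qed

context minimal_hilbert_system
begin

text \<open>Induction on the list of blocks. The vectors of the first block and a basis of the
  corresponding space \<open>HD\<close> transform by the same matrices, so pairing them gives an
  invariant isometry. The support of \<open>\<Phi>\<close> is left open because the vectors of the
  remaining blocks carry only part of it.\<close>

lemma block_decomposition:
  assumes "set \<pi>s \<subseteq> irreps" "\<And>g. diag_block_mat (map (\<lambda>\<pi>. \<pi> g) \<pi>s) \<in> carrier_mat n n"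
    "orthonormal n \<Phi>"
    "\<And>g j. j < n \<Longrightarrow> \<alpha> g (\<Phi> j) = (\<Sum>i<n. diag_block_mat (map (\<lambda>\<pi>. \<pi> g) \<pi>s) $$ (i, j) *\<^sub>C \<Phi> i)"
  shows "\<exists>W. (\<forall>k<length \<pi>s. W k \<in> \<A>) \<and>
    (\<forall>j<length \<pi>s. \<forall>k<length \<pi>s. adj (W j) * W k = (if j = k then 1 else 0)) \<and>
    (\<forall>B. (\<Sum>k<length \<pi>s. W k * \<rho> (rep_class (\<pi>s ! k)) B * adj (W k)) = endo n \<Phi> B)"
  using assms
proof (induction \<pi>s arbitrary: n \<Phi>)
  case Nil
  then have "n = 0" by auto
  then show ?case by (simp add: endo_def)
next
  case (Cons \<pi> \<pi>s)
  have \<pi>: "\<pi> \<in> irreps" "set \<pi>s \<subseteq> irreps" using Cons.prems(1) by auto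
  then obtain d where irr: "irreducible_rep d \<pi>" by (auto simp: irreps_def)
  then have ud: "unitary_rep d \<pi>" by (simp add: irreducible_rep_def)
  note \<pi>c = unitary_repD(1)[OF ud]
  define rest where "rest = (\<lambda>g. diag_block_mat (map (\<lambda>\<pi>. \<pi> g) \<pi>s))"
  define m where "m = n - d"
  have diag: "diag_block_mat (map (\<lambda>\<pi>. \<pi> g) (\<pi> # \<pi>s)) =
      four_block_mat (\<pi> g) (0\<^sub>m d (dim_col (rest g))) (0\<^sub>m (dim_row (rest g)) d) (rest g)" for g
    using carrier_matD[OF \<pi>c[of g]] by (simp add: rest_def Let_def)
  have dims: "d + dim_row (rest g) = n" "d + dim_col (rest g) = n" for g
    using Cons.prems(2)[of g] carrier_matD[OF \<pi>c[of g]] unfolding diag by auto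
  have n: "n = d + m" using dims(1)[of 0] by (simp add: m_def)
  have rest: "rest g \<in> carrier_mat m m" for g
    using dims[of g] by (intro carrier_matI) (simp_all add: m_def)
  note diag = diag[unfolded carrier_matD[OF rest]]
  have on: "orthonormal (d + m) \<Phi>" using Cons.prems(3) n by simp
  have act: "\<alpha> g (\<Phi> j) = (\<Sum>i<d + m. four_block_mat (\<pi> g) (0\<^sub>m d m) (0\<^sub>m m d) (rest g) $$ (i, j) *\<^sub>C \<Phi> i)"
    if "j < d + m" for g j
    using Cons.prems(4)[of j g] that unfolding diag n by simp
  define \<Phi>' where "\<Phi>' = (\<lambda>i. \<Phi> (d + i))"
  have on0: "orthonormal d \<Phi>" and on': "orthonormal m \<Phi>'"
    using on by (auto simp: orthonormal_def \<Phi>'_def)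
  have t0: "transforms d \<Phi> \<pi>"
    unfolding transforms_def
  proof (intro conjI allI impI)
    fix g j assume "j < d"
    then show "\<alpha> g (\<Phi> j) = (\<Sum>i<d. \<pi> g $$ (i, j) *\<^sub>C \<Phi> i)"
      using carrier_matD[OF \<pi>c[of g]] carrier_matD[OF rest[of g]] by (simp add: act sum_split_add)
  qed (rule ud)
  have act': "\<alpha> g (\<Phi>' j) = (\<Sum>i<m. rest g $$ (i, j) *\<^sub>C \<Phi>' i)" if "j < m" for g j
    using that carrier_matD[OF \<pi>c[of g]] carrier_matD[OF rest[of g]]
    by (simp add: act sum_split_add \<Phi>'_def)
  from Cons.IH[OF \<pi>(2) rest[unfolded rest_def] on' act'[unfolded rest_def]]
  obtain W' where W'_all: "(\<forall>k<length \<pi>s. W' k \<in> \<A>) \<and>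
    (\<forall>j<length \<pi>s. \<forall>k<length \<pi>s. adj (W' j) * W' k = (if j = k then 1 else 0)) \<and>
    (\<forall>B. (\<Sum>k<length \<pi>s. W' k * \<rho> (rep_class (\<pi>s ! k)) B * adj (W' k)) = endo m \<Phi>' B)"
    by (rule exE)
  then have W': "\<And>k. k < length \<pi>s \<Longrightarrow> W' k \<in> \<A>"
    "\<And>j k. j < length \<pi>s \<Longrightarrow> k < length \<pi>s \<Longrightarrow> adj (W' j) * W' k = (if j = k then 1 else 0)"
    "\<And>B. (\<Sum>k<length \<pi>s. W' k * \<rho> (rep_class (\<pi>s ! k)) B * adj (W' k)) = endo m \<Phi>' B"
    by simp_all
  note D = rep_class_dual[OF \<pi>(1)]
  obtain \<Xi> where \<Xi>: "multiplet d \<Xi> \<pi>" "\<And>A. \<rho> (rep_class \<pi>) A = endo d \<Xi> A"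
    using class_multiplet[OF D rep_class_self[OF \<pi>(1)] irr] by metis
  have on\<Xi>: "orthonormal d \<Xi>" and e\<Xi>: "endo d \<Xi> 1 = 1" and t\<Xi>: "transforms d \<Xi> \<pi>"
    using \<Xi>(1) by (auto simp: multiplet_def)
  define W0 where "W0 = (\<Sum>l<d. \<Phi> l * adj (\<Xi> l))"
  have W0A: "W0 \<in> \<A>" using intertwining_sum_fixed[OF t0 t\<Xi> fixed_one] by (simp add: W0_def)
  have adjW0: "adj W0 = (\<Sum>l<d. \<Xi> l * adj (\<Phi> l))" by (simp add: W0_def adj_sum adj_mult adj_adj)
  have W0W0: "adj W0 * W0 = 1"
  proof -
    have "adj W0 * W0 = (\<Sum>l<d. \<Xi> l * (adj (\<Phi> l) * W0))"
      by (simp add: adjW0 sum_distrib_right mult.assoc)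
    also have "\<dots> = endo d \<Xi> 1"
      unfolding endo_def W0_def by (intro sum.cong refl) (simp add: orthonormal_cancel[OF on0])
    finally show ?thesis by (simp add: e\<Xi>)
  qed
  have W0W': "adj W0 * W' k = 0" if k: "k < length \<pi>s" for k
  proof -
    have r1: "\<rho> (rep_class (\<pi>s ! j)) 1 = 1" if "j < length \<pi>s" for j
      using that \<pi>(2) by (intro rho_one rep_class_dual) auto
    \<comment> \<open>At \<open>1\<close> the formula of the induction hypothesis shows that the
      range of \<open>W' k\<close> lies under the support of the remaining vectors, which is
      orthogonal to the first block.\<close>
    have "W' k = (\<Sum>j<length \<pi>s. W' j * \<rho> (rep_class (\<pi>s ! j)) 1 * adj (W' j)) * W' k"
      using k by (subst sum_outer_orthonormal[OF W'(2)]) (auto simp: r1)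
    also have "\<dots> = endo m \<Phi>' 1 * W' k" by (simp only: W'(3))
    finally have P: "W' k = endo m \<Phi>' 1 * W' k" .
    have "adj (\<Phi> l) * endo m \<Phi>' 1 = 0" if "l < d" for l
    proof -
      have "adj (\<Phi> l) * endo m \<Phi>' 1 = (\<Sum>i<m. adj (\<Phi> l) * \<Phi> (d + i) * adj (\<Phi>' i))"
        by (simp add: endo_def \<Phi>'_def sum_distrib_left mult.assoc)
      also have "\<dots> = 0" using that orthonormalD[OF on] by (intro sum.neutral) auto
      finally show ?thesis .
    qed
    then have "adj (\<Phi> l) * W' k = 0" if "l < d" for l
      using that by (subst P) (simp add: mult.assoc[symmetric])
    then show ?thesis by (simp add: adjW0 sum_distrib_right mult.assoc)
  qed
  have W'W0: "adj (W' k) * W0 = 0" if k: "k < length \<pi>s" for k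
    using arg_cong[OF W0W'[OF k], of adj] by (simp add: adj_mult adj_adj)
  have W0endo: "W0 * \<rho> (rep_class \<pi>) B * adj W0 = endo d \<Phi> B" for B
  proof -
    have "W0 * endo d \<Xi> B * adj W0 = (\<Sum>l<d. \<Phi> l * (adj (\<Xi> l) * endo d \<Xi> B) * adj W0)"
      by (simp add: W0_def sum_distrib_right mult.assoc)
    also have "\<dots> = (\<Sum>l<d. \<Phi> l * B * (adj (\<Xi> l) * adj W0))"
      by (intro sum.cong refl) (simp add: adj_basis_mult_endo[OF on\<Xi>] mult.assoc)
    also have "\<dots> = endo d \<Phi> B"
      unfolding endo_def[of d \<Phi>] adjW0 by (intro sum.cong refl) (simp add: orthonormal_cancel[OF on\<Xi>])
    finally show ?thesis by (simp add: \<Xi>(2))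
  qed
  define W where "W = (\<lambda>k. case k of 0 \<Rightarrow> W0 | Suc k \<Rightarrow> W' k)"
  have "W k \<in> \<A>" if "k < length (\<pi> # \<pi>s)" for k
    using that W0A W'(1) by (cases k) (auto simp: W_def)
  moreover have "adj (W j) * W k = (if j = k then 1 else 0)"
    if "j < length (\<pi> # \<pi>s)" "k < length (\<pi> # \<pi>s)" for j k
    using that by (cases j; cases k) (auto simp: W_def W0W0 W0W' W'W0 W'(2))
  moreover have "(\<Sum>k<length (\<pi> # \<pi>s). W k * \<rho> (rep_class ((\<pi> # \<pi>s) ! k)) B * adj (W k)) = endo n \<Phi> B" for B
  proof -
    have "(\<Sum>k<length (\<pi> # \<pi>s). W k * \<rho> (rep_class ((\<pi> # \<pi>s) ! k)) B * adj (W k)) =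
        endo d \<Phi> B + endo m \<Phi>' B"
      by (simp add: sum.lessThan_Suc_shift W_def W0endo W'(3) del: sum.lessThan_Suc)
    also have "\<dots> = endo n \<Phi> B" unfolding n by (simp add: endo_def sum_split_add \<Phi>'_def)
    finally show ?thesis .
  qed
  ultimately show ?case by blast
qed

text \<open>A class may stand at several indices, which expresses its multiplicity. The intertwiners
  \<open>W k\<close> take over the role of the block matrices.\<close>

definition decomposition :: "('f \<Rightarrow> 'f) \<Rightarrow> nat \<Rightarrow> (nat \<Rightarrow> 'f) \<Rightarrow> (nat \<Rightarrow> 'g rep set) \<Rightarrow> bool" where
  "decomposition \<tau> K W Ds \<longleftrightarrow>
     (\<forall>k<K. Ds k \<in> group_dual \<and> W k \<in> intertwiners \<alpha> (\<rho> (Ds k)) \<tau>) \<and>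
     (\<forall>j<K. \<forall>k<K. adj (W j) * W k = (if j = k then 1 else 0)) \<and>
     (\<forall>B. (\<Sum>k<K. W k * \<rho> (Ds k) B * adj (W k)) = \<tau> B)"

lemma decompositionD:
  assumes "decomposition \<tau> K W Ds"
  shows "k < K \<Longrightarrow> Ds k \<in> group_dual" "k < K \<Longrightarrow> W k \<in> intertwiners \<alpha> (\<rho> (Ds k)) \<tau>"
    "j < K \<Longrightarrow> k < K \<Longrightarrow> adj (W j) * W k = (if j = k then 1 else 0)"
    "(\<Sum>k<K. W k * \<rho> (Ds k) B * adj (W k)) = \<tau> B"
  using assms by (simp_all add: decomposition_def)

lemma decomposition_sum_one:
  assumes "decomposition \<tau> K W Ds" "\<tau> 1 = 1"
  shows "(\<Sum>k<K. W k * adj (W k)) = 1"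
  using decompositionD(4)[OF assms(1), of 1] assms(2)
  by (simp add: rho_one decompositionD(1)[OF assms(1)])

text \<open>The adjoint of the relation for \<open>W k\<close> at \<open>adj A\<close> shows that
  \<open>adj (W k)\<close> intertwines in the opposite direction; it can then be composed with
  \<open>X\<close>.\<close>

lemma decomposition_coefficient:
  assumes dec: "decomposition \<tau> K W Ds" and \<tau>: "\<And>A. \<tau> (adj A) = adj (\<tau> A)"
    and X: "X \<in> intertwiners \<alpha> \<sigma> \<tau>" and k: "k < K"
  shows "adj (W k) * X \<in> intertwiners \<alpha> \<sigma> (\<rho> (Ds k))"
proof (rule intertwinersI)
  note W = decompositionD(2)[OF dec k]
  show "adj (W k) * X \<in> \<A>"
    by (intro fixed_mult fixed_adj intertwinersD(1)[OF W] intertwinersD(1)[OF X])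
  fix A assume A: "A \<in> \<A>"
  have "adj (W k * \<rho> (Ds k) (adj A)) = adj (\<tau> (adj A) * W k)"
    using intertwinersD(2)[OF W fixed_adj[OF A]] by simp
  then have 1: "\<rho> (Ds k) A * adj (W k) = adj (W k) * \<tau> A"
    by (simp add: adj_mult \<tau> rho_adj[OF decompositionD(1)[OF dec k]] adj_adj)
  have "adj (W k) * X * \<sigma> A = adj (W k) * \<tau> A * X"
    by (simp add: mult.assoc intertwinersD(2)[OF X A])
  then show "adj (W k) * X * \<sigma> A = \<rho> (Ds k) A * (adj (W k) * X)"
    by (simp add: 1[symmetric] mult.assoc)
qed

lemma decomposition_expand:
  assumes "decomposition \<tau> K W Ds" "\<tau> 1 = 1"
  shows "X = (\<Sum>k<K. W k * (adj (W k) * X))"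
  using arg_cong[OF decomposition_sum_one[OF assms], of "\<lambda>y. y * X"]
  by (simp add: sum_distrib_right mult.assoc)

lemma decomposition_coefficient_nonzero:
  assumes "decomposition \<tau> K W Ds" "\<tau> 1 = 1" "X \<noteq> 0"
  obtains k where "k < K" "adj (W k) * X \<noteq> 0"
proof (rule ccontr)
  assume "\<not> thesis"
  then have "(\<Sum>k<K. W k * (adj (W k) * X)) = 0" using that by (intro sum.neutral) fastforce
  then show False using decomposition_expand[OF assms(1,2), of X] assms(3) by simp
qed

lemma rep_decomposition:
  assumes \<Phi>: "multiplet n \<Phi> U" and \<pi>s: "set \<pi>s \<subseteq> irreps"
    and eq: "rep_equiv U (\<lambda>g. diag_block_mat (map (\<lambda>\<pi>. \<pi> g) \<pi>s))"
  obtains W where "decomposition (endo n \<Phi>) (length \<pi>s) W (\<lambda>k. rep_class (\<pi>s ! k))"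
proof -
  obtain \<Psi> where \<Psi>: "multiplet n \<Psi> (\<lambda>g. diag_block_mat (map (\<lambda>\<pi>. \<pi> g) \<pi>s))"
    "\<And>A. endo n \<Psi> A = endo n \<Phi> A"
    using multiplet_rep_equiv[OF \<Phi> eq] by metis
  have on: "orthonormal n \<Psi>" and t: "transforms n \<Psi> (\<lambda>g. diag_block_mat (map (\<lambda>\<pi>. \<pi> g) \<pi>s))"
    using \<Psi>(1) by (simp_all add: multiplet_def)
  have c: "diag_block_mat (map (\<lambda>\<pi>. \<pi> g) \<pi>s) \<in> carrier_mat n n" for g
    using t unitary_repD(1)[of n "\<lambda>g. diag_block_mat (map (\<lambda>\<pi>. \<pi> g) \<pi>s)" g] by (simp add: transforms_def)
  from block_decomposition[OF \<pi>s c on transformsD[OF t]]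
  obtain W where W_all: "(\<forall>k<length \<pi>s. W k \<in> \<A>) \<and>
    (\<forall>j<length \<pi>s. \<forall>k<length \<pi>s. adj (W j) * W k = (if j = k then 1 else 0)) \<and>
    (\<forall>B. (\<Sum>k<length \<pi>s. W k * \<rho> (rep_class (\<pi>s ! k)) B * adj (W k)) = endo n \<Psi> B)"
    by (rule exE)
  then have W: "\<And>k. k < length \<pi>s \<Longrightarrow> W k \<in> \<A>"
    "\<And>j k. j < length \<pi>s \<Longrightarrow> k < length \<pi>s \<Longrightarrow> adj (W j) * W k = (if j = k then 1 else 0)"
    "\<And>B. (\<Sum>k<length \<pi>s. W k * \<rho> (rep_class (\<pi>s ! k)) B * adj (W k)) = endo n \<Psi> B"
    by simp_all
  have W3: "(\<Sum>k<length \<pi>s. W k * \<rho> (rep_class (\<pi>s ! k)) B * adj (W k)) = endo n \<Phi> B" for B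
    unfolding W(3) by (rule \<Psi>(2))
  \<comment> \<open>The intertwining relation comes from the formula for the endomorphism:
    multiplied by \<open>W k\<close>, it retains one summand, by orthogonality.\<close>
  have "W k \<in> intertwiners \<alpha> (\<rho> (rep_class (\<pi>s ! k))) (endo n \<Phi>)" if "k < length \<pi>s" for k
    unfolding W3[symmetric] using that W(1)
    by (intro intertwinersI) (simp_all add: sum_outer_orthonormal[OF W(2)])
  moreover have "rep_class (\<pi>s ! k) \<in> group_dual" if "k < length \<pi>s" for k
    using that \<pi>s by (intro rep_class_dual) auto
  ultimately have "decomposition (endo n \<Phi>) (length \<pi>s) W (\<lambda>k. rep_class (\<pi>s ! k))"
    using W(2) W3 by (simp add: decomposition_def)
  then show thesis by (rule that)
qed

lemma multiplet_decomposition: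
  assumes "multiplet n \<Phi> U"
  obtains K W Ds where "decomposition (endo n \<Phi>) K W Ds" "\<forall>k<K. occurs_in_rep (Ds k) U"
proof -
  have "unitary_rep n U" using assms by (simp add: multiplet_def transforms_def)
  then obtain \<pi>s where \<pi>s: "set \<pi>s \<subseteq> irreps" "rep_equiv U (\<lambda>g. diag_block_mat (map (\<lambda>\<pi>. \<pi> g) \<pi>s))"
    using complete_reducibility by blast
  obtain W where W: "decomposition (endo n \<Phi>) (length \<pi>s) W (\<lambda>k. rep_class (\<pi>s ! k))"
    by (rule rep_decomposition[OF assms \<pi>s])
  have mem: "\<pi>s ! k \<in> irreps" if "k < length \<pi>s" for k using that \<pi>s(1) by auto
  have "occurs_in_rep (rep_class (\<pi>s ! k)) U" if "k < length \<pi>s" for k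
    unfolding occurs_in_rep_def using \<pi>s that rep_class_self[OF mem[OF that]]
    by (intro exI[of _ \<pi>s]) auto
  with that[OF W] show thesis by blast
qed

lemma occurs_isometry:
  assumes \<Phi>: "multiplet n \<Phi> U" and D: "D \<in> group_dual" and occ: "occurs_in_rep D U"
  obtains X where "X \<in> intertwiners \<alpha> (\<rho> D) (endo n \<Phi>)" "adj X * X = 1"
proof -
  obtain \<pi>s \<pi> where \<pi>s: "set \<pi>s \<subseteq> irreps" "rep_equiv U (\<lambda>g. diag_block_mat (map (\<lambda>\<pi>. \<pi> g) \<pi>s))"
    and \<pi>: "\<pi> \<in> set \<pi>s" "\<pi> \<in> D"
    using occ unfolding occurs_in_rep_def by blast
  obtain k where k: "k < length \<pi>s" "\<pi>s ! k = \<pi>" using \<pi>(1) by (metis in_set_conv_nth)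
  have D_eq: "rep_class (\<pi>s ! k) = D" using group_dual_memD(2)[OF D \<pi>(2)] k by simp
  obtain W where W: "decomposition (endo n \<Phi>) (length \<pi>s) W (\<lambda>k. rep_class (\<pi>s ! k))"
    by (rule rep_decomposition[OF \<Phi> \<pi>s])
  show thesis
    using that[of "W k"] decompositionD(2)[OF W k(1)] decompositionD(3)[OF W k(1) k(1)] D_eq by simp
qed

text \<open>The range projections of a decomposition add up to the unit, so some coefficient
  \<open>adj (W k) * X\<close> is nonzero. The source \<open>\<sigma>\<close> is arbitrary because
  the identity serves as a source as well as \<open>\<rho> D\<close>.\<close>

lemma intertwiner_component:
  assumes \<Phi>: "multiplet n \<Phi> U" and X: "X \<in> intertwiners \<alpha> \<sigma> (endo n \<Phi>)" "X \<noteq> 0"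
  obtains E Y where "E \<in> group_dual" "occurs_in_rep E U" "Y \<in> intertwiners \<alpha> \<sigma> (\<rho> E)" "Y \<noteq> 0"
proof -
  obtain K W Ds where dec: "decomposition (endo n \<Phi>) K W Ds" and occ: "\<forall>k<K. occurs_in_rep (Ds k) U"
    by (rule multiplet_decomposition[OF \<Phi>])
  have "endo n \<Phi> 1 = 1" using \<Phi> by (simp add: multiplet_def)
  then obtain k where k: "k < K" "adj (W k) * X \<noteq> 0"
    using decomposition_coefficient_nonzero[OF dec _ X(2)] by metis
  moreover have "adj (W k) * X \<in> intertwiners \<alpha> \<sigma> (\<rho> (Ds k))"
    by (rule decomposition_coefficient[OF dec _ X(1) k(1)]) (simp add: endo_adj)
  ultimately show thesis using that decompositionD(1)[OF dec] occ by blast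
qed

text \<open>A nonzero component leads from \<open>\<rho> D\<close> to some occurring
  \<open>\<rho> E\<close>, and Schur's lemma forces \<open>E = D\<close>.\<close>

lemma intertwiner_occurs:
  assumes "multiplet n \<Phi> U" "D \<in> group_dual" "X \<in> intertwiners \<alpha> (\<rho> D) (endo n \<Phi>)" "X \<noteq> 0"
  shows "occurs_in_rep D U"
  using intertwiner_component[OF assms(1,3,4)] intertwiner_distinct[OF assms(2)] by metis

section \<open>Products of classes in terms of intertwiners\<close>

lemma class_product_multiplet:
  assumes D1: "D1 \<in> group_dual" "U1 \<in> D1" and D2: "D2 \<in> group_dual" "U2 \<in> D2"
  obtains n \<Theta> where "multiplet n \<Theta> (\<lambda>g. kronecker (U1 g) (U2 g))" "\<And>A. endo n \<Theta> A = \<rho> D1 (\<rho> D2 A)"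
proof -
  obtain n m where irr: "irreducible_rep n U1" "irreducible_rep m U2"
    using group_dual_memD(1)[OF D1] group_dual_memD(1)[OF D2] by (auto simp: irreps_def)
  obtain \<Phi> where \<Phi>: "multiplet n \<Phi> U1" "\<And>A. \<rho> D1 A = endo n \<Phi> A"
    using class_multiplet[OF D1 irr(1)] by metis
  obtain \<Psi> where \<Psi>: "multiplet m \<Psi> U2" "\<And>A. \<rho> D2 A = endo m \<Psi> A"
    using class_multiplet[OF D2 irr(2)] by metis
  note P = product_multiplet[OF \<Phi>(1) \<Psi>(1) irreducible_dim[OF irr(2)]]
  show thesis by (rule that[OF P(1)]) (simp add: P(2) \<Phi>(2) \<Psi>(2))
qed

lemma class_product_dual: "D \<in> class_product D1 D2 \<Longrightarrow> D \<in> group_dual"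
  by (simp add: class_product_def)

lemma class_product_isometry:
  assumes D1: "D1 \<in> group_dual" and D2: "D2 \<in> group_dual" and D: "D \<in> class_product D1 D2"
  obtains X where "X \<in> intertwiners \<alpha> (\<rho> D) (\<lambda>A. \<rho> D1 (\<rho> D2 A))" "adj X * X = 1"
proof -
  obtain U1 U2 where U: "U1 \<in> D1" "U2 \<in> D2" "occurs_in_rep D (\<lambda>g. kronecker (U1 g) (U2 g))"
    using D by (auto simp: class_product_def)
  obtain n \<Theta> where \<Theta>: "multiplet n \<Theta> (\<lambda>g. kronecker (U1 g) (U2 g))"
    "\<And>A. endo n \<Theta> A = \<rho> D1 (\<rho> D2 A)"
    using class_product_multiplet[OF D1 U(1) D2 U(2)] by metis
  have "endo n \<Theta> = (\<lambda>A. \<rho> D1 (\<rho> D2 A))" using \<Theta>(2) by auto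
  with occurs_isometry[OF \<Theta>(1) class_product_dual[OF D] U(3)] that show thesis by metis
qed

text \<open>Any representatives may be chosen, since the existence of a nonzero intertwiner refers
  to the endomorphisms alone. Together with \<open>class_product_isometry\<close> this is a
  criterion for membership that can be composed.\<close>

lemma class_productI:
  assumes D1: "D1 \<in> group_dual" and D2: "D2 \<in> group_dual" and D: "D \<in> group_dual"
    and X: "X \<in> intertwiners \<alpha> (\<rho> D) (\<lambda>A. \<rho> D1 (\<rho> D2 A))" "X \<noteq> 0"
  shows "D \<in> class_product D1 D2"
proof -
  obtain U1 U2 where U: "U1 \<in> D1" "U2 \<in> D2" using group_dualE D1 D2 by metis
  obtain n \<Theta> where \<Theta>: "multiplet n \<Theta> (\<lambda>g. kronecker (U1 g) (U2 g))"
    "\<And>A. endo n \<Theta> A = \<rho> D1 (\<rho> D2 A)"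
    using class_product_multiplet[OF D1 U(1) D2 U(2)] by metis
  have "endo n \<Theta> = (\<lambda>A. \<rho> D1 (\<rho> D2 A))" using \<Theta>(2) by auto
  then have "occurs_in_rep D (\<lambda>g. kronecker (U1 g) (U2 g))"
    using intertwiner_occurs[OF \<Theta>(1) D] X by simp
  then show ?thesis using U D by (auto simp: class_product_def)
qed

lemma class_product_decomposition:
  assumes D1: "D1 \<in> group_dual" and D2: "D2 \<in> group_dual"
  obtains K W Ds where "decomposition (\<lambda>A. \<rho> D1 (\<rho> D2 A)) K W Ds" "\<forall>k<K. Ds k \<in> class_product D1 D2"
proof -
  obtain U1 U2 where U: "U1 \<in> D1" "U2 \<in> D2" using group_dualE D1 D2 by metis
  obtain n \<Theta> where \<Theta>: "multiplet n \<Theta> (\<lambda>g. kronecker (U1 g) (U2 g))"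
    "\<And>A. endo n \<Theta> A = \<rho> D1 (\<rho> D2 A)"
    using class_product_multiplet[OF D1 U(1) D2 U(2)] by metis
  have e: "endo n \<Theta> = (\<lambda>A. \<rho> D1 (\<rho> D2 A))" using \<Theta>(2) by auto
  obtain K W Ds where dec: "decomposition (endo n \<Theta>) K W Ds"
    and occ: "\<forall>k<K. occurs_in_rep (Ds k) (\<lambda>g. kronecker (U1 g) (U2 g))"
    by (rule multiplet_decomposition[OF \<Theta>(1)])
  have "Ds k \<in> class_product D1 D2" if "k < K" for k
    using decompositionD(1)[OF dec that] occ that U by (auto simp: class_product_def)
  then show thesis using dec that unfolding e by blast
qed

text \<open>The two given isometries compose to a nonzero intertwiner from \<open>\<rho> D\<close>
  to the threefold product. The unit is decomposed along the classes in the product of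
  \<open>D2\<close> and \<open>D3\<close>, and \<open>\<rho> D1\<close> is applied to the summands;
  one of them does not annihilate the intertwiner, and its class is \<open>F\<close>.\<close>

lemma class_product_assoc:
  fixes D1 D2 D3 :: "'g rep set"
  assumes D1: "D1 \<in> group_dual" and D2: "D2 \<in> group_dual" and D3: "D3 \<in> group_dual"
    and E: "E \<in> class_product D1 D2" and D: "D \<in> class_product E D3"
  obtains F where "F \<in> class_product D2 D3" "D \<in> class_product D1 F"
proof -
  note Ed = class_product_dual[OF E] and Dd = class_product_dual[OF D]
  obtain W where W: "W \<in> intertwiners \<alpha> (\<rho> E) (\<lambda>A. \<rho> D1 (\<rho> D2 A))" "adj W * W = 1"
    using class_product_isometry[OF D1 D2 E] by metis
  obtain Y where Y: "Y \<in> intertwiners \<alpha> (\<rho> D) (\<lambda>A. \<rho> E (\<rho> D3 A))" "adj Y * Y = 1"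
    using class_product_isometry[OF Ed D3 D] by metis
  obtain K S Fs where dec: "decomposition (\<lambda>A. \<rho> D2 (\<rho> D3 A)) K S Fs"
    and Fs: "\<forall>k<K. Fs k \<in> class_product D2 D3"
    by (rule class_product_decomposition[OF D2 D3])
  note S = decompositionD(2)[OF dec] and Fd = decompositionD(1)[OF dec]
  have sum: "(\<Sum>k<K. S k * adj (S k)) = 1"
    using decomposition_sum_one[OF dec] by (simp add: rho_one D2 D3)
  define V where "V = W * Y"
  have VA: "V \<in> \<A>" unfolding V_def by (intro fixed_mult intertwinersD(1)[OF W(1)] intertwinersD(1)[OF Y(1)])
  have "adj V * V = adj Y * (adj W * W) * Y" by (simp add: V_def adj_mult mult.assoc)
  then have "adj V * V = 1" by (simp add: W Y)
  then have V0: "V \<noteq> 0" by auto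
  have VI: "V * \<rho> D A = \<rho> D1 (\<rho> D2 (\<rho> D3 A)) * V" if A: "A \<in> \<A>" for A
  proof -
    have "V * \<rho> D A = W * \<rho> E (\<rho> D3 A) * Y" by (simp add: V_def mult.assoc intertwinersD(2)[OF Y(1) A])
    also have "\<dots> = \<rho> D1 (\<rho> D2 (\<rho> D3 A)) * W * Y"
      by (simp add: intertwinersD(2)[OF W(1) rho_fixed[OF D3 A]])
    finally show ?thesis by (simp add: V_def mult.assoc)
  qed
  have "V = \<rho> D1 (\<Sum>k<K. S k * adj (S k)) * V" by (simp add: sum rho_one[OF D1])
  also have "\<dots> = (\<Sum>k<K. \<rho> D1 (S k) * (\<rho> D1 (adj (S k)) * V))"
    by (simp add: rho_sum[OF D1] rho_mult[OF D1] sum_distrib_right mult.assoc)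
  finally obtain k where k: "k < K" "\<rho> D1 (adj (S k)) * V \<noteq> 0"
    using V0 by (metis (no_types, lifting) lessThan_iff mult_zero_right sum.neutral)
  note Fd = Fd[OF k(1)]
  have "\<rho> D1 (adj (S k)) * V \<in> intertwiners \<alpha> (\<rho> D) (\<lambda>A. \<rho> D1 (\<rho> (Fs k) A))"
  proof (rule intertwinersI)
    show "\<rho> D1 (adj (S k)) * V \<in> \<A>"
      by (intro fixed_mult rho_fixed[OF D1] fixed_adj intertwinersD(1)[OF S[OF k(1)]] VA)
    fix A assume A: "A \<in> \<A>"
    have "adj (S k * \<rho> (Fs k) (adj A)) = adj (\<rho> D2 (\<rho> D3 (adj A)) * S k)"
      using intertwinersD(2)[OF S[OF k(1)] fixed_adj[OF A]] by simp
    then have 1: "\<rho> (Fs k) A * adj (S k) = adj (S k) * \<rho> D2 (\<rho> D3 A)"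
      by (simp add: adj_mult rho_adj[OF Fd] rho_adj[OF D2] rho_adj[OF D3] adj_adj)
    have "\<rho> D1 (adj (S k)) * V * \<rho> D A = \<rho> D1 (adj (S k)) * \<rho> D1 (\<rho> D2 (\<rho> D3 A)) * V"
      by (simp add: mult.assoc VI[OF A])
    also have "\<dots> = \<rho> D1 (\<rho> (Fs k) A * adj (S k)) * V"
      by (simp only: 1 rho_mult[OF D1])
    finally show "\<rho> D1 (adj (S k)) * V * \<rho> D A = \<rho> D1 (\<rho> (Fs k) A) * (\<rho> D1 (adj (S k)) * V)"
      by (simp add: rho_mult[OF D1] mult.assoc)
  qed
  then have "D \<in> class_product D1 (Fs k)" using class_productI[OF D1 Fd Dd] k(2) by blast
  with Fs k(1) that show thesis by blast
qed

section \<open>Chain products and chain classes\<close>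

lemma chain_product_dual: "set Ds \<subseteq> group_dual \<Longrightarrow> chain_product Ds \<subseteq> group_dual"
  by (induction Ds rule: chain_product.induct) (auto simp: class_set_product_def dest: class_product_dual)

text \<open>Chain products are bracketed to the right, so the multiplication by \<open>D2\<close>
  has to be moved inwards past each factor of \<open>Ds\<close>; this is the rebracketing of
  \<open>class_product_assoc\<close>.\<close>

lemma chain_product_append:
  fixes Ds Es :: "'g rep set list"
  assumes "set Ds \<subseteq> group_dual" "Ds \<noteq> []" "set Es \<subseteq> group_dual" "Es \<noteq> []"
    and "D1 \<in> chain_product Ds" "D2 \<in> chain_product Es" "D \<in> class_product D1 D2"
  shows "D \<in> chain_product (Ds @ Es)"
  using assms(1,2,5,7)
proof (induction Ds arbitrary: D1 D rule: chain_product.induct)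
  case (2 X)
  obtain E Es' where Es: "Es = E # Es'" using assms(4) by (cases Es) auto
  show ?case using 2 assms(6) by (auto simp: Es class_set_product_def)
next
  case (3 X Y Ds)
  then obtain D1' where D1': "D1' \<in> chain_product (Y # Ds)" "D1 \<in> class_product X D1'"
    by (auto simp: class_set_product_def)
  have X: "X \<in> group_dual" and "D1' \<in> group_dual"
    using 3 D1'(1) chain_product_dual[of "Y # Ds"] by auto
  moreover have "D2 \<in> group_dual" using assms(3,6) chain_product_dual by blast
  ultimately obtain F where F: "F \<in> class_product D1' D2" "D \<in> class_product X F"
    using class_product_assoc D1'(2) "3.prems"(4) by metis
  have "F \<in> chain_product ((Y # Ds) @ Es)" using "3.IH"[OF _ _ D1'(1) F(1)] "3.prems"(1) by auto
  then show ?case using F(2) by (auto simp: class_set_product_def)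
qed simp

text \<open>The class \<open>E\<close> acts as a unit: \<open>\<rho> D Y\<close> and
  \<open>Y\<close> itself are the intertwiners for the two memberships. The former is nonzero
  because \<open>\<rho> D\<close> is injective.\<close>

lemma unit_class_product:
  assumes D: "D \<in> group_dual" and E: "E \<in> group_dual" and Y: "Y \<in> intertwiners \<alpha> id (\<rho> E)" "Y \<noteq> 0"
  shows "D \<in> class_product D E" "D \<in> class_product E D"
proof -
  note YA = intertwinersD(1)[OF Y(1)] and YI = intertwinersD(2)[OF Y(1), simplified]
  have "\<rho> D Y \<in> intertwiners \<alpha> (\<rho> D) (\<lambda>A. \<rho> D (\<rho> E A))"
    by (intro intertwinersI rho_fixed[OF D] YA) (simp add: rho_mult[OF D, symmetric] YI)
  then show "D \<in> class_product D E"
    using rho_eq_zero[OF D, of Y] Y(2) class_productI[OF D E D] by blast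
  have "Y \<in> intertwiners \<alpha> (\<rho> D) (\<lambda>A. \<rho> E (\<rho> D A))"
    by (intro intertwinersI YA) (simp add: YI rho_fixed[OF D])
  then show "D \<in> class_product E D" using Y(2) class_productI[OF E D D] by blast
qed

text \<open>The trivial class is not mentioned: its role is played by any class \<open>E\<close> with a nonzero
  intertwiner from the identity to \<open>\<rho>\<^sub>E\<close>.\<close>

lemma conjugate_class:
  assumes D: "D \<in> group_dual"
  obtains D' E E' Y Y' where "D' \<in> group_dual"
    "E \<in> class_product D' D" "Y \<in> intertwiners \<alpha> id (\<rho> E)" "Y \<noteq> 0"
    "E' \<in> class_product D D'" "Y' \<in> intertwiners \<alpha> id (\<rho> E')" "Y' \<noteq> 0"
proof -
  obtain D' n \<pi> \<Phi> \<Xi> where D': "D' \<in> group_dual" and n: "0 < n"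
    and \<Phi>: "multiplet n \<Phi> \<pi>" and \<Xi>: "multiplet n \<Xi> (\<lambda>g. map_mat cnj (\<pi> g))"
    and \<rho>: "\<And>A. \<rho> D A = endo n \<Phi> A" "\<And>A. \<rho> D' A = endo n \<Xi> A"
    using conjugate_multiplets[OF D] by metis
  have on: "orthonormal n \<Phi>" "orthonormal n \<Xi>" using \<Phi> \<Xi> by (simp_all add: multiplet_def)
  note S = conjugate_sum[OF \<Phi> \<Xi> n]
  have inter: "(\<Sum>j<n. X j * Y j) * A = endo n X (endo n Y A) * (\<Sum>j<n. X j * Y j)"
    if "orthonormal n X" "orthonormal n Y" for X Y :: "nat \<Rightarrow> 'f" and A
  proof -
    have "endo n X (endo n Y A) * (X j * Y j) = X j * Y j * A" if "j < n" for j
      using \<open>orthonormal n X\<close> \<open>orthonormal n Y\<close> that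
      by (simp add: mult.assoc[symmetric] endo_mult_basis) (simp add: mult.assoc endo_mult_basis)
    then show ?thesis by (simp add: sum_distrib_left sum_distrib_right)
  qed
  \<comment> \<open>A nonzero intertwiner from the identity to a product has a nonzero component at
    one of the classes in that product.\<close>
  have comp: "\<exists>E Y. E \<in> class_product D1 D2 \<and> Y \<in> intertwiners \<alpha> id (\<rho> E) \<and> Y \<noteq> 0"
    if d: "D1 \<in> group_dual" "D2 \<in> group_dual" and X: "X \<in> intertwiners \<alpha> id (\<lambda>A. \<rho> D1 (\<rho> D2 A))" "X \<noteq> 0" for D1 D2 X
  proof -
    obtain U1 U2 where U: "U1 \<in> D1" "U2 \<in> D2" using group_dualE d by metis
    obtain m \<Theta> where \<Theta>: "multiplet m \<Theta> (\<lambda>g. kronecker (U1 g) (U2 g))"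
      "\<And>A. endo m \<Theta> A = \<rho> D1 (\<rho> D2 A)"
      using class_product_multiplet[OF d(1) U(1) d(2) U(2)] by metis
    have "endo m \<Theta> = (\<lambda>A. \<rho> D1 (\<rho> D2 A))" using \<Theta>(2) by auto
    then obtain E Y where "E \<in> group_dual" "occurs_in_rep E (\<lambda>g. kronecker (U1 g) (U2 g))"
      "Y \<in> intertwiners \<alpha> id (\<rho> E)" "Y \<noteq> 0"
      using intertwiner_component[OF \<Theta>(1), of X id] X by metis
    then show ?thesis using U by (auto simp: class_product_def)
  qed
  have "(\<Sum>j<n. \<Xi> j * \<Phi> j) \<in> intertwiners \<alpha> id (\<lambda>A. \<rho> D' (\<rho> D A))"
    using inter[OF on(2,1)] by (intro intertwinersI S) (simp add: \<rho>)
  moreover have "(\<Sum>j<n. \<Phi> j * \<Xi> j) \<in> intertwiners \<alpha> id (\<lambda>A. \<rho> D (\<rho> D' A))"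
    using inter[OF on] by (intro intertwinersI S) (simp add: \<rho>)
  ultimately have
    "\<exists>E Y. E \<in> class_product D' D \<and> Y \<in> intertwiners \<alpha> id (\<rho> E) \<and> Y \<noteq> 0"
    "\<exists>E Y. E \<in> class_product D D' \<and> Y \<in> intertwiners \<alpha> id (\<rho> E) \<and> Y \<noteq> 0"
    using comp[OF D' D] comp[OF D D'] S(3,4) by blast+
  with that[OF D'] show thesis by blast
qed

text \<open>The factor \<open>D'\<close> between the two lists cancels \<open>D1\<close>. For
  \<open>D\<close>, the part \<open>[D'] @ Es\<close> contributes the unit class \<open>E\<close>,
  obtained from \<open>D1\<close>, so that \<open>D\<close> from \<open>Ds\<close> is unchanged. For
  \<open>D2\<close>, the list \<open>Ds\<close> contributes \<open>D1\<close>, which cancels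
  \<open>D'\<close> and leaves the \<open>D2\<close> from \<open>Es\<close>.\<close>

lemma chain_equiv_trans:
  fixes D D1 D2 :: "'g rep set"
  assumes "chain_equiv D D1" "chain_equiv D1 D2"
  shows "chain_equiv D D2"
proof -
  obtain Ds where Ds: "Ds \<noteq> []" "set Ds \<subseteq> group_dual" "D \<in> chain_product Ds" "D1 \<in> chain_product Ds"
    using assms(1) by (auto simp: chain_equiv_def)
  obtain Es where Es: "Es \<noteq> []" "set Es \<subseteq> group_dual" "D1 \<in> chain_product Es" "D2 \<in> chain_product Es"
    using assms(2) by (auto simp: chain_equiv_def)
  have d: "D \<in> group_dual" "D1 \<in> group_dual" "D2 \<in> group_dual"
    using Ds Es chain_product_dual by blast+
  obtain D' E E' Y Y' where D': "D' \<in> group_dual"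
    and E: "E \<in> class_product D' D1" "Y \<in> intertwiners \<alpha> id (\<rho> E)" "Y \<noteq> 0"
    and E': "E' \<in> class_product D1 D'" "Y' \<in> intertwiners \<alpha> id (\<rho> E')" "Y' \<noteq> 0"
    using conjugate_class[OF d(2)] by metis
  have app: "F \<in> chain_product ([D'] @ Es)" if "F \<in> class_product D' G" "G \<in> chain_product Es" for F G
    using chain_product_append[of "[D']" Es D' G F] that D' Es by simp
  have app': "F \<in> chain_product (Ds @ [D'] @ Es)"
    if "F \<in> class_product G G'" "G \<in> chain_product Ds" "G' \<in> chain_product ([D'] @ Es)" for F G G'
    using chain_product_append[of Ds "[D'] @ Es" G G' F] that D' Ds(1,2) Es(2) by simp
  have "D \<in> class_product D E" using unit_class_product(1)[OF d(1) class_product_dual[OF E(1)] E(2,3)] .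
  then have "D \<in> chain_product (Ds @ [D'] @ Es)" using app' Ds(3) app[OF E(1) Es(3)] by blast
  moreover have "D2 \<in> class_product E' D2"
    using unit_class_product(2)[OF d(3) class_product_dual[OF E'(1)] E'(2,3)] .
  \<comment> \<open>The unit class \<open>E'\<close> arises in the product of \<open>D1\<close> and
    \<open>D'\<close>, whereas the list brackets \<open>D'\<close> with \<open>Es\<close>; hence the
    rebracketing.\<close>
  then obtain F where "F \<in> class_product D' D2" "D2 \<in> class_product D1 F"
    using class_product_assoc[OF d(2) D' d(3) E'(1)] by metis
  then have "D2 \<in> chain_product (Ds @ [D'] @ Es)" using app' Ds(4) app Es(4) by blast
  ultimately show ?thesis
    using D' Ds(2) Es(2) unfolding chain_equiv_def by (intro exI[of _ "Ds @ [D'] @ Es"]) auto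
qed

lemma chain_equiv_sym: "chain_equiv D E \<Longrightarrow> chain_equiv E D"
  by (auto simp: chain_equiv_def)

lemma chain_class_self: "D \<in> group_dual \<Longrightarrow> D \<in> chain_class D"
  by (auto simp: chain_class_def chain_equiv_def intro!: exI[of _ "[D]"])

lemma chain_class_eq:
  fixes D E :: "'g rep set"
  shows "chain_equiv D E \<Longrightarrow> chain_class D = chain_class E"
  unfolding chain_class_def using chain_equiv_sym chain_equiv_trans by blast

text \<open>The iterated value is central, so it commutes with the isometry \<open>W\<close>; the
  intertwining relation becomes an equation with \<open>W\<close> as common left factor, and
  \<open>adj W\<close> cancels it.\<close>

lemma rho_class_product:
  assumes D1: "D1 \<in> group_dual" and D2: "D2 \<in> group_dual" and D: "D \<in> class_product D1 D2" and z: "z \<in> \<Z>"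
  shows "\<rho> D z = \<rho> D1 (\<rho> D2 z)"
proof -
  obtain W where W: "W \<in> intertwiners \<alpha> (\<rho> D) (\<lambda>A. \<rho> D1 (\<rho> D2 A))" "adj W * W = 1"
    using class_product_isometry[OF D1 D2 D] by metis
  have "W * \<rho> D z = W * \<rho> D1 (\<rho> D2 z)"
    using intertwinersD(2)[OF W(1) center_fixed[OF z]]
      center_commute[OF rho_center[OF D1 rho_center[OF D2 z]] intertwinersD(1)[OF W(1)]] by simp
  then have "adj W * W * \<rho> D z = adj W * W * \<rho> D1 (\<rho> D2 z)" by (simp add: mult.assoc)
  then show ?thesis by (simp add: W)
qed

text \<open>The right-hand side depends on the list alone, so all classes in one chain product act
  alike on the centre.\<close>

lemma rho_chain_product:
  assumes "set Ds \<subseteq> group_dual" "Ds \<noteq> []" "D \<in> chain_product Ds" "z \<in> \<Z>"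
  shows "\<rho> D z = foldr \<rho> Ds z"
  using assms
proof (induction Ds arbitrary: D rule: chain_product.induct)
  case (3 X Y Ds)
  then obtain D' where D': "D' \<in> chain_product (Y # Ds)" "D \<in> class_product X D'"
    by (auto simp: class_set_product_def)
  then have "X \<in> group_dual" "D' \<in> group_dual" using 3(2) chain_product_dual[of "Y # Ds"] by auto
  then have "\<rho> D z = \<rho> X (\<rho> D' z)" using rho_class_product D'(2) 3 by blast
  also have "\<rho> D' z = foldr \<rho> (Y # Ds) z" using 3 D'(1) by simp
  finally show ?case by simp
qed simp_all

lemma rho_chain_equiv: "chain_equiv D E \<Longrightarrow> z \<in> \<Z> \<Longrightarrow> \<rho> D z = \<rho> E z"
  unfolding chain_equiv_def using rho_chain_product by metis

lemma class_automorphism_chain_class: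
  assumes "D \<in> group_dual" "z \<in> \<Z>"
  shows "class_automorphism HD (chain_class D) z = \<rho> D z"
  unfolding class_automorphism_def
proof (rule the_equality)
  show "\<forall>E\<in>chain_class D. \<rho> D z = \<rho> E z" using rho_chain_equiv assms by (simp add: chain_class_def)
\<comment> \<open>Uniqueness of the common value rests on a member of the chain class;
  \<open>D\<close> itself is one.\<close>
qed (use chain_class_self[OF assms(1)] in blast)

end

section \<open>Isotypical projections\<close>

context minimal_hilbert_system
begin

lemma center_zero: "0 \<in> \<Z>"
  by (simp add: fixed_center_def commutant_def fixed_algebra_def)

lemma center_one: "1 \<in> \<Z>"
  by (simp add: fixed_center_def commutant_def fixed_algebra_def)

lemma rho_zero: "D \<in> group_dual \<Longrightarrow> \<rho> D 0 = 0"
  using rho_sum[of D "\<lambda>_. 0" "{} :: nat set"] by simp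

lemma intertwiner_basis_mem:
  assumes D: "D \<in> group_dual" and Ws: "intertwiner_basis \<alpha> (\<rho> D) \<tau> Ws" and j: "j < length Ws"
  shows "Ws ! j \<in> intertwiners \<alpha> (\<rho> D) \<tau>"
proof -
  \<comment> \<open>Coefficients that are 1 at \<open>j\<close> and 0 elsewhere single out one basis
    element.\<close>
  define z :: "nat \<Rightarrow> 'f" where "z = (\<lambda>i. if i = j then 1 else 0)"
  have "Ws ! j = (\<Sum>i<length Ws. if i = j then Ws ! i else 0)" using j by simp
  also have "\<dots> = (\<Sum>i<length Ws. Ws ! i * \<rho> D (z i))"
    by (intro sum.cong refl) (simp add: z_def rho_one[OF D] rho_zero[OF D])
  finally have "Ws ! j = (\<Sum>i<length Ws. Ws ! i * \<rho> D (z i))" .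
  moreover have "\<forall>i<length Ws. z i \<in> \<Z>" by (simp add: z_def center_zero center_one)
  ultimately show ?thesis using Ws unfolding intertwiner_basis_def by blast
qed

lemma intertwiner_basis_absorb:
  assumes Ws: "intertwiner_basis \<alpha> \<sigma> \<tau> Ws" and X: "X \<in> intertwiners \<alpha> \<sigma> \<tau>"
  shows "(\<Sum>W\<leftarrow>Ws. W * adj W) * X = X"
proof -
  obtain z where X_eq: "X = (\<Sum>j<length Ws. Ws ! j * \<sigma> (z j))"
    using Ws X unfolding intertwiner_basis_def by blast
  have on: "orthonormal (length Ws) ((!) Ws)" using Ws by (simp add: intertwiner_basis_def orthonormal_def)
  have "(\<Sum>W\<leftarrow>Ws. W * adj W) * X = (\<Sum>i<length Ws. Ws ! i * (adj (Ws ! i) * X))"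
    by (simp add: sum_list_nth sum_distrib_right mult.assoc)
  also have "\<dots> = X"
    unfolding X_eq by (intro sum.cong refl) (simp add: orthonormal_cancel[OF on])
  finally show ?thesis .
qed

text \<open>The projection of each basis absorbs the elements of the other one, so the two products
  of the projections are the projections themselves; by self-adjointness they coincide. This makes
  the definite description in \<open>isotypical_projection\<close> unambiguous without a comparison
  of lengths.\<close>

lemma intertwiner_basis_projection:
  assumes D: "D \<in> group_dual" and Ws: "intertwiner_basis \<alpha> (\<rho> D) \<tau> Ws"
    and Vs: "intertwiner_basis \<alpha> (\<rho> D) \<tau> Vs"
  shows "(\<Sum>W\<leftarrow>Ws. W * adj W) = (\<Sum>V\<leftarrow>Vs. V * adj V)"
proof -
  have absorb: "(\<Sum>W\<leftarrow>Ws. W * adj W) * (\<Sum>V\<leftarrow>Vs. V * adj V) = (\<Sum>V\<leftarrow>Vs. V * adj V)"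
    if "intertwiner_basis \<alpha> (\<rho> D) \<tau> Ws" "intertwiner_basis \<alpha> (\<rho> D) \<tau> Vs" for Ws Vs
  proof -
    have "(\<Sum>W\<leftarrow>Ws. W * adj W) * (Vs ! j * adj (Vs ! j)) = Vs ! j * adj (Vs ! j)"
      if "j < length Vs" for j
      using intertwiner_basis_absorb[OF \<open>intertwiner_basis \<alpha> (\<rho> D) \<tau> Ws\<close>
          intertwiner_basis_mem[OF D \<open>intertwiner_basis \<alpha> (\<rho> D) \<tau> Vs\<close> that]]
      by (simp add: mult.assoc[symmetric])
    then show ?thesis by (simp add: sum_list_nth[of _ Vs] sum_distrib_left)
  qed
  have sa: "adj (\<Sum>W\<leftarrow>Ws. W * adj W) = (\<Sum>W\<leftarrow>Ws. W * adj W)" for Ws :: "'f list"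
    by (simp add: sum_list_nth adj_sum adj_mult adj_adj)
  have "(\<Sum>V\<leftarrow>Vs. V * adj V) = adj ((\<Sum>W\<leftarrow>Ws. W * adj W) * (\<Sum>V\<leftarrow>Vs. V * adj V))"
    by (simp add: absorb[OF Ws Vs] sa)
  also have "\<dots> = (\<Sum>V\<leftarrow>Vs. V * adj V) * (\<Sum>W\<leftarrow>Ws. W * adj W)"
    by (simp add: adj_mult sa)
  also have "\<dots> = (\<Sum>W\<leftarrow>Ws. W * adj W)" by (rule absorb[OF Vs Ws])
  finally show ?thesis ..
qed

text \<open>The coefficients \<open>adj (W k) * X\<close> of an intertwiner vanish where
  \<open>Ds k\<close> differs from \<open>D\<close> and lie in the image of the centre where it
  equals \<open>D\<close>: these are the two cases of Schur's lemma. Conversely,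
  \<open>\<rho> D\<close> of a central element commutes with \<open>\<rho> D A\<close> for fixed
  \<open>A\<close>, so right multiplication by it preserves intertwiners.\<close>

lemma decomposition_intertwiner_basis:
  assumes dec: "decomposition \<tau> K W Ds" and D: "D \<in> group_dual"
    and \<tau>: "\<And>A. \<tau> (adj A) = adj (\<tau> A)" "\<tau> 1 = 1"
  defines "ks \<equiv> filter (\<lambda>k. Ds k = D) [0..<K]"
  shows "intertwiner_basis \<alpha> (\<rho> D) \<tau> (map W ks)"
proof -
  have ks: "distinct ks" "set ks = {k. k < K \<and> Ds k = D}" by (auto simp: ks_def)
  have ksD: "ks ! j < K" "Ds (ks ! j) = D" if "j < length ks" for j
    using that ks(2) nth_mem[OF that] by auto
  have reindex: "(\<Sum>k\<in>set ks. f k) = (\<Sum>j<length ks. f (ks ! j))" for f :: "nat \<Rightarrow> 'f"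
    using sum_list_distinct_conv_sum_set[OF ks(1), of f] by (simp add: sum_list_nth)
  have restrict: "(\<Sum>k<K. f k) = (\<Sum>k\<in>set ks. f k)" if "\<And>k. k < K \<Longrightarrow> Ds k \<noteq> D \<Longrightarrow> f k = 0" for f :: "nat \<Rightarrow> 'f"
    using that ks(2) by (intro sum.mono_neutral_right) auto
  have "adj (W (ks ! j)) * W (ks ! k) = (if j = k then 1 else 0)" if "j < length ks" "k < length ks" for j k
    using decompositionD(3)[OF dec ksD(1)[OF that(1)] ksD(1)[OF that(2)]] nth_eq_iff_index_eq[OF ks(1) that]
    by simp
  moreover have "intertwiners \<alpha> (\<rho> D) \<tau> =
      {\<Sum>j<length ks. W (ks ! j) * \<rho> D (z j) | z. \<forall>j<length ks. z j \<in> \<Z>}" (is "_ = ?R")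
  proof (intro Set.set_eqI iffI)
    fix X assume X: "X \<in> intertwiners \<alpha> (\<rho> D) \<tau>"
    note c = decomposition_coefficient[OF dec \<tau>(1) X]
    have "\<forall>k\<in>set ks. \<exists>z\<in>\<Z>. adj (W k) * X = \<rho> D z"
    proof
      fix k assume "k \<in> set ks"
      then have "adj (W k) * X \<in> intertwiners \<alpha> (\<rho> D) (\<rho> D)" using c[of k] ks(2) by auto
      then show "\<exists>z\<in>\<Z>. adj (W k) * X = \<rho> D z" using intertwiner_same[OF D] by metis
    qed
    then obtain z where z: "\<And>k. k \<in> set ks \<Longrightarrow> z k \<in> \<Z> \<and> adj (W k) * X = \<rho> D (z k)" by metis
    have "X = (\<Sum>k<K. W k * (adj (W k) * X))" by (rule decomposition_expand[OF dec \<tau>(2)])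
    also have "\<dots> = (\<Sum>k\<in>set ks. W k * (adj (W k) * X))"
    proof (rule restrict)
      fix k assume "k < K" "Ds k \<noteq> D"
      then have "adj (W k) * X = 0"
        using intertwiner_distinct[OF D decompositionD(1)[OF dec] _ c] by metis
      then show "W k * (adj (W k) * X) = 0" by simp
    qed
    also have "\<dots> = (\<Sum>k\<in>set ks. W k * \<rho> D (z k))" by (intro sum.cong refl) (simp add: z)
    also have "\<dots> = (\<Sum>j<length ks. W (ks ! j) * \<rho> D (z (ks ! j)))" by (rule reindex)
    finally show "X \<in> ?R" using z by (intro CollectI exI[of _ "\<lambda>j. z (ks ! j)"]) auto
  next
    fix X assume "X \<in> ?R"
    then obtain z where z: "\<And>j. j < length ks \<Longrightarrow> z j \<in> \<Z>" and X: "X = (\<Sum>j<length ks. W (ks ! j) * \<rho> D (z j))"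
      by blast
    have W: "W (ks ! j) \<in> intertwiners \<alpha> (\<rho> D) \<tau>" if "j < length ks" for j
      using decompositionD(2)[OF dec ksD(1)[OF that]] ksD(2)[OF that] by simp
    show "X \<in> intertwiners \<alpha> (\<rho> D) \<tau>"
    proof (rule intertwinersI)
      show "X \<in> \<A>"
        unfolding X
        by (intro fixed_sum fixed_mult intertwinersD(1)[OF W] rho_fixed[OF D] center_fixed[OF z]) auto
      fix A assume A: "A \<in> \<A>"
      have "W (ks ! j) * \<rho> D (z j) * \<rho> D A = \<tau> A * (W (ks ! j) * \<rho> D (z j))" if j: "j < length ks" for j
      proof -
        have "W (ks ! j) * \<rho> D (z j) * \<rho> D A = W (ks ! j) * \<rho> D A * \<rho> D (z j)"
          by (simp add: mult.assoc rho_mult[OF D, symmetric] center_commute[OF z[OF j] A])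
        then show ?thesis by (simp add: intertwinersD(2)[OF W[OF j] A] mult.assoc)
      qed
      then show "X * \<rho> D A = \<tau> A * X" unfolding X by (simp add: sum_distrib_left sum_distrib_right)
    qed
  qed
  ultimately show ?thesis by (simp add: intertwiner_basis_def cong: conj_cong)
qed

lemma isotypical_projection_eq:
  assumes dec: "decomposition (canonical_endo H) K W Ds" and occ: "D \<in> occurring \<alpha> H"
    and adj: "\<And>A. canonical_endo H (adj A) = adj (canonical_endo H A)" and one: "canonical_endo H 1 = 1"
  shows "isotypical_projection \<alpha> HD H D = (\<Sum>k | k < K \<and> Ds k = D. W k * adj (W k))"
proof -
  have D: "D \<in> group_dual" using occ by (simp add: occurring_def)
  define ks where "ks = filter (\<lambda>k. Ds k = D) [0..<K]"
  have B: "intertwiner_basis \<alpha> (\<rho> D) (canonical_endo H) (map W ks)"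
    unfolding ks_def by (rule decomposition_intertwiner_basis[OF dec D adj one])
  have "isotypical_projection \<alpha> HD H D = (\<Sum>V\<leftarrow>map W ks. V * adj V)"
    unfolding isotypical_projection_def if_P[OF occ]
    by (rule the_equality) (use B intertwiner_basis_projection[OF D _ B] in blast)+
  also have "\<dots> = (\<Sum>k\<leftarrow>ks. W k * adj (W k))" by (simp add: comp_def)
  also have "\<dots> = (\<Sum>k\<in>set ks. W k * adj (W k))"
    by (rule sum_list_distinct_conv_sum_set) (simp add: ks_def)
  also have "set ks = {k. k < K \<and> Ds k = D}" by (auto simp: ks_def)
  finally show ?thesis .
qed

lemma canonical_endo_center:
  assumes H: "algebraic_hilbert_space H" and inv: "invariant_subset \<alpha> H" and z: "z \<in> \<Z>"
  shows "canonical_endo H z = (\<Sum>c\<in>chain_class ` occurring \<alpha> H. class_automorphism HD c z *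
    (\<Sum>D\<in>c \<inter> occurring \<alpha> H. isotypical_projection \<alpha> HD H D))"
proof -
  let ?O = "occurring \<alpha> H"
  obtain \<Phi> where \<Phi>: "orthonormal_basis H \<Phi>" using H by (auto simp: algebraic_hilbert_space_def)
  note M = hilbert_space_multiplet[OF H inv]
  have \<tau>: "canonical_endo H = endo (length \<Phi>) ((!) \<Phi>)" using M(2)[OF \<Phi>] by auto
  obtain K W Ds where dec: "decomposition (canonical_endo H) K W Ds"
    and occ: "\<forall>k<K. occurs_in_rep (Ds k) (carried_rep \<alpha> \<Phi>)"
    unfolding \<tau> by (rule multiplet_decomposition[OF M(1)[OF \<Phi>]])
  have adj: "canonical_endo H (adj A) = adj (canonical_endo H A)" for A by (simp add: \<tau> endo_adj)
  have one: "canonical_endo H 1 = 1" using M(1)[OF \<Phi>] by (simp add: \<tau> multiplet_def)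
  \<comment> \<open>\<open>occurring\<close> admits any orthonormal basis of \<open>H\<close>, while
    the decomposition comes from one of them. Both are compared through intertwiners, which do not
    depend on the basis.\<close>
  have occ_eq: "?O = Ds ` {..<K}"
  proof (intro Set.set_eqI iffI)
    fix D assume "D \<in> ?O"
    then obtain \<Psi> where D: "D \<in> group_dual" and \<Psi>: "orthonormal_basis H \<Psi>"
      "occurs_in_rep D (carried_rep \<alpha> \<Psi>)"
      by (auto simp: occurring_def)
    have e: "endo (length \<Psi>) ((!) \<Psi>) = canonical_endo H" using M(2)[OF \<Psi>(1)] by auto
    obtain X where X: "X \<in> intertwiners \<alpha> (\<rho> D) (canonical_endo H)" "adj X * X = 1"
      using occurs_isometry[OF M(1)[OF \<Psi>(1)] D \<Psi>(2)] unfolding e by metis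
    have "X \<noteq> 0" using X(2) by auto
    then obtain k where k: "k < K" "adj (W k) * X \<noteq> 0"
      using decomposition_coefficient_nonzero[OF dec one] by metis
    have "Ds k = D"
      using intertwiner_distinct[OF D decompositionD(1)[OF dec k(1)] _
          decomposition_coefficient[OF dec adj X(1) k(1)]] k(2) by metis
    then show "D \<in> Ds ` {..<K}" using k(1) by auto
  next
    fix D assume "D \<in> Ds ` {..<K}"
    then show "D \<in> ?O" using occ \<Phi> decompositionD(1)[OF dec] by (auto simp: occurring_def)
  qed
  have fin: "finite ?O" by (simp add: occ_eq)
  have dual: "D \<in> group_dual" if "D \<in> ?O" for D using that by (simp add: occurring_def)
  \<comment> \<open>Chain equivalence is an equivalence relation, so the occurring classes with a
    given image under \<open>chain_class\<close> are exactly the occurring members of that chain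
    class.\<close>
  have fiber: "{D \<in> ?O. chain_class D = c} = c \<inter> ?O" if c: "c \<in> chain_class ` ?O" for c
  proof -
    obtain E where E: "E \<in> ?O" "c = chain_class E" using c by auto
    have "chain_class D = c \<longleftrightarrow> D \<in> c" if "D \<in> ?O" for D
    proof
      show "D \<in> c" if "chain_class D = c" using chain_class_self[OF dual[OF \<open>D \<in> ?O\<close>]] that by simp
      show "chain_class D = c" if "D \<in> c"
        using that chain_class_eq[of E D] by (simp add: E(2) chain_class_def[of E])
    qed
    then show ?thesis by auto
  qed
  have "canonical_endo H z = (\<Sum>k<K. \<rho> (Ds k) z * (W k * adj (W k)))"
    unfolding decompositionD(4)[OF dec, symmetric]
  proof (intro sum.cong refl)
    fix k assume "k \<in> {..<K}"
    then have "k < K" by simp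
    \<comment> \<open>A central value and a fixed isometry commute, so the value moves to the left
      and the range projection remains.\<close>
    have "\<rho> (Ds k) z * W k = W k * \<rho> (Ds k) z"
      by (rule center_commute[OF rho_center[OF decompositionD(1)[OF dec \<open>k < K\<close>] z]
            intertwinersD(1)[OF decompositionD(2)[OF dec \<open>k < K\<close>]]])
    then show "W k * \<rho> (Ds k) z * adj (W k) = \<rho> (Ds k) z * (W k * adj (W k))"
      by (simp add: mult.assoc[symmetric])
  qed
  \<comment> \<open>Grouping the indices by class makes the range projections add up to isotypical
    projections; a second grouping, by chain class, follows.\<close>
  also have "\<dots> = (\<Sum>D\<in>?O. \<Sum>k | k \<in> {..<K} \<and> Ds k = D. \<rho> (Ds k) z * (W k * adj (W k)))"
    unfolding occ_eq by (rule sum.image_gen) simp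
  also have "\<dots> = (\<Sum>D\<in>?O. \<rho> D z * isotypical_projection \<alpha> HD H D)"
    by (intro sum.cong refl) (simp add: isotypical_projection_eq[OF dec _ adj one] sum_distrib_left)
  also have "\<dots> = (\<Sum>c\<in>chain_class ` ?O. \<Sum>D | D \<in> ?O \<and> chain_class D = c. \<rho> D z * isotypical_projection \<alpha> HD H D)"
    by (rule sum.image_gen[OF fin])
  also have "\<dots> = (\<Sum>c\<in>chain_class ` ?O. class_automorphism HD c z *
      (\<Sum>D\<in>c \<inter> ?O. isotypical_projection \<alpha> HD H D))"
  proof (intro sum.cong refl)
    fix c assume c: "c \<in> chain_class ` ?O"
    have "(\<Sum>D | D \<in> ?O \<and> chain_class D = c. \<rho> D z * isotypical_projection \<alpha> HD H D) =
        (\<Sum>D | D \<in> ?O \<and> chain_class D = c. class_automorphism HD c z * isotypical_projection \<alpha> HD H D)"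
      using class_automorphism_chain_class[OF dual z] by (intro sum.cong refl) auto
    then show "(\<Sum>D | D \<in> ?O \<and> chain_class D = c. \<rho> D z * isotypical_projection \<alpha> HD H D) =
        class_automorphism HD c z * (\<Sum>D\<in>c \<inter> ?O. isotypical_projection \<alpha> HD H D)"
      unfolding fiber[OF c] by (simp add: sum_distrib_left)
  qed
  finally show ?thesis .
qed

end

theorem theorem5p9:
  fixes \<alpha> :: "'g::{topological_group_add, t2_space} \<Rightarrow> 'f::cstar_algebra \<Rightarrow> 'f"
    and \<mu> :: "'g measure"
    and HD :: "'g rep set \<Rightarrow> 'f set"
    and H :: "'f set"
  assumes "hilbert_cstar_system \<mu> \<alpha> HD"
    and "minimal_system \<alpha>"
    and "\<exists>g h :: 'g. g + h \<noteq> h + g"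
    and "property_B (fixed_algebra \<alpha>)"
    and "algebraic_hilbert_space H" and "invariant_subset \<alpha> H"
    and "Z \<in> fixed_center \<alpha>"
  shows "canonical_endo H Z =
    (\<Sum>c\<in>chain_class ` occurring \<alpha> H.
       class_automorphism HD c Z * (\<Sum>D\<in>c \<inter> occurring \<alpha> H. isotypical_projection \<alpha> HD H D))"
proof -
  interpret minimal_hilbert_system \<alpha> HD
    using assms(1,2) by unfold_locales (auto simp: hilbert_cstar_system_def)
  show ?thesis using assms(5-7) by (rule canonical_endo_center)
qed

end
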